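(* The monoid $K^{1,1}_0(\mathbb Z,\mathrm{id}_{\mathbb Z},1)$ is not a group.
   Context: Wall anti-structures: a Wall anti-structure $(R,\alpha,\varepsilon)$ is a ring $R$, an additive map $\alpha\colon R\to R$ with $\alpha(rs)=\alpha(s)\alpha(r)$, and a unit $\varepsilon$ with $\alpha^2(r)=\varepsilon r\varepsilon^{-1}$ and $\alpha(\varepsilon)=\varepsilon^{-1}$. $P(R,\alpha,\varepsilon)$ is the (essentially small) category of finitely generated projective right $R$-modules with duality functor $T=\mathrm{Hom}_R(-,R)$, where $(fr)(p)=\alpha(r)f(p)$, and with natural isomorphism $\eta_P\colon P\to TTP$, $\eta_P(p)(f)=\alpha(f(p))\varepsilon$. Strictification: for a category with duality $(\mathscr C,T,\eta)$, $\mathscr D\mathscr C$ has objects the triples $(c,c',f)$ with $f\colon c'\to Tc$ an isomorphism. Maps $(c,c',f)\to(d,d',g)$ are pairs $(r\colon c\to d,\,s\colon d'\to c')$ with $f\circ s=Tr\circ g$. The strict duality sends $(c,c',f)$ to $(c',c,Tf\circ\eta_c)$ and $(r,s)$ to $(s,r)$. Let $\mathscr A=\mathscr DP(R,\alpha,\varepsilon)$, an additive category with strict duality, also denoted $T$, pointed by the zero object $(0,0,0)$, which is fixed by the duality; let $i$ denote the subcategory of isomorphisms, taken as weak equivalences. Sum-diagrams: for a finite pointed set $X$, $Q(X)$ is the category whose objects are the pointed subsets of $X$; morphisms $U\to V$ are the pointed subsets of $U\cap V$; composition is intersection. $\mathscr A(X)$ is the category of functors $A\colon Q(X)\to\mathscr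 A$ with $A(\{\ast\})=0$ such that, for every $U$, the maps $A(U)\to A(\{u,\ast\})$, $u\in U\setminus\{\ast\}$, induced by $\{u,\ast\}\subseteq U$ exhibit $A(U)$ as a product. $i\mathscr A(X)$ is its subcategory of isomorphisms. A pointed map $f\colon X\to Y$ induces $f_\ast$ by $(f_\ast A)(U)=A(f^{-1}(U\setminus\{\ast\})\cup\{\ast\})$. A pointed involution $\sigma$ of $X$ induces the strict duality $(T_XA)(U)=T(A(\sigma(U)))$ on $i\mathscr A(X)$. The $C_2$-space: $S^{1,1}=\Delta^1/\partial\Delta^1$ with the involution in degree $m$ induced by $\xi\mapsto\omega_1\circ\xi\circ\omega_m$ on $\Delta^1_m=\mathrm{Hom}_\Delta([m],[1])$ ($\omega_k$ the order reversal of $[k]$); $T_m$ is the resulting duality on $i\mathscr A(S^{1,1}_m)$. $C_2$ acts on the realization $|Ni\mathscr A(S^{1,1})|$ of the bisimplicial set $(m,n)\mapsto N_ni\mathscr A(S^{1,1}_m)$ by sending $(A_0\to\dots\to A_n)$ to $(T_mA_n\to\dots\to T_mA_0)$ and reversing the simplex coordinates in both directions. For a based $C_2$-space $Y$, $\Omega^{1,1}Y$ is the space of based maps from $[0,1]/\{0,1\}$ (action $t\mapsto1-t$) to $Y$, with conjugation action. Set $$K^{1,1}(R,\alpha,\varepsilon)=(\Omega^{1,1}|Ni\mathscr A(S^{1,1})|)^{C_2},\qquad K^{1,1}_n(R,\alpha,\varepsilon)=\pi_nK^{1,1}(R,\alpha,\varepsilon).$$ $K^{1,1}_0$ is a monoid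 under the operation induced by direct sum of sum-diagrams. Equivalently, this operation is induced by the levelwise equivalence $i\mathscr A(S^{1,1}\vee S^{1,1})\to i\mathscr A(S^{1,1})\times i\mathscr A(S^{1,1})$ of categories with duality together with the fold map. *)

theory Defs
  imports "HOL-Algebra.Group" "HOL-Homology.Simplices"
begin

section \<open>Right modules and the duality \<open>Hom(-,R)\<close>\<close>

definition wall_antistructure :: "('r::ring_1 \<Rightarrow> 'r) \<Rightarrow> 'r \<Rightarrow> bool" where
  "wall_antistructure \<alpha> \<epsilon> \<longleftrightarrow>
     (\<forall>r s. \<alpha> (r + s) = \<alpha> r + \<alpha> s) \<and> (\<forall>r s. \<alpha> (r * s) = \<alpha> s * \<alpha> r) \<and>
     (\<exists>\<epsilon>'. \<epsilon> * \<epsilon>' = 1 \<and> \<epsilon>' * \<epsilon> = 1 \<and> (\<forall>r. \<alpha> (\<alpha> r) = \<epsilon> * r * \<epsilon>') \<and> \<alpha> \<epsilon> = \<epsilon>')"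

lemma wall_antistructure_id: "wall_antistructure (id :: 'r::comm_ring_1 \<Rightarrow> 'r) 1"
  by (auto simp: wall_antistructure_def intro!: exI[of _ 1])

text \<open>The underlying abelian group of a right module is written multiplicatively (HOL-Algebra's
  \<open>comm_group\<close>); \<open>ract M x r\<close> is the product \<open>x r\<close>.\<close>

record ('a, 'r) rmod = "'a monoid" + ract :: "'a \<Rightarrow> 'r \<Rightarrow> 'a"

definition right_module :: "('a, 'r::ring_1) rmod \<Rightarrow> bool" where
  "right_module M \<longleftrightarrow> comm_group M \<and>
     (\<forall>x\<in>carrier M. \<forall>r. ract M x r \<in> carrier M) \<and>
     (\<forall>x\<in>carrier M. \<forall>y\<in>carrier M. \<forall>r. ract M (x \<otimes>\<^bsub>M\<^esub> y) r = ract M x r \<otimes>\<^bsub>M\<^esub> ract M y r) \<and>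
     (\<forall>x\<in>carrier M. \<forall>r s. ract M x (r + s) = ract M x r \<otimes>\<^bsub>M\<^esub> ract M x s) \<and>
     (\<forall>x\<in>carrier M. \<forall>r s. ract M x (r * s) = ract M (ract M x r) s) \<and>
     (\<forall>x\<in>carrier M. ract M x 1 = x)"

definition rhom :: "('a, 'r::ring_1) rmod \<Rightarrow> ('b, 'r) rmod \<Rightarrow> ('a \<Rightarrow> 'b) set" where
  "rhom M N = {f \<in> carrier M \<rightarrow>\<^sub>E carrier N.
     (\<forall>x\<in>carrier M. \<forall>y\<in>carrier M. f (x \<otimes>\<^bsub>M\<^esub> y) = f x \<otimes>\<^bsub>N\<^esub> f y) \<and>
     (\<forall>x\<in>carrier M. \<forall>r. f (ract M x r) = ract N (f x) r)}"

definition regular_rmod :: "('r::ring_1, 'r) rmod" where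
  "regular_rmod = \<lparr>carrier = UNIV, mult = (+), one = 0, ract = (*)\<rparr>"

definition free_rmod :: "nat \<Rightarrow> (nat \<Rightarrow> 'r::ring_1, 'r) rmod" where
  "free_rmod n = \<lparr>carrier = {v. \<forall>i\<ge>n. v i = 0}, mult = (\<lambda>v w i. v i + w i), one = (\<lambda>i. 0),
     ract = (\<lambda>v r i. v i * r)\<rparr>"

text \<open>Finitely generated projective: a retract (equivalently, a direct summand) of some \<open>R\<^sup>n\<close>.\<close>

definition fg_projective :: "('a, 'r::ring_1) rmod \<Rightarrow> bool" where
  "fg_projective P \<longleftrightarrow> right_module P \<and>
     (\<exists>n. \<exists>i \<in> rhom P (free_rmod n). \<exists>p \<in> rhom (free_rmod n) P. \<forall>x\<in>carrier P. p (i x) = x)"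

definition dual_rmod :: "('r::ring_1 \<Rightarrow> 'r) \<Rightarrow> ('a, 'r) rmod \<Rightarrow> ('a \<Rightarrow> 'r, 'r) rmod" where
  "dual_rmod \<alpha> P = \<lparr>carrier = rhom P regular_rmod,
     mult = (\<lambda>f g. \<lambda>p\<in>carrier P. f p + g p), one = (\<lambda>p\<in>carrier P. 0),
     ract = (\<lambda>f r. \<lambda>p\<in>carrier P. \<alpha> r * f p)\<rparr>"

text \<open>For \<open>r : P \<rightarrow> Q\<close>, the map \<open>T r : T Q \<rightarrow> T P\<close>.\<close>

definition dual_map ::
  "('r::ring_1 \<Rightarrow> 'r) \<Rightarrow> ('a, 'r) rmod \<Rightarrow> ('b, 'r) rmod \<Rightarrow> ('a \<Rightarrow> 'b) \<Rightarrow> (('b \<Rightarrow> 'r) \<Rightarrow> 'a \<Rightarrow> 'r)" where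
  "dual_map \<alpha> P Q r = (\<lambda>g\<in>carrier (dual_rmod \<alpha> Q). compose (carrier P) g r)"

definition dual_eta ::
  "('r::ring_1 \<Rightarrow> 'r) \<Rightarrow> 'r \<Rightarrow> ('a, 'r) rmod \<Rightarrow> ('a \<Rightarrow> (('a \<Rightarrow> 'r) \<Rightarrow> 'r))" where
  "dual_eta \<alpha> \<epsilon> P = (\<lambda>p\<in>carrier P. \<lambda>f\<in>carrier (dual_rmod \<alpha> P). \<alpha> (f p) * \<epsilon>)"

section \<open>Categories with strict duality\<close>

text \<open>\<open>cmp C a b c g f\<close> is the composite of \<open>f : a \<rightarrow> b\<close> and \<open>g : b \<rightarrow> c\<close>, and \<open>dmor C a b f\<close> is
  the dual \<open>T b \<rightarrow> T a\<close> of \<open>f : a \<rightarrow> b\<close>. The distinguished zero object \<open>zob\<close> and the chosen direct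
  sum (\<open>osum\<close> on objects; \<open>msum C a b a' b' f f'\<close> for \<open>f : a \<rightarrow> b\<close> and \<open>f' : a' \<rightarrow> b'\<close>) are part of
  the data. For the categories below they commute with the duality on the nose.\<close>

record ('o, 'm) dcat =
  ob :: "'o set"
  hom :: "'o \<Rightarrow> 'o \<Rightarrow> 'm set"
  idt :: "'o \<Rightarrow> 'm"
  cmp :: "'o \<Rightarrow> 'o \<Rightarrow> 'o \<Rightarrow> 'm \<Rightarrow> 'm \<Rightarrow> 'm"
  dob :: "'o \<Rightarrow> 'o"
  dmor :: "'o \<Rightarrow> 'o \<Rightarrow> 'm \<Rightarrow> 'm"
  zob :: "'o"
  osum :: "'o \<Rightarrow> 'o \<Rightarrow> 'o"
  msum :: "'o \<Rightarrow> 'o \<Rightarrow> 'o \<Rightarrow> 'o \<Rightarrow> 'm \<Rightarrow> 'm \<Rightarrow> 'm"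

definition iso_cat :: "('o, 'm) dcat \<Rightarrow> ('o, 'm) dcat" where
  "iso_cat C = C \<lparr>hom := (\<lambda>a b. {f \<in> hom C a b.
     \<exists>g \<in> hom C b a. cmp C a b a g f = idt C a \<and> cmp C b a b f g = idt C b})\<rparr>"

definition is_product ::
  "('o, 'm) dcat \<Rightarrow> 'o \<Rightarrow> 'i set \<Rightarrow> ('i \<Rightarrow> 'o) \<Rightarrow> ('i \<Rightarrow> 'm) \<Rightarrow> bool" where
  "is_product C p I a \<pi> \<longleftrightarrow> p \<in> ob C \<and> (\<forall>i\<in>I. a i \<in> ob C \<and> \<pi> i \<in> hom C p (a i)) \<and>
     (\<forall>z\<in>ob C. \<forall>h. (\<forall>i\<in>I. h i \<in> hom C z (a i)) \<longrightarrow>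
        (\<exists>!k. k \<in> hom C z p \<and> (\<forall>i\<in>I. cmp C z p (a i) (\<pi> i) k = h i)))"

section \<open>The strictification of \<open>P(R,\<alpha>,\<epsilon>)\<close>\<close>

text \<open>\<open>P(R,\<alpha>,\<epsilon>)\<close> is only essentially small. Its small model has as objects all finitely generated
  projective modules whose carrier is a subset of \<open>nat \<Rightarrow> 'r\<close>. Up to isomorphism these are all
  finitely generated projective modules, since each embeds in some \<open>R\<^sup>n\<close>. In an object \<open>(c, c', f)\<close>
  with \<open>f : c' \<rightarrow> T c\<close> the modules \<open>c\<close> and \<open>c'\<close> are taken from this model, whereas \<open>T c\<close> is literally
  the module \<open>Hom(c, R)\<close> of functions on \<open>c\<close>, so no identification of \<open>T c\<close> with an object of the
  model has to be chosen.

  Direct sums are formed with the bijection \<open>fpair\<close>, which sends the pair of zero functions to the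
  zero function; hence \<open>0 \<oplus> 0 = 0\<close> holds strictly.\<close>

type_synonym 'r vmod = "(nat \<Rightarrow> 'r, 'r) rmod"
type_synonym 'r dpob = "'r vmod \<times> 'r vmod \<times> ((nat \<Rightarrow> 'r) \<Rightarrow> (nat \<Rightarrow> 'r) \<Rightarrow> 'r)"
type_synonym 'r dpmor = "((nat \<Rightarrow> 'r) \<Rightarrow> (nat \<Rightarrow> 'r)) \<times> ((nat \<Rightarrow> 'r) \<Rightarrow> (nat \<Rightarrow> 'r))"

definition fpair :: "(nat \<Rightarrow> 'r) \<Rightarrow> (nat \<Rightarrow> 'r) \<Rightarrow> (nat \<Rightarrow> 'r)" where
  "fpair v w = (\<lambda>n. if even n then v (n div 2) else w (n div 2))"

definition ffst :: "(nat \<Rightarrow> 'r) \<Rightarrow> (nat \<Rightarrow> 'r)" where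
  "ffst x = (\<lambda>n. x (2 * n))"

definition fsnd :: "(nat \<Rightarrow> 'r) \<Rightarrow> (nat \<Rightarrow> 'r)" where
  "fsnd x = (\<lambda>n. x (2 * n + 1))"

definition zero_rmod :: "'r::ring_1 vmod" where
  "zero_rmod = \<lparr>carrier = {\<lambda>_. 0}, mult = (\<lambda>_ _ _. 0), one = (\<lambda>_. 0), ract = (\<lambda>_ _ _. 0)\<rparr>"

definition sum_rmod :: "'r::ring_1 vmod \<Rightarrow> 'r vmod \<Rightarrow> 'r vmod" where
  "sum_rmod P Q = \<lparr>carrier = {x. ffst x \<in> carrier P \<and> fsnd x \<in> carrier Q},
     mult = (\<lambda>x y. fpair (ffst x \<otimes>\<^bsub>P\<^esub> ffst y) (fsnd x \<otimes>\<^bsub>Q\<^esub> fsnd y)),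
     one = fpair \<one>\<^bsub>P\<^esub> \<one>\<^bsub>Q\<^esub>,
     ract = (\<lambda>x r. fpair (ract P (ffst x) r) (ract Q (fsnd x) r))\<rparr>"

definition sum_rhom :: "'r::ring_1 vmod \<Rightarrow> 'r vmod \<Rightarrow>
    ((nat \<Rightarrow> 'r) \<Rightarrow> (nat \<Rightarrow> 'r)) \<Rightarrow> ((nat \<Rightarrow> 'r) \<Rightarrow> (nat \<Rightarrow> 'r)) \<Rightarrow> ((nat \<Rightarrow> 'r) \<Rightarrow> (nat \<Rightarrow> 'r))" where
  "sum_rhom P Q r s = (\<lambda>x\<in>carrier (sum_rmod P Q). fpair (r (ffst x)) (s (fsnd x)))"

definition DP_ob :: "('r::ring_1 \<Rightarrow> 'r) \<Rightarrow> 'r dpob set" where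
  "DP_ob \<alpha> = {(c, c', f). fg_projective c \<and> fg_projective c' \<and>
     f \<in> rhom c' (dual_rmod \<alpha> c) \<and> bij_betw f (carrier c') (carrier (dual_rmod \<alpha> c))}"

definition DP_hom :: "('r::ring_1 \<Rightarrow> 'r) \<Rightarrow> 'r dpob \<Rightarrow> 'r dpob \<Rightarrow> 'r dpmor set" where
  "DP_hom \<alpha> = (\<lambda>(c, c', f) (d, d', g). {(r, s). r \<in> rhom c d \<and> s \<in> rhom d' c' \<and>
     compose (carrier d') f s = compose (carrier d') (dual_map \<alpha> c d r) g})"

definition DP_dual :: "('r::ring_1 \<Rightarrow> 'r) \<Rightarrow> 'r \<Rightarrow> 'r dpob \<Rightarrow> 'r dpob" where
  "DP_dual \<alpha> \<epsilon> = (\<lambda>(c, c', f).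
     (c', c, compose (carrier c) (dual_map \<alpha> c' (dual_rmod \<alpha> c) f) (dual_eta \<alpha> \<epsilon> c)))"

text \<open>In the direct sum of \<open>(c, c', f)\<close> and \<open>(d, d', g)\<close> the third entry is \<open>f \<oplus> g\<close> followed by the
  canonical isomorphism \<open>T c \<oplus> T d \<cong> T (c \<oplus> d)\<close>.\<close>

definition DP_sum :: "'r::ring_1 dpob \<Rightarrow> 'r dpob \<Rightarrow> 'r dpob" where
  "DP_sum = (\<lambda>(c, c', f) (d, d', g). (sum_rmod c d, sum_rmod c' d',
     \<lambda>w\<in>carrier (sum_rmod c' d'). \<lambda>z\<in>carrier (sum_rmod c d).
       f (ffst w) (ffst z) + g (fsnd w) (fsnd z)))"

definition DP :: "('r::ring_1 \<Rightarrow> 'r) \<Rightarrow> 'r \<Rightarrow> ('r dpob, 'r dpmor) dcat" where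
  "DP \<alpha> \<epsilon> = \<lparr>
     ob = DP_ob \<alpha>,
     hom = DP_hom \<alpha>,
     idt = (\<lambda>(c, c', f). (\<lambda>x\<in>carrier c. x, \<lambda>x\<in>carrier c'. x)),
     cmp = (\<lambda>(c, c', f) (d, d', g) (e, e', h) (r\<^sub>2, s\<^sub>2) (r\<^sub>1, s\<^sub>1).
              (compose (carrier c) r\<^sub>2 r\<^sub>1, compose (carrier e') s\<^sub>1 s\<^sub>2)),
     dob = DP_dual \<alpha> \<epsilon>,
     dmor = (\<lambda>_ _ (r, s). (s, r)),
     zob = (zero_rmod, zero_rmod,
            \<lambda>w\<in>carrier zero_rmod. \<lambda>z\<in>carrier zero_rmod. 0),
     osum = DP_sum,
     msum = (\<lambda>(a, a', _) (b, b', _) (c, c', _) (d, d', _) (r, s) (t, u).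
              (sum_rhom a c r t, sum_rhom b' d' s u))\<rparr>"

section \<open>Sum-diagrams\<close>

text \<open>A pointed set is a subset of an option type that contains the base point \<open>None\<close>. A morphism
  \<open>U \<rightarrow> V\<close> of \<open>Q(X)\<close> is encoded as a triple \<open>(U, V, W)\<close> with \<open>W\<close> a pointed subset of \<open>U \<inter> V\<close>. A
  functor on \<open>Q(X)\<close> is a pair of functions on objects and on morphisms, undefined outside \<open>Q(X)\<close>, so
  that equality of functors is equality of pairs.\<close>

definition QOb :: "'x option set \<Rightarrow> 'x option set set" where
  "QOb X = {U. U \<subseteq> X \<and> None \<in> U}"

definition QMor :: "'x option set \<Rightarrow> ('x option set \<times> 'x option set \<times> 'x option set) set" where
  "QMor X = {(U, V, W). U \<in> QOb X \<and> V \<in> QOb X \<and> W \<in> QOb (U \<inter> V)}"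

type_synonym ('x, 'o, 'm) diag =
  "('x option set \<Rightarrow> 'o) \<times> ('x option set \<times> 'x option set \<times> 'x option set \<Rightarrow> 'm)"

definition Qfunctor :: "('o, 'm) dcat \<Rightarrow> 'x option set \<Rightarrow> ('x, 'o, 'm) diag \<Rightarrow> bool" where
  "Qfunctor C X A \<longleftrightarrow> fst A \<in> QOb X \<rightarrow>\<^sub>E ob C \<and> snd A \<in> extensional (QMor X) \<and>
     (\<forall>(U, V, W) \<in> QMor X. snd A (U, V, W) \<in> hom C (fst A U) (fst A V)) \<and>
     (\<forall>U \<in> QOb X. snd A (U, U, U) = idt C (fst A U)) \<and>
     (\<forall>U V V' W W'. (U, V, W) \<in> QMor X \<and> (V, V', W') \<in> QMor X \<longrightarrow>
        snd A (U, V', W \<inter> W') =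
          cmp C (fst A U) (fst A V) (fst A V') (snd A (V, V', W')) (snd A (U, V, W)))"

definition sum_diagrams :: "('o, 'm) dcat \<Rightarrow> 'x option set \<Rightarrow> ('x, 'o, 'm) diag set" where
  "sum_diagrams C X = {A. Qfunctor C X A \<and> fst A {None} = zob C \<and>
     (\<forall>U \<in> QOb X. is_product C (fst A U) (U - {None}) (\<lambda>u. fst A {u, None})
        (\<lambda>u. snd A (U, {u, None}, {u, None})))}"

definition diag_hom :: "('o, 'm) dcat \<Rightarrow> 'x option set \<Rightarrow>
    ('x, 'o, 'm) diag \<Rightarrow> ('x, 'o, 'm) diag \<Rightarrow> ('x option set \<Rightarrow> 'm) set" where
  "diag_hom C X A B = {\<phi> \<in> extensional (QOb X).
     (\<forall>U \<in> QOb X. \<phi> U \<in> hom C (fst A U) (fst B U)) \<and>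
     (\<forall>(U, V, W) \<in> QMor X.
        cmp C (fst A U) (fst A V) (fst B V) (\<phi> V) (snd A (U, V, W)) =
        cmp C (fst A U) (fst B U) (fst B V) (snd B (U, V, W)) (\<phi> U))}"

text \<open>The dual \<open>T\<^sub>X A\<close> is \<open>U \<mapsto> T (A (\<sigma> U))\<close>; a morphism \<open>W : U \<rightarrow> V\<close> of \<open>Q(X)\<close> is also a morphism
  \<open>V \<rightarrow> U\<close>, which makes \<open>T\<^sub>X A\<close> covariant.\<close>

definition diag_dual ::
  "('o, 'm) dcat \<Rightarrow> 'x option set \<Rightarrow> ('x option \<Rightarrow> 'x option) \<Rightarrow> ('x, 'o, 'm) diag \<Rightarrow> ('x, 'o, 'm) diag" where
  "diag_dual C X \<sigma> A =
     (\<lambda>U\<in>QOb X. dob C (fst A (\<sigma> ` U)),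
      \<lambda>(U, V, W)\<in>QMor X. dmor C (fst A (\<sigma> ` V)) (fst A (\<sigma> ` U)) (snd A (\<sigma> ` V, \<sigma> ` U, \<sigma> ` W)))"

definition diag_sum ::
  "('o, 'm) dcat \<Rightarrow> 'x option set \<Rightarrow> ('x, 'o, 'm) diag \<Rightarrow> ('x, 'o, 'm) diag \<Rightarrow> ('x, 'o, 'm) diag" where
  "diag_sum C X A B =
     (\<lambda>U\<in>QOb X. osum C (fst A U) (fst B U),
      \<lambda>(U, V, W)\<in>QMor X. msum C (fst A U) (fst A V) (fst B U) (fst B V)
        (snd A (U, V, W)) (snd B (U, V, W)))"

definition diag_cat :: "('o, 'm) dcat \<Rightarrow> 'x option set \<Rightarrow> ('x option \<Rightarrow> 'x option) \<Rightarrow>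
    (('x, 'o, 'm) diag, 'x option set \<Rightarrow> 'm) dcat" where
  "diag_cat C X \<sigma> = \<lparr>
     ob = sum_diagrams C X,
     hom = diag_hom C X,
     idt = (\<lambda>A. \<lambda>U\<in>QOb X. idt C (fst A U)),
     cmp = (\<lambda>A B D \<psi> \<phi>. \<lambda>U\<in>QOb X. cmp C (fst A U) (fst B U) (fst D U) (\<psi> U) (\<phi> U)),
     dob = diag_dual C X \<sigma>,
     dmor = (\<lambda>A B \<phi>. \<lambda>U\<in>QOb X. dmor C (fst A (\<sigma> ` U)) (fst B (\<sigma> ` U)) (\<phi> (\<sigma> ` U))),
     zob = (\<lambda>U\<in>QOb X. zob C, \<lambda>_\<in>QMor X. idt C (zob C)),
     osum = diag_sum C X,
     msum = (\<lambda>A B A' B' \<phi> \<phi>'. \<lambda>U\<in>QOb X.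
       msum C (fst A U) (fst B U) (fst A' U) (fst B' U) (\<phi> U) (\<phi>' U))\<rparr>"

definition pinv :: "('x option \<Rightarrow> 'y option) \<Rightarrow> 'x option set \<Rightarrow> 'y option set \<Rightarrow> 'x option set" where
  "pinv f X U = {x \<in> X. f x \<in> U - {None}} \<union> {None}"

definition diag_push :: "('x option \<Rightarrow> 'y option) \<Rightarrow> 'x option set \<Rightarrow> 'y option set \<Rightarrow>
    ('x, 'o, 'm) diag \<Rightarrow> ('y, 'o, 'm) diag" where
  "diag_push f X Y A =
     (\<lambda>U\<in>QOb Y. fst A (pinv f X U),
      \<lambda>(U, V, W)\<in>QMor Y. snd A (pinv f X U, pinv f X V, pinv f X W))"

definition diag_push_mor ::
  "('x option \<Rightarrow> 'y option) \<Rightarrow> 'x option set \<Rightarrow> 'y option set \<Rightarrow> ('x option set \<Rightarrow> 'm) \<Rightarrow> ('y option set \<Rightarrow> 'm)" where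
  "diag_push_mor f X Y \<phi> = (\<lambda>U\<in>QOb Y. \<phi> (pinv f X U))"

section \<open>The simplicial circle \<open>\<Delta>\<^sup>1/\<partial>\<Delta>\<^sup>1\<close> with its reflection\<close>

definition sop :: "nat \<Rightarrow> nat \<Rightarrow> (nat \<Rightarrow> nat) set" where
  "sop k m = {\<theta>. mono_on {..k} \<theta> \<and> \<theta> ` {..k} \<subseteq> {..m}}"

definition Delta1 :: "nat \<Rightarrow> (nat \<Rightarrow> nat) set" where
  "Delta1 m = sop m 1 \<inter> extensional {..m}"

text \<open>The simplices of \<open>\<partial>\<Delta>\<^sup>1\<close> are the constant maps; they are collapsed to the base point.\<close>

definition circ_class :: "nat \<Rightarrow> (nat \<Rightarrow> nat) \<Rightarrow> (nat \<Rightarrow> nat) option" where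
  "circ_class m \<xi> = (if \<exists>c. \<forall>i\<le>m. \<xi> i = c then None else Some \<xi>)"

definition circ :: "nat \<Rightarrow> (nat \<Rightarrow> nat) option set" where
  "circ m = circ_class m ` Delta1 m"

definition circ_op :: "nat \<Rightarrow> (nat \<Rightarrow> nat) \<Rightarrow> (nat \<Rightarrow> nat) option \<Rightarrow> (nat \<Rightarrow> nat) option" where
  "circ_op k \<theta> x = (case x of None \<Rightarrow> None | Some \<xi> \<Rightarrow> circ_class k (\<lambda>i\<in>{..k}. \<xi> (\<theta> i)))"

definition circ_inv :: "nat \<Rightarrow> (nat \<Rightarrow> nat) option \<Rightarrow> (nat \<Rightarrow> nat) option" where
  "circ_inv m x = (case x of None \<Rightarrow> None | Some \<xi> \<Rightarrow> circ_class m (\<lambda>i\<in>{..m}. 1 - \<xi> (m - i)))"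

section \<open>Nerves\<close>

text \<open>An \<open>n\<close>-simplex \<open>A\<^sub>0 \<rightarrow> \<dots> \<rightarrow> A\<^sub>n\<close> of the nerve is given as a functor on the ordered set \<open>{0..n}\<close>,
  that is, together with all composites \<open>A\<^sub>i \<rightarrow> A\<^sub>j\<close> for \<open>i \<le> j\<close>.\<close>

type_synonym ('o, 'm) chain_simplex = "(nat \<Rightarrow> 'o) \<times> (nat \<times> nat \<Rightarrow> 'm)"

definition le_pairs :: "nat \<Rightarrow> (nat \<times> nat) set" where
  "le_pairs n = {(i, j). i \<le> j \<and> j \<le> n}"

definition nerve :: "('o, 'm) dcat \<Rightarrow> nat \<Rightarrow> ('o, 'm) chain_simplex set" where
  "nerve C n = {x. fst x \<in> {..n} \<rightarrow>\<^sub>E ob C \<and> snd x \<in> extensional (le_pairs n) \<and>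
     (\<forall>(i, j) \<in> le_pairs n. snd x (i, j) \<in> hom C (fst x i) (fst x j)) \<and>
     (\<forall>i\<le>n. snd x (i, i) = idt C (fst x i)) \<and>
     (\<forall>i j k. i \<le> j \<and> j \<le> k \<and> k \<le> n \<longrightarrow>
        snd x (i, k) = cmp C (fst x i) (fst x j) (fst x k) (snd x (j, k)) (snd x (i, j)))}"

definition nerve_op :: "nat \<Rightarrow> (nat \<Rightarrow> nat) \<Rightarrow> ('o, 'm) chain_simplex \<Rightarrow> ('o, 'm) chain_simplex" where
  "nerve_op k \<theta> x = (\<lambda>i\<in>{..k}. fst x (\<theta> i), \<lambda>(i, j)\<in>le_pairs k. snd x (\<theta> i, \<theta> j))"

definition nerve_map :: "nat \<Rightarrow> ('o \<Rightarrow> 'p) \<Rightarrow> ('m \<Rightarrow> 'q) \<Rightarrow> ('o, 'm) chain_simplex \<Rightarrow> ('p, 'q) chain_simplex" where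
  "nerve_map n F G x = (\<lambda>i\<in>{..n}. F (fst x i), \<lambda>(i, j)\<in>le_pairs n. G (snd x (i, j)))"

definition nerve_inv :: "('o, 'm) dcat \<Rightarrow> nat \<Rightarrow> ('o, 'm) chain_simplex \<Rightarrow> ('o, 'm) chain_simplex" where
  "nerve_inv C n x = (\<lambda>i\<in>{..n}. dob C (fst x (n - i)),
     \<lambda>(i, j)\<in>le_pairs n. dmor C (fst x (n - j)) (fst x (n - i)) (snd x (n - j, n - i)))"

definition nerve_sum :: "('o, 'm) dcat \<Rightarrow> nat \<Rightarrow>
    ('o, 'm) chain_simplex \<Rightarrow> ('o, 'm) chain_simplex \<Rightarrow> ('o, 'm) chain_simplex" where
  "nerve_sum C n x y = (\<lambda>i\<in>{..n}. osum C (fst x i) (fst y i),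
     \<lambda>(i, j)\<in>le_pairs n. msum C (fst x i) (fst x j) (fst y i) (fst y j) (snd x (i, j)) (snd y (i, j)))"

section \<open>Bisimplicial sets with duality and their realization\<close>

text \<open>\<open>bs_op X m n k l \<theta> \<psi>\<close> is the operator \<open>X\<^sub>m\<^sub>,\<^sub>n \<rightarrow> X\<^sub>k\<^sub>,\<^sub>l\<close> of \<open>\<theta> : [k] \<rightarrow> [m]\<close> and \<open>\<psi> : [l] \<rightarrow> [n]\<close>;
  \<open>bs_inv\<close> is an involution in each bidegree that intertwines the operators of \<open>(\<theta>, \<psi>)\<close> and of
  their order reversals; \<open>bs_base\<close> is a simplex of bidegree \<open>(0,0)\<close>.\<close>

record 's bisset =
  bs_set :: "nat \<Rightarrow> nat \<Rightarrow> 's set"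
  bs_op :: "nat \<Rightarrow> nat \<Rightarrow> nat \<Rightarrow> nat \<Rightarrow> (nat \<Rightarrow> nat) \<Rightarrow> (nat \<Rightarrow> nat) \<Rightarrow> 's \<Rightarrow> 's"
  bs_inv :: "nat \<Rightarrow> nat \<Rightarrow> 's \<Rightarrow> 's"
  bs_base :: "'s"

definition bs_prod :: "'s bisset \<Rightarrow> 't bisset \<Rightarrow> ('s \<times> 't) bisset" where
  "bs_prod X Y = \<lparr>
     bs_set = (\<lambda>m n. bs_set X m n \<times> bs_set Y m n),
     bs_op = (\<lambda>m n k l \<theta> \<psi>. map_prod (bs_op X m n k l \<theta> \<psi>) (bs_op Y m n k l \<theta> \<psi>)),
     bs_inv = (\<lambda>m n. map_prod (bs_inv X m n) (bs_inv Y m n)),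
     bs_base = (bs_base X, bs_base Y)\<rparr>"

text \<open>A point \<open>(x; s, t)\<close> of \<open>X\<^sub>m\<^sub>,\<^sub>n \<times> \<Delta>\<^sup>m \<times> \<Delta>\<^sup>n\<close> is written \<open>((m, n, x), s, t)\<close>.\<close>

type_synonym 's bpt = "(nat \<times> nat \<times> 's) \<times> (nat \<Rightarrow> real) \<times> (nat \<Rightarrow> real)"

definition simplex_top :: "nat \<Rightarrow> (nat \<Rightarrow> real) topology" where
  "simplex_top m = subtopology (powertop_real UNIV) (standard_simplex m)"

definition simplex_push :: "nat \<Rightarrow> (nat \<Rightarrow> nat) \<Rightarrow> (nat \<Rightarrow> real) \<Rightarrow> (nat \<Rightarrow> real)" where
  "simplex_push k \<theta> s = (\<lambda>j. \<Sum>i | i \<le> k \<and> \<theta> i = j. s i)"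

definition simplex_rev :: "nat \<Rightarrow> (nat \<Rightarrow> real) \<Rightarrow> (nat \<Rightarrow> real)" where
  "simplex_rev m s = (\<lambda>i. if i \<le> m then s (m - i) else 0)"

definition bs_total :: "'s bisset \<Rightarrow> 's bpt topology" where
  "bs_total X = sum_topology (\<lambda>(m, n, x). prod_topology (simplex_top m) (simplex_top n))
     {(m, n, x). x \<in> bs_set X m n}"

definition bs_glue :: "'s bisset \<Rightarrow> ('s bpt \<times> 's bpt) set" where
  "bs_glue X =
     {(((k, l, bs_op X m n k l \<theta> \<psi> x), s, t), ((m, n, x), simplex_push k \<theta> s, simplex_push l \<psi> t))
       | m n k l \<theta> \<psi> x s t. x \<in> bs_set X m n \<and> \<theta> \<in> sop k m \<and> \<psi> \<in> sop l n \<and>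
           s \<in> standard_simplex k \<and> t \<in> standard_simplex l}"

definition bs_eqv :: "'s bisset \<Rightarrow> ('s bpt \<times> 's bpt) set" where
  "bs_eqv X = (bs_glue X \<union> (bs_glue X)\<inverse>)\<^sup>*"

text \<open>Points of the realization are the equivalence classes, with the quotient topology.\<close>

definition bs_real :: "'s bisset \<Rightarrow> 's bpt set topology" where
  "bs_real X = topology (\<lambda>U. U \<subseteq> topspace (bs_total X) // bs_eqv X \<and>
     openin (bs_total X) {p \<in> topspace (bs_total X). bs_eqv X `` {p} \<in> U})"

lemma istopology_bs_real:
  "istopology (\<lambda>U. U \<subseteq> topspace (bs_total X) // bs_eqv X \<and>
     openin (bs_total X) {p \<in> topspace (bs_total X). bs_eqv X `` {p} \<in> U})"
proof -
  let ?Q = "\<lambda>U. {p \<in> topspace (bs_total X). bs_eqv X `` {p} \<in> U}"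
  have "?Q (S \<inter> T) = ?Q S \<inter> ?Q T" for S T by auto
  moreover have "?Q (\<Union>\<K>) = (\<Union>S\<in>\<K>. ?Q S)" for \<K> by auto
  ultimately show ?thesis
    unfolding istopology_def by (auto intro!: openin_Int openin_Union simp del: Collect_conj_eq)
qed

definition bs_real_base :: "'s bisset \<Rightarrow> 's bpt set" where
  "bs_real_base X = bs_eqv X `` {((0, 0, bs_base X), (\<lambda>i. if i = 0 then 1 else 0), (\<lambda>i. if i = 0 then 1 else 0))}"

text \<open>The generator of \<open>C\<^sub>2\<close> acts on a class elementwise.\<close>

definition bs_real_inv :: "'s bisset \<Rightarrow> 's bpt set \<Rightarrow> 's bpt set" where
  "bs_real_inv X c =
     (\<lambda>((m, n, x), s, t). ((m, n, bs_inv X m n x), simplex_rev m s, simplex_rev n t)) ` c"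

text \<open>The map of realizations induced by a map \<open>F\<close> from some bisimplicial set to \<open>Y\<close>.\<close>

definition bs_real_map :: "'t bisset \<Rightarrow> (nat \<Rightarrow> nat \<Rightarrow> 's \<Rightarrow> 't) \<Rightarrow> 's bpt set \<Rightarrow> 't bpt set" where
  "bs_real_map Y F c = bs_eqv Y `` ((\<lambda>((m, n, x), s, t). ((m, n, F m n x), s, t)) ` c)"

section \<open>The fixed points of the loop space \<open>\<Omega>\<^sup>1\<^sup>,\<^sup>1\<close>\<close>

text \<open>Based maps on \<open>[0,1]/{0,1}\<close> are represented as loops on \<open>[0,1]\<close>; the mapping space carries the
  compact-open topology.\<close>

definition loops :: "'s bisset \<Rightarrow> (real \<Rightarrow> 's bpt set) set" where
  "loops X = {\<gamma> \<in> extensional {0..1}. continuous_map (top_of_set {0..1}) (bs_real X) \<gamma> \<and>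
     \<gamma> 0 = bs_real_base X \<and> \<gamma> 1 = bs_real_base X}"

definition loop_top :: "'s bisset \<Rightarrow> (real \<Rightarrow> 's bpt set) topology" where
  "loop_top X = subtopology
     (topology_generated_by {{\<gamma>. \<gamma> ` K \<subseteq> U} | K U. compact K \<and> K \<subseteq> {0..1} \<and> openin (bs_real X) U})
     (loops X)"

definition loop_conj :: "'s bisset \<Rightarrow> (real \<Rightarrow> 's bpt set) \<Rightarrow> (real \<Rightarrow> 's bpt set)" where
  "loop_conj X \<gamma> = (\<lambda>t\<in>{0..1}. bs_real_inv X (\<gamma> (1 - t)))"

definition loop_fix_top :: "'s bisset \<Rightarrow> (real \<Rightarrow> 's bpt set) topology" where
  "loop_fix_top X = subtopology (loop_top X) {\<gamma> \<in> loops X. loop_conj X \<gamma> = \<gamma>}"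

section \<open>The monoid \<open>K\<^sup>1\<^sup>,\<^sup>1\<^sub>0(R,\<alpha>,\<epsilon>)\<close>\<close>

abbreviation SD :: "('r::ring_1 \<Rightarrow> 'r) \<Rightarrow> 'r \<Rightarrow> nat \<Rightarrow>
    ((nat \<Rightarrow> nat, 'r dpob, 'r dpmor) diag, (nat \<Rightarrow> nat) option set \<Rightarrow> 'r dpmor) dcat" where
  "SD \<alpha> \<epsilon> m \<equiv> iso_cat (diag_cat (DP \<alpha> \<epsilon>) (circ m) (circ_inv m))"

type_synonym 'r sd_simplex =
  "((nat \<Rightarrow> nat, 'r dpob, 'r dpmor) diag, (nat \<Rightarrow> nat) option set \<Rightarrow> 'r dpmor) chain_simplex"

definition NiA :: "('r::ring_1 \<Rightarrow> 'r) \<Rightarrow> 'r \<Rightarrow> 'r sd_simplex bisset" where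
  "NiA \<alpha> \<epsilon> = \<lparr>
     bs_set = (\<lambda>m n. nerve (SD \<alpha> \<epsilon> m) n),
     bs_op = (\<lambda>m n k l \<theta> \<psi> x. nerve_map l (diag_push (circ_op k \<theta>) (circ m) (circ k))
        (diag_push_mor (circ_op k \<theta>) (circ m) (circ k)) (nerve_op l \<psi> x)),
     bs_inv = (\<lambda>m n. nerve_inv (SD \<alpha> \<epsilon> m) n),
     bs_base = (\<lambda>i\<in>{..0}. zob (SD \<alpha> \<epsilon> 0), \<lambda>_\<in>le_pairs 0. idt (SD \<alpha> \<epsilon> 0) (zob (SD \<alpha> \<epsilon> 0)))\<rparr>"

definition NiA_sum :: "('r::ring_1 \<Rightarrow> 'r) \<Rightarrow> 'r \<Rightarrow> nat \<Rightarrow> nat \<Rightarrow>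
    'r sd_simplex \<times> 'r sd_simplex \<Rightarrow> 'r sd_simplex" where
  "NiA_sum \<alpha> \<epsilon> m n = (\<lambda>(x, y). nerve_sum (SD \<alpha> \<epsilon> m) n x y)"

definition K11 :: "('r::ring_1 \<Rightarrow> 'r) \<Rightarrow> 'r \<Rightarrow> (real \<Rightarrow> 'r sd_simplex bpt set) topology" where
  "K11 \<alpha> \<epsilon> = loop_fix_top (NiA \<alpha> \<epsilon>)"

text \<open>Write \<open>Y\<close> for the bisimplicial set \<open>NiA \<alpha> \<epsilon>\<close>. Direct sum is a map \<open>Y \<times> Y \<rightarrow> Y\<close> of bisimplicial
  sets with duality, and the two projections induce a bijection from the path components for
  \<open>Y \<times> Y\<close> to pairs of path components for \<open>Y\<close>. The product of \<open>a\<close> and \<open>b\<close> is therefore the component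
  of the sum of any \<open>\<zeta>\<close> whose projections lie in \<open>a\<close> and \<open>b\<close>. It is written as the union of these
  components over all such \<open>\<zeta>\<close>, as products of cosets are in \<open>set_mult\<close>.\<close>

definition K11_zero ::
  "('r::ring_1 \<Rightarrow> 'r) \<Rightarrow> 'r \<Rightarrow> (real \<Rightarrow> 'r sd_simplex bpt set) set monoid" where
  "K11_zero \<alpha> \<epsilon> = \<lparr>
     carrier = path_components_of (K11 \<alpha> \<epsilon>),
     mult = (\<lambda>a b. \<Union>\<zeta> \<in> {\<zeta> \<in> topspace (loop_fix_top (bs_prod (NiA \<alpha> \<epsilon>) (NiA \<alpha> \<epsilon>))).
          (\<lambda>t\<in>{0..1}. bs_real_map (NiA \<alpha> \<epsilon>) (\<lambda>_ _. fst) (\<zeta> t)) \<in> a \<and>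
          (\<lambda>t\<in>{0..1}. bs_real_map (NiA \<alpha> \<epsilon>) (\<lambda>_ _. snd) (\<zeta> t)) \<in> b}.
        path_component_of_set (K11 \<alpha> \<epsilon>)
          (\<lambda>t\<in>{0..1}. bs_real_map (NiA \<alpha> \<epsilon>) (NiA_sum \<alpha> \<epsilon>) (\<zeta> t))),
     one = path_component_of_set (K11 \<alpha> \<epsilon>) (\<lambda>t\<in>{0..1}. bs_real_base (NiA \<alpha> \<epsilon>))\<rparr>"

end

theory Submission
  imports Defs
begin

text \<open>A fixed loop is determined by its first half, a path from the base point to a fixed point of the
  realization. Such a point is a configuration on the circle with labels in \<open>DP\<close> and with a
  self-duality that covers the reflection, so the label at \<open>1/2\<close> carries a symmetric bilinear
  form over the integers. When labels move away from \<open>1/2\<close> they do so in dual pairs, which split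
  off a hyperbolic, hence even, form. The parity of the middle form (whether \<open>f x x\<close> is odd for some
  \<open>x\<close>) is therefore constant along paths. A direct sum with an odd summand is odd, the base loop is
  even, and the form \<open>\<langle>1\<rangle>\<close> gives an odd loop, whose class has no inverse.

  Normal forms of points of the realization are not needed. The labels over a band around \<open>1/2\<close> of
  width \<open>\<epsilon>\<close>, compared between the ends \<open>\<delta>\<close> and \<open>1 - \<delta>\<close> of the nerve coordinate, form a diagram
  that is invariant under the gluing relation, and generic thresholds \<open>\<epsilon>, \<delta>\<close> make it locally
  constant on each cell. Hence having an odd, or an even, form for some thresholds are both open
  conditions. On fixed points the parity does not depend on the thresholds, so there the two
  conditions are complementary.\<close>

section \<open>Realizations of bisimplicial sets with duality\<close>

text \<open>Off the fixed points the transition between the two sampled ends is not a form at all,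
  since those ends are not dual to each other, and neither parity condition is visibly closed. So
  \<open>odd_at\<close> is a formula that can be written down for every point, and it is read as the
  parity of a form only where the terminal sample is the dual of the initial one. The two thresholds
  act differently. Changing \<delta> pulls the form back along an isomorphism and keeps its set of
  values; changing \<epsilon> adds or removes labels in two mirror halves of the band, which
  contribute a term 2 h(l, r). All comparisons are arranged so that raising a threshold slightly
  alters no sample at the given point, while the raised threshold equals none of the finitely many
  quantities compared with it; this is where openness comes from. The bound \<delta> < 1/2 keeps the
  initial sample before the terminal one, and \<epsilon> < 1/2 keeps the band away from 0 and 1,
  where collapsed simplices sit. Strictness of the duality matters: samples of glued points are
  literally equal, so a fixed point gives an equality between one sample and the dual of the other,
  not just an isomorphism.\<close>

definition rev_op :: "nat \<Rightarrow> nat \<Rightarrow> (nat \<Rightarrow> nat) \<Rightarrow> nat \<Rightarrow> nat" where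
  "rev_op k m \<theta> = (\<lambda>i. m - \<theta> (k - i))"

lemma sop_le: "\<theta> \<in> sop k m \<Longrightarrow> i \<le> k \<Longrightarrow> \<theta> i \<le> m"
  by (auto simp: sop_def)

lemma sop_mono: "\<theta> \<in> sop k m \<Longrightarrow> i \<le> j \<Longrightarrow> j \<le> k \<Longrightarrow> \<theta> i \<le> \<theta> j"
  by (auto simp: sop_def mono_on_def)

lemma rev_op_in_sop: "\<theta> \<in> sop k m \<Longrightarrow> rev_op k m \<theta> \<in> sop k m"
  by (auto simp: sop_def rev_op_def mono_on_def intro!: diff_le_mono2)

lemma rev_op_rev_op: "\<theta> \<in> sop k m \<Longrightarrow> i \<le> k \<Longrightarrow> rev_op k m (rev_op k m \<theta>) i = \<theta> i"
  by (auto simp: rev_op_def sop_le)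

section \<open>Points of standard simplices: reversal and push-forward\<close>

lemma standard_simplex_nonneg: "s \<in> standard_simplex m \<Longrightarrow> 0 \<le> s i"
  by (auto simp: standard_simplex_def)

lemma standard_simplex_outside: "s \<in> standard_simplex m \<Longrightarrow> m < i \<Longrightarrow> s i = 0"
  by (auto simp: standard_simplex_def)

lemma standard_simplex_sum: "s \<in> standard_simplex m \<Longrightarrow> sum s {..m} = 1"
  by (auto simp: standard_simplex_def)

lemma standard_simplexI:
  assumes "\<And>i. 0 \<le> s i" "\<And>i. m < i \<Longrightarrow> s i = 0" "sum s {..m} = 1"
  shows "s \<in> standard_simplex m"
proof -
  have "s i \<le> 1" for i
  proof (cases "i \<le> m")
    case True
    then have "s i \<le> sum s {..m}" by (intro member_le_sum) (auto simp: assms)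
    then show ?thesis by (simp add: assms)
  qed (simp add: assms)
  then show ?thesis by (simp add: standard_simplex_def assms)
qed

lemma bij_betw_flip: "bij_betw (\<lambda>i. m - i) {..m} {..m::nat}"
  by (rule bij_betw_byWitness[where f' = "\<lambda>i. m - i"]) auto

lemma simplex_rev_in:
  assumes "s \<in> standard_simplex m"
  shows "simplex_rev m s \<in> standard_simplex m"
proof (rule standard_simplexI)
  have "sum (simplex_rev m s) {..m} = (\<Sum>i\<le>m. s (m - i))" by (simp add: simplex_rev_def)
  also have "\<dots> = sum s {..m}" by (rule sum.reindex_bij_betw[OF bij_betw_flip])
  finally show "sum (simplex_rev m s) {..m} = 1" using assms by (simp add: standard_simplex_sum)
qed (use assms in \<open>auto simp: simplex_rev_def standard_simplex_nonneg\<close>)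

lemma simplex_rev_rev: "s \<in> standard_simplex m \<Longrightarrow> simplex_rev m (simplex_rev m s) = s"
  by (auto simp: simplex_rev_def standard_simplex_outside)

lemma simplex_push_in:
  assumes "\<theta> \<in> sop k m" "s \<in> standard_simplex k"
  shows "simplex_push k \<theta> s \<in> standard_simplex m"
proof (rule standard_simplexI)
  show "0 \<le> simplex_push k \<theta> s i" for i
    unfolding simplex_push_def by (intro sum_nonneg standard_simplex_nonneg[OF assms(2)])
  show "simplex_push k \<theta> s i = 0" if "m < i" for i
  proof -
    have "{j. j \<le> k \<and> \<theta> j = i} = {}" using that assms(1) by (auto dest: sop_le)
    then show ?thesis by (simp only: simplex_push_def sum.empty)
  qed
  have "(\<Sum>j\<in>{..m}. \<Sum>i\<in>{i \<in> {..k}. \<theta> i = j}. s i) = sum s {..k}"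
    using assms(1) by (intro sum.group) (auto simp: sop_le)
  then show "sum (simplex_push k \<theta> s) {..m} = 1"
    using assms(2) by (simp add: simplex_push_def standard_simplex_sum)
qed

text \<open>The flip i \<mapsto> k - i carries the fibre of \<theta> over m - j to the fibre of the
  conjugate operator over j. Coordinates beyond m vanish on both sides.\<close>

lemma simplex_rev_push:
  assumes "\<theta> \<in> sop k m"
  shows "simplex_rev m (simplex_push k \<theta> s) = simplex_push k (rev_op k m \<theta>) (simplex_rev k s)"
proof
  fix j
  show "simplex_rev m (simplex_push k \<theta> s) j = simplex_push k (rev_op k m \<theta>) (simplex_rev k s) j"
  proof (cases "j \<le> m")
    case True
    have "bij_betw (\<lambda>i. k - i) {i. i \<le> k \<and> \<theta> i = m - j} {i. i \<le> k \<and> rev_op k m \<theta> i = j}"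
      using True assms by (intro bij_betw_byWitness[where f' = "\<lambda>i. k - i"])
        (auto simp: rev_op_def sop_le)
    note sum.reindex_bij_betw[OF this, of "simplex_rev k s"]
    moreover have "simplex_rev k s (k - i) = s i" if "i \<le> k" for i
      using that by (simp add: simplex_rev_def)
    ultimately show ?thesis using True by (simp add: simplex_rev_def simplex_push_def)
  next
    case False
    then have "{i. i \<le> k \<and> rev_op k m \<theta> i = j} = {}" by (auto simp: rev_op_def)
    with False show ?thesis by (simp only: simplex_rev_def simplex_push_def if_False sum.empty)
  qed
qed

section \<open>The gluing relation and the quotient topology\<close>

lemma bs_glueI:
  assumes "x \<in> bs_set X m n" "\<theta> \<in> sop k m" "\<psi> \<in> sop l n"
    "s \<in> standard_simplex k" "t \<in> standard_simplex l"
  shows "(((k, l, bs_op X m n k l \<theta> \<psi> x), s, t),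
    ((m, n, x), simplex_push k \<theta> s, simplex_push l \<psi> t)) \<in> bs_glue X"
  using assms unfolding bs_glue_def by blast

lemma bs_glueE:
  assumes "(p, q) \<in> bs_glue X"
  obtains m n k l \<theta> \<psi> x s t where "p = ((k, l, bs_op X m n k l \<theta> \<psi> x), s, t)"
    "q = ((m, n, x), simplex_push k \<theta> s, simplex_push l \<psi> t)"
    "x \<in> bs_set X m n" "\<theta> \<in> sop k m" "\<psi> \<in> sop l n"
    "s \<in> standard_simplex k" "t \<in> standard_simplex l"
  using assms unfolding bs_glue_def by blast

lemma openin_bs_real:
  "openin (bs_real X) U \<longleftrightarrow> U \<subseteq> topspace (bs_total X) // bs_eqv X \<and>
     openin (bs_total X) {p \<in> topspace (bs_total X). bs_eqv X `` {p} \<in> U}"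
  unfolding bs_real_def by (subst topology_inverse'[OF istopology_bs_real]) simp

lemma topspace_bs_real: "topspace (bs_real X) = topspace (bs_total X) // bs_eqv X"
proof -
  have *: "{p \<in> topspace (bs_total X). bs_eqv X `` {p} \<in> topspace (bs_total X) // bs_eqv X} =
      topspace (bs_total X)"
    by (auto simp: quotient_def)
  have "openin (bs_real X) (topspace (bs_total X) // bs_eqv X)"
    unfolding openin_bs_real * by simp
  moreover have "topspace (bs_real X) \<subseteq> topspace (bs_total X) // bs_eqv X"
    using openin_bs_real openin_topspace by blast
  ultimately show ?thesis using openin_subset by blast
qed

lemma topspace_bs_total:
  "topspace (bs_total X) =
     {((m, n, x), s, t). x \<in> bs_set X m n \<and> s \<in> standard_simplex m \<and> t \<in> standard_simplex n}"
  by (auto simp: bs_total_def simplex_top_def)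

lemma equiv_bs_eqv: "equiv UNIV (bs_eqv X)"
  unfolding equiv_def bs_eqv_def
  by (auto simp: refl_on_def trans_rtrancl intro: sym_rtrancl sym_Un_converse)

lemma bs_eqv_refl: "(p, p) \<in> bs_eqv X"
  by (simp add: bs_eqv_def)

lemma bs_eqv_sym: "(p, q) \<in> bs_eqv X \<Longrightarrow> (q, p) \<in> bs_eqv X"
  by (metis equiv_bs_eqv equivE symE)

lemma bs_glue_eqv: "(p, q) \<in> bs_glue X \<Longrightarrow> (p, q) \<in> bs_eqv X"
  by (auto simp: bs_eqv_def)

lemma bs_eqv_class_eq: "bs_eqv X `` {p} = bs_eqv X `` {q} \<longleftrightarrow> (p, q) \<in> bs_eqv X"
  by (rule eq_equiv_class_iff[OF equiv_bs_eqv]) simp_all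

text \<open>Induction along a zigzag of gluings: an invariant of classes has to be checked on a
  single gluing.\<close>

lemma bs_eqv_invariant:
  assumes "(p, q) \<in> bs_eqv X" and "\<And>p q. (p, q) \<in> bs_glue X \<Longrightarrow> f p = f q"
  shows "f p = f q"
  using assms(1) unfolding bs_eqv_def
  by (induction rule: rtrancl_induct) (auto dest: assms(2))

lemma bs_real_point:
  assumes "y \<in> topspace (bs_real X)"
  obtains p where "p \<in> topspace (bs_total X)" "y = bs_eqv X `` {p}"
  using assms by (auto simp: topspace_bs_real quotient_def)

lemma bs_real_class_of:
  assumes "y \<in> topspace (bs_real X)" "p \<in> y"
  shows "y = bs_eqv X `` {p}"
proof -
  obtain q where "y = bs_eqv X `` {q}" using bs_real_point assms(1) by blast
  with assms(2) show ?thesis using bs_eqv_class_eq[of X q p] by auto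
qed

lemma continuous_map_bs_proj: "continuous_map (bs_total X) (bs_real X) (\<lambda>p. bs_eqv X `` {p})"
  unfolding continuous_map_def by (auto simp: topspace_bs_real openin_bs_real quotient_def)

text \<open>The characteristic map of a cell is a component injection followed by the quotient map.
  This serves for paths that stay inside one cell.\<close>

lemma continuous_map_bs_cell:
  assumes "x \<in> bs_set X m n" "continuous_map Z (prod_topology (simplex_top m) (simplex_top n)) f"
  shows "continuous_map Z (bs_real X) (\<lambda>z. bs_eqv X `` {((m, n, x), f z)})"
proof -
  have "continuous_map (prod_topology (simplex_top m) (simplex_top n)) (bs_total X) (Pair (m, n, x))"
    using continuous_map_component_injection[of "(m, n, x)" "{(m, n, x). x \<in> bs_set X m n}"
        "\<lambda>(m, n, x). prod_topology (simplex_top m) (simplex_top n)"] assms(1)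
    by (simp add: bs_total_def)
  from continuous_map_compose[OF continuous_map_compose[OF assms(2) this] continuous_map_bs_proj]
  show ?thesis by (simp add: comp_def)
qed

section \<open>The action of the generator of \<open>C\<^sub>2\<close> on points and on
  classes\<close>

definition pt_rev :: "'s bisset \<Rightarrow> 's bpt \<Rightarrow> 's bpt" where
  "pt_rev X = (\<lambda>((m, n, x), s, t). ((m, n, bs_inv X m n x), simplex_rev m s, simplex_rev n t))"

text \<open>Operators are indexed by functions on all of \<open>nat\<close>, and reversing \<theta>
  twice restores it on {..k} alone; \<open>op_cong\<close> bridges this gap.\<close>

locale dual_bisset =
  fixes X :: "'s bisset"
  assumes inv_set: "x \<in> bs_set X m n \<Longrightarrow> bs_inv X m n x \<in> bs_set X m n"
    and inv_inv: "x \<in> bs_set X m n \<Longrightarrow> bs_inv X m n (bs_inv X m n x) = x"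
    and inv_op: "x \<in> bs_set X m n \<Longrightarrow> \<theta> \<in> sop k m \<Longrightarrow> \<psi> \<in> sop l n \<Longrightarrow>
      bs_inv X k l (bs_op X m n k l \<theta> \<psi> x) =
        bs_op X m n k l (rev_op k m \<theta>) (rev_op l n \<psi>) (bs_inv X m n x)"
    and op_cong: "(\<And>i. i \<le> k \<Longrightarrow> \<theta> i = \<theta>' i) \<Longrightarrow> (\<And>i. i \<le> l \<Longrightarrow> \<psi> i = \<psi>' i) \<Longrightarrow>
      bs_op X m n k l \<theta> \<psi> x = bs_op X m n k l \<theta>' \<psi>' x"
begin

lemma glue_rev:
  assumes "(p, q) \<in> bs_glue X"
  shows "(pt_rev X p, pt_rev X q) \<in> bs_glue X"
proof -
  from assms obtain m n k l \<theta> \<psi> x s t where p: "p = ((k, l, bs_op X m n k l \<theta> \<psi> x), s, t)"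
    and q: "q = ((m, n, x), simplex_push k \<theta> s, simplex_push l \<psi> t)"
    and x: "x \<in> bs_set X m n" "\<theta> \<in> sop k m" "\<psi> \<in> sop l n"
    and st: "s \<in> standard_simplex k" "t \<in> standard_simplex l"
    by (rule bs_glueE)
  show ?thesis
    using bs_glueI[OF inv_set[OF x(1)] rev_op_in_sop[OF x(2)] rev_op_in_sop[OF x(3)]
        simplex_rev_in[OF st(1)] simplex_rev_in[OF st(2)]]
    by (simp add: p q pt_rev_def inv_op[OF x] simplex_rev_push x)
qed

text \<open>The simplex at the lower end of a gluing is \<open>bs_op\<close> applied to x and is not
  known to lie in \<open>bs_set\<close>. Its double reversal is therefore moved through the operator
  by applying \<open>inv_op\<close> twice, and cancelled on x.\<close>

lemma glue_rev_rev:
  assumes "(p, q) \<in> bs_glue X"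
  shows "pt_rev X (pt_rev X p) = p" "pt_rev X (pt_rev X q) = q"
proof -
  from assms obtain m n k l \<theta> \<psi> x s t where p: "p = ((k, l, bs_op X m n k l \<theta> \<psi> x), s, t)"
    and q: "q = ((m, n, x), simplex_push k \<theta> s, simplex_push l \<psi> t)"
    and x: "x \<in> bs_set X m n" "\<theta> \<in> sop k m" "\<psi> \<in> sop l n"
    and st: "s \<in> standard_simplex k" "t \<in> standard_simplex l"
    by (rule bs_glueE)
  have "bs_inv X k l (bs_inv X k l (bs_op X m n k l \<theta> \<psi> x)) =
      bs_op X m n k l (rev_op k m (rev_op k m \<theta>)) (rev_op l n (rev_op l n \<psi>)) x"
    using x by (simp add: inv_op inv_set rev_op_in_sop inv_inv)
  also have "\<dots> = bs_op X m n k l \<theta> \<psi> x"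
    using x by (intro op_cong) (simp_all add: rev_op_rev_op)
  finally show "pt_rev X (pt_rev X p) = p"
    using st by (simp add: p pt_rev_def simplex_rev_rev)
  show "pt_rev X (pt_rev X q) = q"
    using x st by (simp add: q pt_rev_def simplex_rev_rev simplex_push_in inv_inv)
qed

lemma eqv_rev:
  assumes "(p, q) \<in> bs_eqv X"
  shows "(pt_rev X p, pt_rev X q) \<in> bs_eqv X"
  using assms unfolding bs_eqv_def
proof (induction rule: rtrancl_induct)
  case (step q r)
  have "(pt_rev X q, pt_rev X r) \<in> bs_glue X \<union> (bs_glue X)\<inverse>"
    using step.hyps(2) glue_rev[of q r] glue_rev[of r q] by simp metis
  with step.IH show ?case by (rule rtrancl_into_rtrancl)
qed (rule rtrancl_refl)

text \<open>A point reached by a nonempty zigzag is an end of some gluing, where double reversal is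
  already known to be trivial. The hypothesis on p covers the empty zigzag.\<close>

lemma eqv_rev_rev:
  assumes "(p, q) \<in> bs_eqv X" "pt_rev X (pt_rev X p) = p"
  shows "pt_rev X (pt_rev X q) = q"
  using assms(1) unfolding bs_eqv_def
proof (induction rule: rtrancl_induct)
  case (step q r)
  from step.hyps(2) have "(q, r) \<in> bs_glue X \<or> (r, q) \<in> bs_glue X" by simp
  then show ?case by (elim disjE) (erule glue_rev_rev)+
qed (rule assms(2))

lemma rev_rev: "p \<in> topspace (bs_total X) \<Longrightarrow> pt_rev X (pt_rev X p) = p"
  by (auto simp: topspace_bs_total pt_rev_def inv_inv simplex_rev_rev)

lemma rev_in: "p \<in> topspace (bs_total X) \<Longrightarrow> pt_rev X p \<in> topspace (bs_total X)"
  by (auto simp: topspace_bs_total pt_rev_def inv_set simplex_rev_in)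

text \<open>The action is defined as an image of a class, which a priori is a mere subset of a
  class. It is a whole class because reversal respects gluing and is its own inverse on every point
  of the class.\<close>

lemma bs_real_inv_class:
  assumes "p \<in> topspace (bs_total X)"
  shows "bs_real_inv X (bs_eqv X `` {p}) = bs_eqv X `` {pt_rev X p}"
proof -
  have "bs_real_inv X (bs_eqv X `` {p}) = pt_rev X ` (bs_eqv X `` {p})"
    by (simp add: bs_real_inv_def pt_rev_def)
  also have "\<dots> = bs_eqv X `` {pt_rev X p}"
  proof (intro equalityI subsetI)
    fix q assume "q \<in> bs_eqv X `` {pt_rev X p}"
    then have q: "(pt_rev X p, q) \<in> bs_eqv X" by simp
    then have "pt_rev X (pt_rev X q) = q"
      by (rule eqv_rev_rev) (intro rev_rev rev_in assms)
    moreover have "(p, pt_rev X q) \<in> bs_eqv X" using eqv_rev[OF q] rev_rev[OF assms] by simp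
    ultimately show "q \<in> pt_rev X ` (bs_eqv X `` {p})" by (metis ImageI imageI singletonI)
  qed (auto intro: eqv_rev)
  finally show ?thesis .
qed

end

section \<open>Fixed loops\<close>

lemma topspace_loop_fix_top:
  fixes X :: "'s bisset"
  shows "topspace (loop_fix_top X) = {\<gamma> \<in> loops X. loop_conj X \<gamma> = \<gamma>}"
proof -
  \<comment> \<open>The compact set K = {} gives a subbasic set that contains every function, so the
    generated topology has full carrier.\<close>
  have "\<gamma> \<in> topspace (topology_generated_by
      {{\<gamma>. \<gamma> ` K \<subseteq> U} | K U. compact K \<and> K \<subseteq> {0..1} \<and> openin (bs_real X) U})"
    for \<gamma> :: "real \<Rightarrow> 's bpt set"
    unfolding topology_generated_by_topspace
    by (rule UnionI[of "{\<gamma>. \<gamma> ` {} \<subseteq> {}}"]) (auto intro!: exI[of _ "{}"])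
  then show ?thesis by (auto simp: loop_fix_top_def loop_top_def)
qed

lemma loop_in_topspace:
  "\<gamma> \<in> loops X \<Longrightarrow> u \<in> {0..1} \<Longrightarrow> \<gamma> u \<in> topspace (bs_real X)"
  by (auto simp: loops_def continuous_map_def)

lemma midpoint_fixed:
  assumes "\<gamma> \<in> topspace (loop_fix_top X)"
  shows "\<gamma> (1/2) \<in> topspace (bs_real X)" "bs_real_inv X (\<gamma> (1/2)) = \<gamma> (1/2)"
proof -
  have \<gamma>: "\<gamma> \<in> loops X" "loop_conj X \<gamma> = \<gamma>" using assms by (auto simp: topspace_loop_fix_top)
  then show "\<gamma> (1/2) \<in> topspace (bs_real X)" by (auto intro: loop_in_topspace)
  show "bs_real_inv X (\<gamma> (1/2)) = \<gamma> (1/2)"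
    using fun_cong[OF \<gamma>(2), of "1/2"] by (simp add: loop_conj_def)
qed

lemma continuous_map_loop_eval:
  assumes "u \<in> {0..1}"
  shows "continuous_map (loop_fix_top X) (bs_real X) (\<lambda>\<gamma>. \<gamma> u)"
  unfolding continuous_map_def
proof (intro conjI allI impI)
  show "(\<lambda>\<gamma>. \<gamma> u) \<in> topspace (loop_fix_top X) \<rightarrow> topspace (bs_real X)"
    using assms by (auto simp: topspace_loop_fix_top intro: loop_in_topspace)
  fix U assume U: "openin (bs_real X) U"
  have "openin (topology_generated_by
      {{\<gamma>. \<gamma> ` K \<subseteq> U} | K U. compact K \<and> K \<subseteq> {0..1} \<and> openin (bs_real X) U}) {\<gamma>. \<gamma> ` {u} \<subseteq> U}"
    using assms U by (intro topology_generated_by_Basis CollectI exI[of _ "{u}"] exI[of _ U]) auto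
  then have "openin (loop_fix_top X)
      ({\<gamma>. \<gamma> ` {u} \<subseteq> U} \<inter> loops X \<inter> {\<gamma> \<in> loops X. loop_conj X \<gamma> = \<gamma>})"
    unfolding loop_fix_top_def loop_top_def by (intro openin_subtopology_Int)
  also have "{\<gamma>. \<gamma> ` {u} \<subseteq> U} \<inter> loops X \<inter> {\<gamma> \<in> loops X. loop_conj X \<gamma> = \<gamma>} =
      {\<gamma> \<in> topspace (loop_fix_top X). \<gamma> u \<in> U}"
    by (auto simp: topspace_loop_fix_top)
  finally show "openin (loop_fix_top X) {\<gamma> \<in> topspace (loop_fix_top X). \<gamma> u \<in> U}" .
qed

text \<open>Connectedness of [0,1]: midpoints along a path of fixed loops are fixed points, so the
  preimages of S and V are disjoint open sets that cover the interval. Complementarity is required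
  on fixed points alone, because elsewhere the two sets may overlap.\<close>

lemma midpoint_separation:
  fixes X :: "'s bisset"
  assumes "openin (bs_real X) S" "openin (bs_real X) V"
    and sep: "\<And>y. y \<in> topspace (bs_real X) \<Longrightarrow> bs_real_inv X y = y \<Longrightarrow> y \<in> S \<longleftrightarrow> y \<notin> V"
    and "path_component_of (loop_fix_top X) \<gamma> \<gamma>'" "\<gamma> (1/2) \<in> S"
  shows "\<gamma>' (1/2) \<in> S"
proof -
  obtain g :: "real \<Rightarrow> real \<Rightarrow> 's bpt set"
    where g: "continuous_map (top_of_set {0..1}) (loop_fix_top X) g" "g 0 = \<gamma>" "g 1 = \<gamma>'"
    using assms(4) unfolding path_component_of_def pathin_def by (elim exE conjE)
  let ?h = "\<lambda>\<tau>::real. g \<tau> (1/2)"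
  have h: "continuous_map (top_of_set {0..1}) (bs_real X) ?h"
    using continuous_map_compose[OF g(1) continuous_map_loop_eval[of "1/2"]] by (simp add: comp_def)
  have mid: "?h \<tau> \<in> S \<longleftrightarrow> ?h \<tau> \<notin> V" if "\<tau> \<in> {0..1}" for \<tau>
    using g(1) that by (intro sep midpoint_fixed) (auto simp: continuous_map_def)
  let ?A = "{\<tau> \<in> {0..1}. ?h \<tau> \<in> S}" and ?B = "{\<tau> \<in> {0..1}. ?h \<tau> \<in> V}"
  have op: "openin (top_of_set {0..1}) ?A" "openin (top_of_set {0..1}) ?B"
    using openin_continuous_map_preimage[OF h assms(1)] openin_continuous_map_preimage[OF h assms(2)]
    by simp_all
  have cover: "{0..1} \<subseteq> ?A \<union> ?B" "?A \<inter> ?B = {}" using mid by auto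
  have "0 \<in> ?A" using assms(5) g(2) by simp
  then have ne: "?A \<noteq> {}" by blast
  have "?B = {}"
    by (rule ccontr) (use op cover ne connected_Icc[of 0 "1::real", unfolded connected_openin] in blast)
  then have "1 \<notin> ?B" by blast
  with mid[of 1] g(3) show ?thesis by simp
qed

section \<open>Sampling a point of the realization\<close>

text \<open>A point \<open>(x; s, t)\<close> is a configuration on the circle: the simplex \<open>\<xi>\<close> sits at the position
  \<open>loc m s \<xi>\<close> in \<open>[0,1]\<close>, and along the chain in \<open>x\<close> it is a step function on \<open>[0,1]\<close> whose steps have
  the lengths \<open>t i\<close>, with the value number \<open>lo t \<delta>\<close> immediately to the right of \<open>\<delta>\<close> and
  \<open>hi n t \<delta>\<close> immediately to the left of \<open>1 - \<delta>\<close>.\<close>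

definition loc :: "nat \<Rightarrow> (nat \<Rightarrow> real) \<Rightarrow> (nat \<Rightarrow> nat) \<Rightarrow> real" where
  "loc m s \<xi> = (\<Sum>i | i \<le> m \<and> \<xi> i = 1. s i)"

text \<open>Adding \<open>None\<close> makes this an object of the category of pointed subsets; a
  sum-diagram takes there the sum of all labels located in E.\<close>

definition mid :: "nat \<Rightarrow> (nat \<Rightarrow> real) \<Rightarrow> real set \<Rightarrow> (nat \<Rightarrow> nat) option set" where
  "mid m s E = insert None {Some \<xi> | \<xi>. Some \<xi> \<in> circ m \<and> loc m s \<xi> \<in> E}"

definition lo :: "(nat \<Rightarrow> real) \<Rightarrow> real \<Rightarrow> nat" where
  "lo t \<delta> = (LEAST j. \<delta> < sum t {..j})"

definition hi :: "nat \<Rightarrow> (nat \<Rightarrow> real) \<Rightarrow> real \<Rightarrow> nat" where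
  "hi n t \<delta> = n - lo (simplex_rev n t) \<delta>"

section \<open>Simplices of the circle and their locations\<close>

lemma Some_in_circ_iff:
  "Some \<xi> \<in> circ m \<longleftrightarrow> \<xi> \<in> Delta1 m \<and> \<not> (\<exists>c. \<forall>i\<le>m. \<xi> i = c)"
  by (auto simp: circ_def circ_class_def image_iff split: if_splits)

lemma Delta1_iff:
  "\<xi> \<in> Delta1 m \<longleftrightarrow> (\<forall>i j. i \<le> j \<longrightarrow> j \<le> m \<longrightarrow> \<xi> i \<le> \<xi> j) \<and> (\<forall>i\<le>m. \<xi> i \<le> 1) \<and> \<xi> \<in> extensional {..m}"
  by (auto simp: Delta1_def sop_def mono_on_def)

lemma None_in_circ: "None \<in> circ m"
proof -
  have "(\<lambda>i\<in>{..m}. 0) \<in> Delta1 m" by (simp add: Delta1_iff)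
  moreover have "circ_class m (\<lambda>i\<in>{..m}. 0) = None" by (simp add: circ_class_def)
  ultimately show ?thesis unfolding circ_def by (metis imageI)
qed

lemma finite_circ: "finite (circ m)"
proof -
  have "Delta1 m \<subseteq> {..m} \<rightarrow>\<^sub>E {..1}" by (auto simp: Delta1_def sop_def PiE_def)
  then have "finite (Delta1 m)" by (rule finite_subset) (auto intro: finite_PiE)
  then show ?thesis by (simp add: circ_def)
qed

lemma mid_in_QOb: "mid m s E \<in> QOb (circ m)"
  using None_in_circ by (auto simp: mid_def QOb_def)

lemma mid_Un: "mid m s (E \<union> E') = mid m s E \<union> mid m s E'"
  by (auto simp: mid_def)

lemma mid_Int: "mid m s (E \<inter> E') = mid m s E \<inter> mid m s E'"
  by (auto simp: mid_def)

lemma mid_empty: "mid m s {} = {None}"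
  by (auto simp: mid_def)

lemma mid_mono: "E \<subseteq> E' \<Longrightarrow> mid m s E \<subseteq> mid m s E'"
  by (auto simp: mid_def)

text \<open>A location is a sum of barycentric coordinates. Grouping that sum by the fibres of
  \<theta> makes pushing s forward adjoint to pulling \<xi> back.\<close>

lemma loc_push:
  assumes "\<theta> \<in> sop k m"
  shows "loc m (simplex_push k \<theta> s) \<xi> = loc k s (\<lambda>i\<in>{..k}. \<xi> (\<theta> i))"
proof -
  have "(\<Sum>j\<in>{j. j \<le> m \<and> \<xi> j = 1}. \<Sum>i\<in>{i \<in> {i. i \<le> k \<and> \<xi> (\<theta> i) = 1}. \<theta> i = j}. s i) =
      (\<Sum>i | i \<le> k \<and> \<xi> (\<theta> i) = 1. s i)"
    using assms by (intro sum.group) (auto dest: sop_le)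
  moreover have "{i \<in> {i. i \<le> k \<and> \<xi> (\<theta> i) = 1}. \<theta> i = j} = {i. i \<le> k \<and> \<theta> i = j}"
    if "\<xi> j = 1" for j using that by auto
  ultimately have "(\<Sum>j | j \<le> m \<and> \<xi> j = 1. simplex_push k \<theta> s j) = (\<Sum>i | i \<le> k \<and> \<xi> (\<theta> i) = 1. s i)"
    unfolding simplex_push_def by (metis (mono_tags, lifting) mem_Collect_eq sum.cong)
  moreover have "{i. i \<le> k \<and> (\<lambda>i\<in>{..k}. \<xi> (\<theta> i)) i = 1} = {i. i \<le> k \<and> \<xi> (\<theta> i) = 1}" by auto
  ultimately show ?thesis by (simp only: loc_def)
qed

lemma loc_const:
  assumes "s \<in> standard_simplex m" "\<forall>i\<le>m. \<xi> i = c"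
  shows "loc m s \<xi> \<in> {0, 1}"
proof (cases "c = 1")
  case True
  then have "{i. i \<le> m \<and> \<xi> i = 1} = {..m}" using assms(2) by auto
  then show ?thesis using assms(1) by (simp add: loc_def standard_simplex_sum)
next
  case False
  then have "{i. i \<le> m \<and> \<xi> i = 1} = {}" using assms(2) by auto
  then show ?thesis unfolding loc_def by (simp only: sum.empty) simp
qed

lemma Delta1_op: "\<theta> \<in> sop k m \<Longrightarrow> \<xi> \<in> Delta1 m \<Longrightarrow> (\<lambda>i\<in>{..k}. \<xi> (\<theta> i)) \<in> Delta1 k"
  by (auto simp: Delta1_iff sop_le sop_mono)

lemma circ_op_in: "\<theta> \<in> sop k m \<Longrightarrow> x \<in> circ m \<Longrightarrow> circ_op k \<theta> x \<in> circ k"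
  using None_in_circ[of k]
  by (cases x) (auto simp: circ_op_def Some_in_circ_iff circ_def[of k] Delta1_op)

text \<open>A simplex of the circle sits at a point of \<open>(0,1)\<close> only if it is not the base point, so
  that sampling over a subset of \<open>(0,1)\<close> commutes with the collapse of faces to the base point.\<close>

lemma pinv_mid:
  assumes "\<theta> \<in> sop k m" "s \<in> standard_simplex k" "E \<subseteq> {0<..<1}"
  shows "pinv (circ_op k \<theta>) (circ m) (mid k s E) = mid m (simplex_push k \<theta> s) E"
proof -
  have "circ_op k \<theta> (Some \<xi>) \<in> mid k s E - {None} \<longleftrightarrow> loc m (simplex_push k \<theta> s) \<xi> \<in> E"
    if "Some \<xi> \<in> circ m" for \<xi>
  proof -
    let ?\<xi> = "\<lambda>i\<in>{..k}. \<xi> (\<theta> i)"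
    have "?\<xi> \<in> Delta1 k" using Delta1_op assms(1) that by (simp add: Some_in_circ_iff)
    moreover have "loc k s ?\<xi> \<notin> E" if "\<forall>i\<le>k. ?\<xi> i = c" for c
    proof
      assume "loc k s ?\<xi> \<in> E"
      with assms(3) have "loc k s ?\<xi> \<in> {0<..<1}" by (rule subsetD)
      with loc_const[OF assms(2) that] show False by (auto simp del: restrict_apply)
    qed
    ultimately show ?thesis unfolding loc_push[OF assms(1)]
      by (auto simp: circ_op_def circ_class_def mid_def Some_in_circ_iff simp del: restrict_apply)
  qed
  moreover have "circ_op k \<theta> None \<notin> mid k s E - {None}" by (simp add: circ_op_def)
  ultimately show ?thesis unfolding pinv_def
    by (auto simp: mid_def[of m])
qed

section \<open>The reflection of the circle and its effect on locations\<close>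

lemma circ_inv_Some:
  assumes "Some \<xi> \<in> circ m"
  shows "circ_inv m (Some \<xi>) = Some (\<lambda>i\<in>{..m}. 1 - \<xi> (m - i))"
    and "Some (\<lambda>i\<in>{..m}. 1 - \<xi> (m - i)) \<in> circ m"
proof -
  have nc: "\<not> (\<exists>c. \<forall>i\<le>m. \<xi> i = c)" and le: "\<forall>i\<le>m. \<xi> i \<le> 1"
    and mono: "\<forall>i j. i \<le> j \<longrightarrow> j \<le> m \<longrightarrow> \<xi> i \<le> \<xi> j"
    using assms by (auto simp: Some_in_circ_iff Delta1_iff)
  have *: "\<not> (\<exists>c. \<forall>i\<le>m. (\<lambda>i\<in>{..m}. 1 - \<xi> (m - i)) i = c)"
  proof
    assume "\<exists>c. \<forall>i\<le>m. (\<lambda>i\<in>{..m}. 1 - \<xi> (m - i)) i = c"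
    then obtain c where c: "\<And>i. i \<le> m \<Longrightarrow> 1 - \<xi> (m - i) = c" by auto
    have "\<xi> i = 1 - c" if "i \<le> m" for i
      using c[of "m - i"] le that by (metis diff_diff_cancel diff_le_self)
    then show False using nc by blast
  qed
  then show "circ_inv m (Some \<xi>) = Some (\<lambda>i\<in>{..m}. 1 - \<xi> (m - i))"
    unfolding circ_inv_def circ_class_def by (simp del: restrict_apply)
  have "(\<lambda>i\<in>{..m}. 1 - \<xi> (m - i)) \<in> Delta1 m"
    unfolding Delta1_iff using mono by (auto intro!: diff_le_mono2)
  with * show "Some (\<lambda>i\<in>{..m}. 1 - \<xi> (m - i)) \<in> circ m" by (simp only: Some_in_circ_iff simp_thms)
qed

lemma circ_inv_None [simp]: "circ_inv m None = None"
  by (simp add: circ_inv_def)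

lemma circ_inv_in: "x \<in> circ m \<Longrightarrow> circ_inv m x \<in> circ m"
  by (cases x) (auto simp: circ_inv_Some None_in_circ simp del: One_nat_def)

lemma circ_inv_inv: "x \<in> circ m \<Longrightarrow> circ_inv m (circ_inv m x) = x"
proof (cases x)
  case (Some \<xi>)
  assume "x \<in> circ m"
  then have \<xi>: "Some \<xi> \<in> circ m" by (simp add: Some)
  then have "\<xi> \<in> Delta1 m" by (simp add: Some_in_circ_iff)
  then have "\<xi> = (\<lambda>i\<in>{..m}. 1 - (\<lambda>i\<in>{..m}. 1 - \<xi> (m - i)) (m - i))"
    by (auto simp: Delta1_iff extensional_def fun_eq_iff)
  then show ?thesis
    using circ_inv_Some(1)[OF \<xi>] circ_inv_Some(1)[OF circ_inv_Some(2)[OF \<xi>]] by (simp add: Some)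
qed simp

lemma circ_inv_op:
  assumes "\<theta> \<in> sop k m" "x \<in> circ m"
  shows "circ_inv k (circ_op k \<theta> x) = circ_op k (rev_op k m \<theta>) (circ_inv m x)"
proof (cases x)
  case (Some \<xi>)
  let ?\<xi> = "\<lambda>i\<in>{..k}. \<xi> (\<theta> i)"
  have \<xi>: "Some \<xi> \<in> circ m" using assms(2) by (simp add: Some)
  have "circ_inv m x = Some (\<lambda>i\<in>{..m}. 1 - \<xi> (m - i))" using circ_inv_Some(1)[OF \<xi>] Some by simp
  then have R: "circ_op k (rev_op k m \<theta>) (circ_inv m x) = circ_class k (\<lambda>i\<in>{..k}. 1 - ?\<xi> (k - i))"
    using assms(1) by (auto simp: circ_op_def rev_op_def sop_le cong: restrict_cong)
  have D: "?\<xi> \<in> Delta1 k" using Delta1_op assms(1) \<xi> by (simp add: Some_in_circ_iff)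
  show ?thesis
  proof (cases "\<exists>c. \<forall>i\<le>k. ?\<xi> i = c")
    case True
    then have "circ_op k \<theta> x = None" by (simp only: Some circ_op_def circ_class_def option.case if_True)
    moreover have "\<exists>c. \<forall>i\<le>k. (\<lambda>i\<in>{..k}. 1 - ?\<xi> (k - i)) i = c" using True by auto
    ultimately show ?thesis unfolding R by (simp only: circ_class_def if_True circ_inv_None)
  next
    case False
    then have "Some ?\<xi> \<in> circ k" using D by (simp only: Some_in_circ_iff simp_thms)
    moreover have "circ_op k \<theta> x = Some ?\<xi>"
      using False by (simp only: Some circ_op_def circ_class_def option.case if_False)
    ultimately show ?thesis unfolding R
      using False by (simp only: circ_inv_def option.case)
  qed
qed (simp add: circ_op_def)

text \<open>The reflected simplex takes the value 1 exactly at the flips of those vertices where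
  \<xi> is not 1, and all coordinates add up to 1.\<close>

lemma loc_inv:
  assumes "s \<in> standard_simplex m" "Some \<xi> \<in> circ m"
  shows "loc m s (\<lambda>i\<in>{..m}. 1 - \<xi> (m - i)) = 1 - loc m (simplex_rev m s) \<xi>"
proof -
  have flip: "1 - \<xi> i = 1 \<longleftrightarrow> \<xi> i \<noteq> 1" if "i \<le> m" for i
  proof -
    have "\<xi> i \<le> 1" using assms(2) that by (auto simp: Some_in_circ_iff Delta1_iff)
    then show ?thesis by linarith
  qed
  have "bij_betw (\<lambda>i. m - i) {i. i \<le> m \<and> \<xi> i \<noteq> 1} {i. i \<le> m \<and> (\<lambda>i\<in>{..m}. 1 - \<xi> (m - i)) i = 1}"
    by (intro bij_betw_byWitness[where f' = "\<lambda>i. m - i"]) (auto simp: flip simp del: One_nat_def)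
  from sum.reindex_bij_betw[OF this, of s]
  have "loc m s (\<lambda>i\<in>{..m}. 1 - \<xi> (m - i)) = (\<Sum>i | i \<le> m \<and> \<xi> i \<noteq> 1. simplex_rev m s i)"
    by (simp add: loc_def simplex_rev_def)
  moreover have "loc m (simplex_rev m s) \<xi> + (\<Sum>i | i \<le> m \<and> \<xi> i \<noteq> 1. simplex_rev m s i) =
      sum (simplex_rev m s) {..m}"
    unfolding loc_def by (subst sum.union_disjoint[symmetric]) (auto intro!: sum.cong)
  ultimately show ?thesis
    using standard_simplex_sum[OF simplex_rev_in[OF assms(1)]] by simp
qed

text \<open>One inclusion is enough: applied to the reversed coordinates and the reflected set, and
  then transported by the involution, it yields the other one.\<close>

lemma circ_inv_image_mid:
  assumes "s \<in> standard_simplex m"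
  shows "circ_inv m ` mid m (simplex_rev m s) E = mid m s ((-) 1 ` E)"
proof -
  have 1: "circ_inv m ` mid m (simplex_rev m s) E \<subseteq> mid m s ((-) 1 ` E)"
    if "s \<in> standard_simplex m" for s E
    using that by (auto simp: mid_def circ_inv_Some loc_inv simp del: One_nat_def)
  have "mid m s ((-) 1 ` E) = circ_inv m ` circ_inv m ` mid m s ((-) 1 ` E)"
    unfolding image_image using mid_in_QOb[of m s "(-) 1 ` E"]
    by (subst image_cong[OF refl, of _ _ "\<lambda>x. x"]) (auto simp: QOb_def intro!: circ_inv_inv)
  also have "\<dots> \<subseteq> circ_inv m ` mid m (simplex_rev m s) ((-) 1 ` (-) 1 ` E)"
    using 1[OF simplex_rev_in[OF assms], of "(-) 1 ` E"] by (simp add: simplex_rev_rev assms image_mono)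
  also have "(-) 1 ` (-) 1 ` E = E" by (auto simp: image_image)
  finally show ?thesis using 1[OF assms] by blast
qed

section \<open>Chain positions near the two ends of the nerve coordinate\<close>

lemma lo_le:
  assumes "t \<in> standard_simplex n" "\<delta> < 1"
  shows "lo t \<delta> \<le> n" "\<delta> < sum t {..lo t \<delta>}"
  using standard_simplex_sum[OF assms(1)] assms(2)
  by (auto simp: lo_def intro: Least_le LeastI[of "\<lambda>j. \<delta> < sum t {..j}" n])

lemma lo_least: "j < lo t \<delta> \<Longrightarrow> sum t {..j} \<le> \<delta>"
  unfolding lo_def using not_less_Least by fastforce

lemma lo_mono:
  assumes "t \<in> standard_simplex n" "\<delta> \<le> \<delta>'" "\<delta>' < 1"
  shows "lo t \<delta> \<le> lo t \<delta>'"
  using lo_le(2)[OF assms(1,3)] assms(2) unfolding lo_def[of t \<delta>] by (auto intro: Least_le)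

text \<open>The j-th partial sum of the push-forward is the sum of t over all i with \<psi> i \<le>
  j. By monotonicity of \<psi> these i form an initial segment, so the first partial sum above
  \<delta> occurs at the image of the original index.\<close>

lemma lo_push:
  assumes "\<psi> \<in> sop l n" "t \<in> standard_simplex l" "0 \<le> \<delta>" "\<delta> < 1"
  shows "lo (simplex_push l \<psi> t) \<delta> = \<psi> (lo t \<delta>)"
proof -
  have cum: "sum (simplex_push l \<psi> t) {..j} = (\<Sum>i | i \<le> l \<and> \<psi> i \<le> j. t i)" for j
  proof -
    have "(\<Sum>j'\<in>{..j}. \<Sum>i\<in>{i \<in> {i. i \<le> l \<and> \<psi> i \<le> j}. \<psi> i = j'}. t i) = (\<Sum>i | i \<le> l \<and> \<psi> i \<le> j. t i)"
      by (intro sum.group) auto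
    moreover have "{i \<in> {i. i \<le> l \<and> \<psi> i \<le> j}. \<psi> i = j'} = {i. i \<le> l \<and> \<psi> i = j'}" if "j' \<le> j" for j'
      using that by auto
    ultimately show ?thesis unfolding simplex_push_def
      by (metis (no_types, lifting) atMost_iff sum.cong)
  qed
  note a = lo_le[OF assms(2,4)]
  show ?thesis unfolding lo_def[of "simplex_push l \<psi> t"] cum
  proof (rule Least_equality)
    have "sum t {..lo t \<delta>} \<le> (\<Sum>i | i \<le> l \<and> \<psi> i \<le> \<psi> (lo t \<delta>). t i)"
      using a assms by (intro sum_mono2) (auto intro: sop_mono standard_simplex_nonneg)
    with a show "\<delta> < (\<Sum>i | i \<le> l \<and> \<psi> i \<le> \<psi> (lo t \<delta>). t i)" by simp
    fix j assume j: "\<delta> < (\<Sum>i | i \<le> l \<and> \<psi> i \<le> j. t i)"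
    show "\<psi> (lo t \<delta>) \<le> j"
    proof (rule ccontr)
      assume "\<not> \<psi> (lo t \<delta>) \<le> j"
      then have sub: "{i. i \<le> l \<and> \<psi> i \<le> j} \<subseteq> {..<lo t \<delta>}"
        using assms(1) by (auto simp: not_le[symmetric]) (meson le_trans sop_mono)
      have "(\<Sum>i | i \<le> l \<and> \<psi> i \<le> j. t i) \<le> sum t {..<lo t \<delta>}"
        using sub assms by (intro sum_mono2) (auto intro: standard_simplex_nonneg)
      \<comment> \<open>If the index is 0 the sum is empty and the bound is 0 \<le> \<delta>;
        otherwise minimality is applied to the predecessor.\<close>
      also have "\<dots> \<le> \<delta>"
        using lo_least[of "lo t \<delta> - 1" t \<delta>] assms(3)
        by (cases "lo t \<delta>") (auto simp: lessThan_Suc_atMost)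
      finally show False using j by simp
    qed
  qed
qed

lemma hi_push:
  assumes "\<psi> \<in> sop l n" "t \<in> standard_simplex l" "0 \<le> \<delta>" "\<delta> < 1"
  shows "hi n (simplex_push l \<psi> t) \<delta> = \<psi> (hi l t \<delta>)"
proof -
  have t: "simplex_rev l t \<in> standard_simplex l" using assms(2) by (rule simplex_rev_in)
  show ?thesis
    unfolding hi_def simplex_rev_push[OF assms(1)] lo_push[OF rev_op_in_sop[OF assms(1)] t assms(3,4)]
    using assms(1) lo_le(1)[OF t assms(4)] by (auto simp: rev_op_def sop_le)
qed

lemma hi_le: "hi n t \<delta> \<le> n"
  by (simp add: hi_def)

text \<open>If the two positions crossed, the steps up to the index a just before
  \<open>lo t \<delta>\<close> and the steps after a would each have total length at most \<delta>.
  All steps together have length 1, which exceeds 2 \<delta>.\<close>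

lemma lo_le_hi:
  assumes "t \<in> standard_simplex n" "\<delta> < 1/2"
  shows "lo t \<delta> \<le> hi n t \<delta>"
proof (rule ccontr)
  let ?r = "simplex_rev n t"
  assume "\<not> lo t \<delta> \<le> hi n t \<delta>"
  moreover have r: "?r \<in> standard_simplex n" using assms(1) by (rule simplex_rev_in)
  moreover have "lo ?r \<delta> \<le> n" using lo_le(1)[OF r] assms(2) by simp
  ultimately have lt: "hi n t \<delta> < lo t \<delta>" "n < lo t \<delta> + lo ?r \<delta>" by (auto simp: hi_def)
  have ln: "lo t \<delta> \<le> n" using lo_le(1)[OF assms(1)] assms(2) by simp
  have "lo t \<delta> \<noteq> 0" using lt by (cases "lo t \<delta>") auto
  define a where "a = lo t \<delta> - 1"
  have a: "sum t {..a} \<le> \<delta>" by (rule lo_least) (use \<open>lo t \<delta> \<noteq> 0\<close> in \<open>simp add: a_def\<close>)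
  have an: "a < n" using ln \<open>lo t \<delta> \<noteq> 0\<close> by (simp add: a_def)
  have b: "sum ?r {..n - a - 1} \<le> \<delta>"
    by (rule lo_least) (use lt an \<open>lo t \<delta> \<noteq> 0\<close> in \<open>simp add: a_def\<close>)
  have "bij_betw (\<lambda>i. n - i) {..n - a - 1} {a<..n}"
    using an by (intro bij_betw_byWitness[where f' = "\<lambda>i. n - i"]) auto
  from sum.reindex_bij_betw[OF this, of t]
  have "(\<Sum>i\<le>n - a - 1. t (n - i)) = sum t {a<..n}" by simp
  moreover have "sum ?r {..n - a - 1} = (\<Sum>i\<le>n - a - 1. t (n - i))"
    by (intro sum.cong) (use an in \<open>auto simp: simplex_rev_def\<close>)
  moreover have "sum t {..a} + sum t {a<..n} = sum t {..n}"
    using an by (subst sum.union_disjoint[symmetric]) (auto simp: ivl_disj_un)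
  ultimately show False using a b assms(2) standard_simplex_sum[OF assms(1)] by simp
qed

lemma hi_mono:
  assumes "t \<in> standard_simplex n" "\<delta> \<le> \<delta>'" "\<delta>' < 1"
  shows "hi n t \<delta>' \<le> hi n t \<delta>"
  unfolding hi_def using lo_mono[OF simplex_rev_in[OF assms(1)] assms(2,3)] by simp

lemma lo_rev: "t \<in> standard_simplex n \<Longrightarrow> \<delta> < 1 \<Longrightarrow> lo (simplex_rev n t) \<delta> = n - hi n t \<delta>"
  using lo_le(1)[OF simplex_rev_in] by (simp add: hi_def)

lemma hi_rev: "t \<in> standard_simplex n \<Longrightarrow> hi n (simplex_rev n t) \<delta> = n - lo t \<delta>"
  by (simp add: hi_def simplex_rev_rev)

section \<open>Strict dualities on nerves\<close>

locale strict_dual_cat =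
  fixes C :: "('o, 'm) dcat"
  assumes dob_in: "a \<in> ob C \<Longrightarrow> dob C a \<in> ob C"
    and dob_dob: "a \<in> ob C \<Longrightarrow> dob C (dob C a) = a"
    and dmor_in: "a \<in> ob C \<Longrightarrow> b \<in> ob C \<Longrightarrow> f \<in> hom C a b \<Longrightarrow>
      dmor C a b f \<in> hom C (dob C b) (dob C a)"
    and dmor_dmor: "a \<in> ob C \<Longrightarrow> b \<in> ob C \<Longrightarrow> f \<in> hom C a b \<Longrightarrow>
      dmor C (dob C b) (dob C a) (dmor C a b f) = f"
    and dmor_idt: "a \<in> ob C \<Longrightarrow> dmor C a a (idt C a) = idt C (dob C a)"
    and dmor_cmp: "a \<in> ob C \<Longrightarrow> b \<in> ob C \<Longrightarrow> c \<in> ob C \<Longrightarrow> f \<in> hom C a b \<Longrightarrow> g \<in> hom C b c \<Longrightarrow>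
      dmor C a c (cmp C a b c g f) =
        cmp C (dob C c) (dob C b) (dob C a) (dmor C a b f) (dmor C b c g)"

lemma iso_cat_simps [simp]:
  "ob (iso_cat C) = ob C" "idt (iso_cat C) = idt C" "cmp (iso_cat C) = cmp C"
  "dob (iso_cat C) = dob C" "dmor (iso_cat C) = dmor C" "zob (iso_cat C) = zob C"
  "osum (iso_cat C) = osum C" "msum (iso_cat C) = msum C"
  by (simp_all add: iso_cat_def)

lemma iso_cat_hom:
  "f \<in> hom (iso_cat C) a b \<longleftrightarrow> f \<in> hom C a b \<and>
     (\<exists>g \<in> hom C b a. cmp C a b a g f = idt C a \<and> cmp C b a b f g = idt C b)"
  by (simp add: iso_cat_def)

context strict_dual_cat
begin

text \<open>The dual of an inverse is an inverse of the dual.\<close>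

lemma strict_dual_iso_cat: "strict_dual_cat (iso_cat C)"
proof
  fix a b f assume ab: "a \<in> ob (iso_cat C)" "b \<in> ob (iso_cat C)" and f: "f \<in> hom (iso_cat C) a b"
  then obtain g where g: "g \<in> hom C b a" "cmp C a b a g f = idt C a" "cmp C b a b f g = idt C b"
    and f: "f \<in> hom C a b" by (auto simp: iso_cat_hom)
  have "cmp C (dob C b) (dob C a) (dob C b) (dmor C b a g) (dmor C a b f) = idt C (dob C b)"
    using dmor_cmp[of b a b g f] g f ab by (simp add: dmor_idt)
  moreover have "cmp C (dob C a) (dob C b) (dob C a) (dmor C a b f) (dmor C b a g) = idt C (dob C a)"
    using dmor_cmp[of a b a f g] g f ab by (simp add: dmor_idt)
  ultimately show "dmor (iso_cat C) a b f \<in> hom (iso_cat C) (dob (iso_cat C) b) (dob (iso_cat C) a)"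
    using ab f g by (auto simp: iso_cat_hom intro!: dmor_in bexI[of _ "dmor C b a g"])
qed (simp_all add: dob_in dob_dob dmor_dmor dmor_idt dmor_cmp iso_cat_hom)

end

lemma nerveD:
  assumes "x \<in> nerve C n"
  shows "i \<le> n \<Longrightarrow> fst x i \<in> ob C"
    and "i \<le> j \<Longrightarrow> j \<le> n \<Longrightarrow> snd x (i, j) \<in> hom C (fst x i) (fst x j)"
    and "i \<le> n \<Longrightarrow> snd x (i, i) = idt C (fst x i)"
    and "i \<le> j \<Longrightarrow> j \<le> k \<Longrightarrow> k \<le> n \<Longrightarrow>
      cmp C (fst x i) (fst x j) (fst x k) (snd x (j, k)) (snd x (i, j)) = snd x (i, k)"
    and "fst x \<in> extensional {..n}" "snd x \<in> extensional (le_pairs n)"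
  using assms by (auto simp: nerve_def le_pairs_def PiE_def)

context strict_dual_cat
begin

lemma nerve_inv_in:
  assumes "x \<in> nerve C n"
  shows "nerve_inv C n x \<in> nerve C n"
proof -
  note x = nerveD[OF assms]
  show ?thesis
    unfolding nerve_def
    by (simp add: nerve_inv_def le_pairs_def x dob_in dmor_in dmor_idt dmor_cmp[symmetric] PiE_def
        diff_le_mono2)
qed

lemma nerve_inv_inv:
  assumes "x \<in> nerve C n"
  shows "nerve_inv C n (nerve_inv C n x) = x"
proof (rule prod_eqI)
  note x = nerveD[OF assms]
  show "fst (nerve_inv C n (nerve_inv C n x)) = fst x"
    using x(5) by (auto simp: nerve_inv_def x dob_dob extensional_def fun_eq_iff)
  show "snd (nerve_inv C n (nerve_inv C n x)) = snd x"
    using x(6) by (auto simp: nerve_inv_def x dmor_dmor le_pairs_def extensional_def fun_eq_iff)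
qed

end

section \<open>Sum-diagrams in an additive category with strict duality\<close>

text \<open>The record carries no addition of morphisms, so \<open>add\<close> is a separate
  parameter. Zero maps are expressed as composites through \<open>zob\<close>, and
  \<open>add_zero\<close> makes them neutral; together with bilinearity this allows an identity to
  be split into a sum of projectors.\<close>

locale additive_dual_cat = strict_dual_cat C
  for C :: "('o, 'm) dcat" +
  fixes add :: "'o \<Rightarrow> 'o \<Rightarrow> 'm \<Rightarrow> 'm \<Rightarrow> 'm"
  assumes idt_in: "a \<in> ob C \<Longrightarrow> idt C a \<in> hom C a a"
    and cmp_in: "a \<in> ob C \<Longrightarrow> b \<in> ob C \<Longrightarrow> c \<in> ob C \<Longrightarrow> f \<in> hom C a b \<Longrightarrow> g \<in> hom C b c \<Longrightarrow>
      cmp C a b c g f \<in> hom C a c"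
    and cmp_assoc: "a \<in> ob C \<Longrightarrow> b \<in> ob C \<Longrightarrow> c \<in> ob C \<Longrightarrow> d \<in> ob C \<Longrightarrow>
      f \<in> hom C a b \<Longrightarrow> g \<in> hom C b c \<Longrightarrow> h \<in> hom C c d \<Longrightarrow>
      cmp C a b d (cmp C b c d h g) f = cmp C a c d h (cmp C a b c g f)"
    and cmp_idt_right: "a \<in> ob C \<Longrightarrow> b \<in> ob C \<Longrightarrow> f \<in> hom C a b \<Longrightarrow> cmp C a a b f (idt C a) = f"
    and cmp_idt_left: "a \<in> ob C \<Longrightarrow> b \<in> ob C \<Longrightarrow> f \<in> hom C a b \<Longrightarrow> cmp C a b b (idt C b) f = f"
    and add_in: "a \<in> ob C \<Longrightarrow> b \<in> ob C \<Longrightarrow> f \<in> hom C a b \<Longrightarrow> g \<in> hom C a b \<Longrightarrow>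
      add a b f g \<in> hom C a b"
    and add_commute: "a \<in> ob C \<Longrightarrow> b \<in> ob C \<Longrightarrow> f \<in> hom C a b \<Longrightarrow> g \<in> hom C a b \<Longrightarrow>
      add a b f g = add a b g f"
    and cmp_add_left: "a \<in> ob C \<Longrightarrow> b \<in> ob C \<Longrightarrow> c \<in> ob C \<Longrightarrow>
      f \<in> hom C a b \<Longrightarrow> g \<in> hom C b c \<Longrightarrow> h \<in> hom C b c \<Longrightarrow>
      cmp C a b c (add b c g h) f = add a c (cmp C a b c g f) (cmp C a b c h f)"
    and cmp_add_right: "a \<in> ob C \<Longrightarrow> b \<in> ob C \<Longrightarrow> c \<in> ob C \<Longrightarrow>
      f \<in> hom C a b \<Longrightarrow> g \<in> hom C a b \<Longrightarrow> h \<in> hom C b c \<Longrightarrow>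
      cmp C a b c h (add a b f g) = add a c (cmp C a b c h f) (cmp C a b c h g)"
    and zob_in: "zob C \<in> ob C"
    and zob_terminal: "a \<in> ob C \<Longrightarrow> \<exists>!f. f \<in> hom C a (zob C)"
    and zob_initial: "a \<in> ob C \<Longrightarrow> \<exists>!f. f \<in> hom C (zob C) a"
    and add_zero: "a \<in> ob C \<Longrightarrow> b \<in> ob C \<Longrightarrow> f \<in> hom C a b \<Longrightarrow>
      g \<in> hom C a (zob C) \<Longrightarrow> h \<in> hom C (zob C) b \<Longrightarrow> add a b f (cmp C a (zob C) b h g) = f"
    and dob_zob: "dob C (zob C) = zob C"

lemma sum_diagramsD:
  assumes "A \<in> sum_diagrams C X"
  shows "U \<in> QOb X \<Longrightarrow> fst A U \<in> ob C"
    and "(U, V, W) \<in> QMor X \<Longrightarrow> snd A (U, V, W) \<in> hom C (fst A U) (fst A V)"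
    and "U \<in> QOb X \<Longrightarrow> snd A (U, U, U) = idt C (fst A U)"
    and "(U, V, W) \<in> QMor X \<Longrightarrow> (V, V', W') \<in> QMor X \<Longrightarrow>
      cmp C (fst A U) (fst A V) (fst A V') (snd A (V, V', W')) (snd A (U, V, W)) =
        snd A (U, V', W \<inter> W')"
    and "fst A \<in> extensional (QOb X)" "snd A \<in> extensional (QMor X)"
    and "fst A {None} = zob C"
    and "U \<in> QOb X \<Longrightarrow> is_product C (fst A U) (U - {None}) (\<lambda>u. fst A {u, None})
        (\<lambda>u. snd A (U, {u, None}, {u, None}))"
  using assms by (auto simp: sum_diagrams_def Qfunctor_def PiE_def)

lemma QMor_iff: "(U, V, W) \<in> QMor X \<longleftrightarrow> U \<subseteq> X \<and> V \<subseteq> X \<and> W \<subseteq> U \<and> W \<subseteq> V \<and> None \<in> W"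
  by (auto simp: QMor_def QOb_def)

context additive_dual_cat
begin

lemma add_zero_left:
  assumes "a \<in> ob C" "b \<in> ob C" "f \<in> hom C a b" "g \<in> hom C a (zob C)" "h \<in> hom C (zob C) b"
  shows "add a b (cmp C a (zob C) b h g) f = f"
  using assms add_commute[of a b f "cmp C a (zob C) b h g"] add_zero[of a b f g h]
  by (simp add: cmp_in zob_in)

lemma diag_zero:
  assumes "A \<in> sum_diagrams C X" "U \<in> QOb X" "V \<in> QOb X"
  shows "snd A (U, V, {None}) = cmp C (fst A U) (zob C) (fst A V)
      (snd A ({None}, V, {None})) (snd A (U, {None}, {None}))"
    and "snd A (U, {None}, {None}) \<in> hom C (fst A U) (zob C)"
    and "snd A ({None}, V, {None}) \<in> hom C (zob C) (fst A V)"
proof -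
  note A = sum_diagramsD[OF assms(1)]
  have q: "(U, {None}, {None}) \<in> QMor X" "({None}, V, {None}) \<in> QMor X"
    using assms(2,3) by (auto simp: QMor_iff QOb_def)
  then show "snd A (U, V, {None}) = cmp C (fst A U) (zob C) (fst A V)
      (snd A ({None}, V, {None})) (snd A (U, {None}, {None}))"
    using A(4)[OF q] A(7) by simp
  show "snd A (U, {None}, {None}) \<in> hom C (fst A U) (zob C)"
    "snd A ({None}, V, {None}) \<in> hom C (zob C) (fst A V)"
    using A(2)[OF q(1)] A(2)[OF q(2)] A(7) by simp_all
qed

text \<open>The endomorphism of A U given by V \<subseteq> U is the projector onto the labels over
  V. A map into the product A U is determined by its components; on both sides the component at u is
  the projection to u if u lies in V or W, and zero otherwise, the two sets having no proper point
  in common.\<close>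

lemma diag_split:
  assumes A: "A \<in> sum_diagrams C X" and U: "U \<in> QOb X"
    and VW: "V \<subseteq> U" "W \<subseteq> U" "V \<inter> W = {None}"
  shows "snd A (U, U, V \<union> W) = add (fst A U) (fst A U) (snd A (U, U, V)) (snd A (U, U, W))"
proof -
  note D = sum_diagramsD[OF A]
  have None: "None \<in> V" "None \<in> W" using VW(3) by auto
  have q: "(U, U, Y) \<in> QMor X" if "Y \<subseteq> U" "None \<in> Y" for Y
    using that U by (auto simp: QMor_iff QOb_def)
  note m = D(2)[OF q]
  let ?a = "fst A U"
  have a: "?a \<in> ob C" using D(1) U .
  have sing: "{u, None} \<in> QOb X" "(U, {u, None}, {u, None}) \<in> QMor X" if "u \<in> U" for u
    using that U by (auto simp: QMor_iff QOb_def)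
  let ?P = "\<lambda>k. k \<in> hom C ?a ?a \<and> (\<forall>u \<in> U - {None}. cmp C ?a ?a (fst A {u, None})
      (snd A (U, {u, None}, {u, None})) k = snd A (U, {u, None}, (V \<union> W) \<inter> {u, None}))"
  have "\<exists>!k. ?P k"
  proof -
    have "snd A (U, {u, None}, (V \<union> W) \<inter> {u, None}) \<in> hom C ?a (fst A {u, None})" if "u \<in> U" for u
      using that U None by (intro D(2)) (auto simp: QMor_iff QOb_def)
    then show ?thesis
      using D(8)[OF U] a unfolding is_product_def by simp
  qed
  moreover have "?P (snd A (U, U, V \<union> W))"
    using D(4)[OF q[of "V \<union> W"] sing(2)] VW None m[of "V \<union> W"] by auto
  moreover have "?P (add ?a ?a (snd A (U, U, V)) (snd A (U, U, W)))"
  proof (intro conjI ballI)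
    show "add ?a ?a (snd A (U, U, V)) (snd A (U, U, W)) \<in> hom C ?a ?a"
      using a VW None by (intro add_in m) auto
    fix u assume u: "u \<in> U - {None}"
    let ?b = "fst A {u, None}" and ?p = "snd A (U, {u, None}, {u, None})"
    have b: "?b \<in> ob C" using D(1) sing(1) u by simp
    have p: "?p \<in> hom C ?a ?b" using D(2) sing(2) u by simp
    have "cmp C ?a ?a ?b ?p (add ?a ?a (snd A (U, U, V)) (snd A (U, U, W))) =
        add ?a ?b (snd A (U, {u, None}, V \<inter> {u, None})) (snd A (U, {u, None}, W \<inter> {u, None}))"
      using a b p VW None m[of V] m[of W] D(4)[OF q[of V] sing(2), of u] D(4)[OF q[of W] sing(2), of u] u
      by (simp add: cmp_add_right)
    also have "\<dots> = snd A (U, {u, None}, (V \<union> W) \<inter> {u, None})"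
    proof -
      have un: "{u, None} \<in> QOb X" using sing(1) u by simp
      note z = diag_zero[OF A U un]
      consider "u \<in> V" "u \<notin> W" | "u \<in> W" "u \<notin> V" | "u \<notin> V" "u \<notin> W" using VW u by auto
      then show ?thesis
      proof cases
        case 1
        then have "V \<inter> {u, None} = {u, None}" "W \<inter> {u, None} = {None}"
          "(V \<union> W) \<inter> {u, None} = {u, None}" using None by auto
        then show ?thesis using z a b p by (simp only: add_zero)
      next
        case 2
        then have "V \<inter> {u, None} = {None}" "W \<inter> {u, None} = {u, None}"
          "(V \<union> W) \<inter> {u, None} = {u, None}" using None by auto
        then show ?thesis using z a b p by (simp only: add_zero_left)
      next
        case 3
        then have "V \<inter> {u, None} = {None}" "W \<inter> {u, None} = {None}"
          "(V \<union> W) \<inter> {u, None} = {None}" using None by auto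
        then show ?thesis using z a b p cmp_in[OF a zob_in b z(2,3)] by (simp only: add_zero)
      qed
    qed
    finally show "cmp C ?a ?a ?b ?p (add ?a ?a (snd A (U, U, V)) (snd A (U, U, W))) =
        snd A (U, {u, None}, (V \<union> W) \<inter> {u, None})" .
  qed
  ultimately show ?thesis by blast
qed

text \<open>Since the identity of \<open>A U\<close> is the sum of the projectors onto the points of \<open>U\<close>, the
  product \<open>A U\<close> is also a coproduct; hence the dual of a sum-diagram is a sum-diagram.\<close>

lemma diag_coproduct:
  assumes A: "A \<in> sum_diagrams C X" and "finite U" and "U \<in> QOb X" and z: "z \<in> ob C"
    and "\<And>u. u \<in> U - {None} \<Longrightarrow> h u \<in> hom C (fst A {u, None}) z"
  shows "\<exists>!k. k \<in> hom C (fst A U) z \<and> (\<forall>u \<in> U - {None}.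
    cmp C (fst A {u, None}) (fst A U) z k (snd A ({u, None}, U, {u, None})) = h u)"
proof -
  note D = sum_diagramsD[OF A]
  \<comment> \<open>The induction runs over the set F of proper points, so that the empty case is A
    {None}, the zero object, and its initiality.\<close>
  have "\<exists>!k. k \<in> hom C (fst A (insert None F)) z \<and> (\<forall>u \<in> F. cmp C (fst A {u, None})
      (fst A (insert None F)) z k (snd A ({u, None}, insert None F, {u, None})) = h u)"
    if "finite F" "insert None F \<subseteq> X" "None \<notin> F" "\<And>u. u \<in> F \<Longrightarrow> h u \<in> hom C (fst A {u, None}) z"
    for F
    using that
  proof (induction F rule: finite_induct)
    case empty
    then show ?case using zob_initial[OF z] D(7) by simp
  next
    case (insert u F)
    let ?V = "insert None F" and ?U = "insert None (insert u F)" and ?u = "{u, None}"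
    let ?a = "fst A ?U" and ?b = "fst A ?V" and ?c = "fst A ?u"
    have sub: "?U \<subseteq> X" "?V \<subseteq> X" "?u \<subseteq> X" using insert.prems by auto
    have un: "u \<noteq> None" using insert.prems(2) by (metis insertI1)
    have ob: "?a \<in> ob C" "?b \<in> ob C" "?c \<in> ob C"
      using sub by (auto intro!: D(1) simp: QOb_def)
    have obv: "fst A {v, None} \<in> ob C" if "v \<in> F" for v
      using that sub by (intro D(1)) (auto simp: QOb_def)
    have hu: "h u \<in> hom C ?c z" using insert.prems by simp
    have q: "(?U, ?V, ?V) \<in> QMor X" "(?V, ?U, ?V) \<in> QMor X" "(?U, ?u, ?u) \<in> QMor X"
      "(?u, ?U, ?u) \<in> QMor X"
      using sub by (auto simp: QMor_iff)
    have qv: "({v, None}, ?V, {v, None}) \<in> QMor X" "({v, None}, ?U, {v, None}) \<in> QMor X"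
      if "v \<in> F" for v using that sub by (auto simp: QMor_iff)
    note m = D(2)[OF q(1)] D(2)[OF q(2)] D(2)[OF q(3)] D(2)[OF q(4)]
    note mv = D(2)[OF qv(1)] D(2)[OF qv(2)]
    from insert.IH insert.prems obtain k where k: "k \<in> hom C ?b z"
      "\<And>v. v \<in> F \<Longrightarrow> cmp C (fst A {v, None}) ?b z k (snd A ({v, None}, ?V, {v, None})) = h v"
      and kuniq: "\<And>k'. k' \<in> hom C ?b z \<Longrightarrow> (\<forall>v\<in>F. cmp C (fst A {v, None}) ?b z k'
        (snd A ({v, None}, ?V, {v, None})) = h v) \<Longrightarrow> k' = k"
      by (auto elim!: ex1E)
    \<comment> \<open>The map that is k on the summand over F and h u on the new summand, each
      preceded by the projection of A U to that summand.\<close>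
    let ?k = "add ?a z (cmp C ?a ?b z k (snd A (?U, ?V, ?V))) (cmp C ?a ?c z (h u) (snd A (?U, ?u, ?u)))"
    have k1: "cmp C ?a ?b z k (snd A (?U, ?V, ?V)) \<in> hom C ?a z"
      using ob z m k(1) by (intro cmp_in)
    have k2: "cmp C ?a ?c z (h u) (snd A (?U, ?u, ?u)) \<in> hom C ?a z"
      using ob z m hu by (intro cmp_in)
    show ?case
    proof (rule ex1I[of _ ?k], intro conjI ballI)
      show "?k \<in> hom C ?a z" using ob z k1 k2 by (intro add_in)
      fix v assume v: "v \<in> insert u F"
      let ?v = "{v, None}" let ?d = "fst A ?v" let ?i = "snd A (?v, ?U, ?v)"
      have vq: "(?v, ?U, ?v) \<in> QMor X" and vob: "?v \<in> QOb X"
        using v sub by (auto simp: QMor_iff QOb_def)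
      have d: "?d \<in> ob C" using D(1) vob .
      have i: "?i \<in> hom C ?d ?a" using D(2) vq .
      have "cmp C ?d ?a z ?k ?i =
        add ?d z (cmp C ?d ?b z k (cmp C ?d ?a ?b (snd A (?U, ?V, ?V)) ?i))
          (cmp C ?d ?c z (h u) (cmp C ?d ?a ?c (snd A (?U, ?u, ?u)) ?i))"
        using ob z d i k1 k2 k(1) hu m by (simp add: cmp_add_left cmp_assoc)
      also have "\<dots> = add ?d z (cmp C ?d ?b z k (snd A (?v, ?V, ?v \<inter> ?V)))
          (cmp C ?d ?c z (h u) (snd A (?v, ?u, ?v \<inter> ?u)))"
        using D(4)[OF vq q(1)] D(4)[OF vq q(3)] by simp
      also have "\<dots> = h v"
      proof (cases "v = u")
        case True
        then have eq: "?v \<inter> ?V = {None}" "?v \<inter> ?u = ?u" using insert.hyps un by auto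
        have Vob: "?V \<in> QOb X" using sub by (auto simp: QOb_def)
        note zz = diag_zero[OF A vob Vob]
        have "cmp C ?d ?b z k (snd A (?v, ?V, {None})) =
            cmp C ?d (zob C) z (cmp C (zob C) ?b z k (snd A ({None}, ?V, {None}))) (snd A (?v, {None}, {None}))"
          using zz d ob z k(1) zob_in by (simp add: cmp_assoc)
        moreover have "cmp C (zob C) ?b z k (snd A ({None}, ?V, {None})) \<in> hom C (zob C) z"
          using zz d ob z k(1) zob_in by (intro cmp_in)
        moreover have "cmp C ?d ?c z (h u) (snd A (?v, ?u, ?u)) = h u"
          using True D(3)[of ?u] vob hu d z by (simp add: cmp_idt_right)
        ultimately show ?thesis
          unfolding eq using True zz d z hu by (simp add: add_zero_left)
      next
        case False
        then have vF: "v \<in> F" using v by simp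
        then have eq: "?v \<inter> ?V = ?v" "?v \<inter> ?u = {None}" using False insert.prems by auto
        have uob: "?u \<in> QOb X" using sub by (auto simp: QOb_def)
        note zz = diag_zero[OF A vob uob]
        have hv: "h v \<in> hom C ?d z" using insert.prems vF by simp
        have "cmp C ?d ?c z (h u) (snd A (?v, ?u, {None})) =
            cmp C ?d (zob C) z (cmp C (zob C) ?c z (h u) (snd A ({None}, ?u, {None}))) (snd A (?v, {None}, {None}))"
          using zz d ob z hu zob_in by (simp add: cmp_assoc)
        moreover have "cmp C (zob C) ?c z (h u) (snd A ({None}, ?u, {None})) \<in> hom C (zob C) z"
          using zz d ob z hu zob_in by (intro cmp_in)
        ultimately show ?thesis
          unfolding eq k(2)[OF vF] using zz d z hv by (simp add: add_zero)
      qed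
      finally show "cmp C ?d ?a z ?k ?i = h v" .
    next
      fix k' assume k': "k' \<in> hom C ?a z \<and> (\<forall>v\<in>insert u F. cmp C (fst A {v, None}) ?a z k'
          (snd A ({v, None}, ?U, {v, None})) = h v)"
      have Uob: "?U \<in> QOb X" using sub by (auto simp: QOb_def)
      have VI: "?V \<inter> ?u = {None}" using insert.hyps un by auto
      have VU: "?V \<union> ?u = ?U" by auto
      \<comment> \<open>Uniqueness: composing k' with this decomposition of the identity expresses
        k' through its restrictions to the two summands, which are prescribed.\<close>
      have "idt C ?a = add ?a ?a (snd A (?U, ?U, ?V)) (snd A (?U, ?U, ?u))"
        using diag_split[OF A Uob _ _ VI] unfolding VU D(3)[OF Uob] by auto
      moreover have "snd A (?U, ?U, ?V) = cmp C ?a ?b ?a (snd A (?V, ?U, ?V)) (snd A (?U, ?V, ?V))"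
        "snd A (?U, ?U, ?u) = cmp C ?a ?c ?a (snd A (?u, ?U, ?u)) (snd A (?U, ?u, ?u))"
        using D(4)[OF q(1) q(2)] D(4)[OF q(3) q(4)] by simp_all
      ultimately have id: "idt C ?a = add ?a ?a (cmp C ?a ?b ?a (snd A (?V, ?U, ?V)) (snd A (?U, ?V, ?V)))
          (cmp C ?a ?c ?a (snd A (?u, ?U, ?u)) (snd A (?U, ?u, ?u)))" by simp
      have "k' = cmp C ?a ?a z k' (idt C ?a)" using k' ob z by (simp add: cmp_idt_right)
      also have "\<dots> = add ?a z (cmp C ?a ?b z (cmp C ?b ?a z k' (snd A (?V, ?U, ?V))) (snd A (?U, ?V, ?V)))
          (cmp C ?a ?c z (cmp C ?c ?a z k' (snd A (?u, ?U, ?u))) (snd A (?U, ?u, ?u)))"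
        unfolding id using conjunct1[OF k'] ob z m by (simp add: cmp_add_right cmp_assoc cmp_in)
      also have "cmp C ?b ?a z k' (snd A (?V, ?U, ?V)) = k"
      proof (rule kuniq)
        show "cmp C ?b ?a z k' (snd A (?V, ?U, ?V)) \<in> hom C ?b z"
          using k' ob z m by (intro cmp_in) auto
        show "\<forall>v\<in>F. cmp C (fst A {v, None}) ?b z (cmp C ?b ?a z k' (snd A (?V, ?U, ?V)))
            (snd A ({v, None}, ?V, {v, None})) = h v"
        proof
          fix v assume v: "v \<in> F"
          then have "{v, None} \<inter> ?V = {v, None}" by auto
          then show "cmp C (fst A {v, None}) ?b z (cmp C ?b ?a z k' (snd A (?V, ?U, ?V)))
              (snd A ({v, None}, ?V, {v, None})) = h v"
            using k' ob z m mv(1)[OF v] obv[OF v] v D(4)[OF qv(1)[OF v] q(2)] by (simp add: cmp_assoc)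
        qed
      qed
      also have "cmp C ?c ?a z k' (snd A (?u, ?U, ?u)) = h u" using k' by simp
      finally show "k' = ?k" .
    qed
  qed
  moreover have "insert None (U - {None}) = U" "U \<subseteq> X"
    using assms(3) by (auto simp: QOb_def simp del: not_None_eq)
  ultimately show ?thesis
    using assms(2,5) by (metis (no_types, lifting) DiffD2 finite_Diff insertI1)
qed

end

section \<open>Pointed involutions and duals of sum-diagrams\<close>

definition pointed_involution :: "'x option set \<Rightarrow> ('x option \<Rightarrow> 'x option) \<Rightarrow> bool" where
  "pointed_involution X \<sigma> \<longleftrightarrow> finite X \<and> None \<in> X \<and> \<sigma> None = None \<and> (\<forall>x\<in>X. \<sigma> x \<in> X \<and> \<sigma> (\<sigma> x) = x)"

lemma pointed_involution_circ: "pointed_involution (circ m) (circ_inv m)"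
  by (simp add: pointed_involution_def finite_circ None_in_circ circ_inv_in circ_inv_inv)

context
  fixes X :: "'x option set" and \<sigma>
  assumes \<sigma>: "pointed_involution X \<sigma>"
begin

lemma involution_image_image: "U \<subseteq> X \<Longrightarrow> \<sigma> ` \<sigma> ` U = U"
  using \<sigma> by (force simp: pointed_involution_def image_image)

lemma involution_inj_on: "inj_on \<sigma> X"
  using \<sigma> by (intro inj_on_inverseI[of _ \<sigma>]) (simp add: pointed_involution_def)

lemma involution_image_Int: "U \<subseteq> X \<Longrightarrow> V \<subseteq> X \<Longrightarrow> \<sigma> ` (U \<inter> V) = \<sigma> ` U \<inter> \<sigma> ` V"
  by (rule inj_on_image_Int[OF involution_inj_on])

lemma involution_image_subset: "U \<subseteq> X \<Longrightarrow> \<sigma> ` U \<subseteq> X"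
  using \<sigma> by (auto simp: pointed_involution_def)

lemma involution_None_image: "None \<in> U \<Longrightarrow> None \<in> \<sigma> ` U"
  using \<sigma> by (intro image_eqI[of _ _ None]) (simp_all add: pointed_involution_def)

lemma involution_QOb: "U \<in> QOb X \<Longrightarrow> \<sigma> ` U \<in> QOb X"
  using involution_image_subset involution_None_image by (simp add: QOb_def)

lemma involution_QMor: "(U, V, W) \<in> QMor X \<Longrightarrow> (\<sigma> ` V, \<sigma> ` U, \<sigma> ` W) \<in> QMor X"
  using involution_image_subset involution_None_image by (simp add: QMor_iff image_mono)

end

lemma diag_dual_simps:
  "U \<in> QOb X \<Longrightarrow> fst (diag_dual C X \<sigma> A) U = dob C (fst A (\<sigma> ` U))"
  "(U, V, W) \<in> QMor X \<Longrightarrow> snd (diag_dual C X \<sigma> A) (U, V, W) =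
    dmor C (fst A (\<sigma> ` V)) (fst A (\<sigma> ` U)) (snd A (\<sigma> ` V, \<sigma> ` U, \<sigma> ` W))"
  by (auto simp: diag_dual_def)

lemma diag_homD:
  assumes "\<phi> \<in> diag_hom C X A B"
  shows "U \<in> QOb X \<Longrightarrow> \<phi> U \<in> hom C (fst A U) (fst B U)"
    and "(U, V, W) \<in> QMor X \<Longrightarrow>
      cmp C (fst A U) (fst A V) (fst B V) (\<phi> V) (snd A (U, V, W)) =
      cmp C (fst A U) (fst B U) (fst B V) (snd B (U, V, W)) (\<phi> U)"
    and "\<phi> \<in> extensional (QOb X)"
  using assms by (auto simp: diag_hom_def)

lemma QMor_QOb: "(U, V, W) \<in> QMor X \<Longrightarrow> U \<in> QOb X \<and> V \<in> QOb X"
  by (simp add: QMor_def)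

context additive_dual_cat
begin

context
  fixes X :: "'x option set" and \<sigma>
  assumes \<sigma>: "pointed_involution X \<sigma>"
begin

lemma diag_dual_in:
  assumes A: "A \<in> sum_diagrams C X"
  shows "diag_dual C X \<sigma> A \<in> sum_diagrams C X"
proof -
  note D = sum_diagramsD[OF A]
  note QO = involution_QOb[OF \<sigma>] and QM = involution_QMor[OF \<sigma>]
  have \<sigma>None: "\<sigma> None = None" using \<sigma> by (simp add: pointed_involution_def)
  let ?T = "diag_dual C X \<sigma> A"
  have ob: "fst ?T U \<in> ob C" if "U \<in> QOb X" for U
    using that QO D(1) by (simp add: diag_dual_simps dob_in)
  have mor: "snd ?T (U, V, W) \<in> hom C (fst ?T U) (fst ?T V)" if "(U, V, W) \<in> QMor X" for U V W
    using QMor_QOb[OF that] QO D(1) D(2)[OF QM[OF that]] that by (simp add: diag_dual_simps dmor_in)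
  have idt: "snd ?T (U, U, U) = idt C (fst ?T U)" if "U \<in> QOb X" for U
  proof -
    have "(U, U, U) \<in> QMor X" using that by (auto simp: QMor_iff QOb_def)
    then show ?thesis using that QO[OF that] D(1,3) by (simp add: diag_dual_simps dmor_idt)
  qed
  have cmp: "snd ?T (U, V', W \<inter> W') =
      cmp C (fst ?T U) (fst ?T V) (fst ?T V') (snd ?T (V, V', W')) (snd ?T (U, V, W))"
    if q: "(U, V, W) \<in> QMor X" "(V, V', W') \<in> QMor X" for U V V' W W'
  proof -
    have "(U, V', W \<inter> W') \<in> QMor X" using q by (auto simp: QMor_iff)
    then have "snd ?T (U, V', W \<inter> W') =
        dmor C (fst A (\<sigma> ` V')) (fst A (\<sigma> ` U)) (snd A (\<sigma> ` V', \<sigma> ` U, \<sigma> ` (W \<inter> W')))"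
      by (simp add: diag_dual_simps)
    also have "\<sigma> ` (W \<inter> W') = \<sigma> ` W' \<inter> \<sigma> ` W"
    proof -
      have "W \<subseteq> X" "W' \<subseteq> X" using q by (auto simp: QMor_iff)
      then show ?thesis using involution_image_Int[OF \<sigma>] by (simp add: Int_commute)
    qed
    also have "snd A (\<sigma> ` V', \<sigma> ` U, \<dots>) = cmp C (fst A (\<sigma> ` V')) (fst A (\<sigma> ` V)) (fst A (\<sigma> ` U))
        (snd A (\<sigma> ` V, \<sigma> ` U, \<sigma> ` W)) (snd A (\<sigma> ` V', \<sigma> ` V, \<sigma> ` W'))"
      using D(4)[OF QM[OF q(2)] QM[OF q(1)]] by simp
    also have "dmor C (fst A (\<sigma> ` V')) (fst A (\<sigma> ` U)) \<dots> =
        cmp C (fst ?T U) (fst ?T V) (fst ?T V') (snd ?T (V, V', W')) (snd ?T (U, V, W))"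
      using q QMor_QOb[OF q(1)] QMor_QOb[OF q(2)] QO D(1) D(2)[OF QM[OF q(1)]] D(2)[OF QM[OF q(2)]]
      by (simp add: diag_dual_simps dmor_cmp)
    finally show ?thesis .
  qed
  have ext: "fst ?T \<in> extensional (QOb X)" "snd ?T \<in> extensional (QMor X)"
    by (simp_all add: diag_dual_def)
  have is_functor: "Qfunctor C X ?T"
    unfolding Qfunctor_def using ob mor idt cmp ext by (auto simp: PiE_def)
  have zero: "fst ?T {None} = zob C"
    using D(7) \<sigma> by (simp add: QOb_def diag_dual_simps pointed_involution_def dob_zob)
  have prod: "is_product C (fst ?T U) (U - {None}) (\<lambda>u. fst ?T {u, None})
      (\<lambda>u. snd ?T (U, {u, None}, {u, None}))" if U: "U \<in> QOb X" for U
    unfolding is_product_def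
  proof (intro conjI ballI allI impI)
    show "fst ?T U \<in> ob C" using ob U .
    have sing: "{u, None} \<in> QOb X" "(U, {u, None}, {u, None}) \<in> QMor X" if "u \<in> U - {None}" for u
      using that U by (auto simp: QMor_iff QOb_def)
    show "fst ?T {u, None} \<in> ob C"
      "snd ?T (U, {u, None}, {u, None}) \<in> hom C (fst ?T U) (fst ?T {u, None})"
      if "u \<in> U - {None}" for u
      using ob mor sing[OF that] by auto
    fix z h assume z: "z \<in> ob C"
      and h: "\<forall>u \<in> U - {None}. h u \<in> hom C z (fst ?T {u, None})"
    let ?a = "fst A (\<sigma> ` U)"
    have a: "?a \<in> ob C" using D(1) QO U by simp
    have aT: "fst ?T U = dob C ?a" using U by (simp add: diag_dual_simps)
    have c: "fst A {\<sigma> u, None} \<in> ob C" "fst ?T {u, None} = dob C (fst A {\<sigma> u, None})"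
      "(\<sigma> ` {u, None}, \<sigma> ` U, \<sigma> ` {u, None}) \<in> QMor X" if "u \<in> U - {None}" for u
      using D(1)[OF QO[OF sing(1)[OF that]]] sing[OF that] QM[OF sing(2)[OF that]]
      by (simp_all add: \<sigma>None diag_dual_simps)
    have UX: "U \<subseteq> X" using U by (simp add: QOb_def)
    have \<sigma>\<sigma>: "\<sigma> (\<sigma> x) = x" if "x \<in> U" for x
      using that UX \<sigma> by (simp add: pointed_involution_def subset_iff)
    have \<sigma>U': "\<sigma> u \<in> \<sigma> ` U - {None} \<and> \<sigma> (\<sigma> u) = u" if "u \<in> U - {None}" for u
    proof -
      have "\<sigma> u \<noteq> None"
      proof
        assume "\<sigma> u = None"
        then have "u = None" using \<sigma>\<sigma>[of u] \<sigma>None that by simp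
        then show False using that by simp
      qed
      then show ?thesis using that \<sigma>\<sigma> by simp
    qed
    have \<sigma>U: "\<sigma> u \<in> U - {None} \<and> \<sigma> (\<sigma> u) = u" if u: "u \<in> \<sigma> ` U - {None}" for u
    proof -
      from u obtain x where x: "x \<in> U" "u = \<sigma> x" by blast
      then have "x \<noteq> None" using u \<sigma>None by (metis DiffD2 singletonI)
      then show ?thesis using x \<sigma>\<sigma> by simp
    qed
    \<comment> \<open>Dualizing turns a cone from z over the dual diagram at U into a cocone from A
      at \<sigma> U to the dual of z. The product property sought is thus the coproduct property
      already proved, read through the bijection \<open>dmor\<close>.\<close>
    let ?h = "\<lambda>u. dmor C z (dob C (fst A {u, None})) (h (\<sigma> u))"
    have dz: "dob C z \<in> ob C" using z by (rule dob_in)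
    have h': "h u \<in> hom C z (dob C (fst A {\<sigma> u, None}))" if "u \<in> U - {None}" for u
      using h c that by auto
    have "?h u \<in> hom C (fst A {u, None}) (dob C z)" if u: "u \<in> \<sigma> ` U - {None}" for u
      using dmor_in[OF z dob_in h'[of "\<sigma> u"]] c(1)[of "\<sigma> u"] \<sigma>U[OF u] by (simp add: dob_dob)
    moreover have "finite (\<sigma> ` U)"
      using U \<sigma> by (auto simp: pointed_involution_def QOb_def intro: finite_subset)
    ultimately have ex: "\<exists>!k. k \<in> hom C ?a (dob C z) \<and> (\<forall>u \<in> \<sigma> ` U - {None}.
        cmp C (fst A {u, None}) ?a (dob C z) k (snd A ({u, None}, \<sigma> ` U, {u, None})) = ?h u)"
      using U by (intro diag_coproduct[OF A _ QO dz]) simp_all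
    have eq: "cmp C z (fst ?T U) (fst ?T {u, None}) (snd ?T (U, {u, None}, {u, None})) k' = h u \<longleftrightarrow>
        cmp C (fst A {\<sigma> u, None}) ?a (dob C z) (dmor C z (dob C ?a) k')
          (snd A ({\<sigma> u, None}, \<sigma> ` U, {\<sigma> u, None})) = ?h (\<sigma> u)"
      if u: "u \<in> U - {None}" and k': "k' \<in> hom C z (dob C ?a)" for u k'
    proof -
      let ?b = "fst A {\<sigma> u, None}" and ?i = "snd A ({\<sigma> u, None}, \<sigma> ` U, {\<sigma> u, None})"
      have i: "?i \<in> hom C ?b ?a" using D(2)[OF c(3)[OF u]] by (simp add: \<sigma>None)
      have T: "snd ?T (U, {u, None}, {u, None}) = dmor C ?b ?a ?i"
        using sing[OF u] by (simp add: diag_dual_simps \<sigma>None)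
      have di: "dmor C ?b ?a ?i \<in> hom C (dob C ?a) (dob C ?b)" using dmor_in c(1)[OF u] a i .
      have comp: "cmp C z (dob C ?a) (dob C ?b) (dmor C ?b ?a ?i) k' \<in> hom C z (dob C ?b)"
        using cmp_in z a c(1)[OF u] k' di dob_in by simp
      have "dmor C z (dob C ?b) (cmp C z (dob C ?a) (dob C ?b) (dmor C ?b ?a ?i) k') =
          cmp C ?b ?a (dob C z) (dmor C z (dob C ?a) k') ?i"
        using dmor_cmp[OF z dob_in[OF a] dob_in[OF c(1)[OF u]] k' di] a c(1)[OF u] i
        by (simp add: dob_dob dmor_dmor)
      moreover have "dmor C z (dob C ?b) f = dmor C z (dob C ?b) g \<longleftrightarrow> f = g"
        if "f \<in> hom C z (dob C ?b)" "g \<in> hom C z (dob C ?b)" for f g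
        using dmor_dmor[OF z dob_in[OF c(1)[OF u]]] that by metis
      ultimately show ?thesis
        using comp h'[OF u] \<sigma>U'[OF u] unfolding T aT c(2)[OF u] by (metis (no_types, lifting))
    qed
    from ex obtain k where k: "k \<in> hom C ?a (dob C z)" "\<And>u. u \<in> \<sigma> ` U - {None} \<Longrightarrow>
        cmp C (fst A {u, None}) ?a (dob C z) k (snd A ({u, None}, \<sigma> ` U, {u, None})) = ?h u"
      by blast
    have kk: "dmor C z (dob C ?a) (dmor C ?a (dob C z) k) = k"
      using dmor_dmor[OF a dz k(1)] z by (simp add: dob_dob)
    have kin: "dmor C ?a (dob C z) k \<in> hom C z (dob C ?a)"
      using dmor_in[OF a dz k(1)] z by (simp add: dob_dob)
    show "\<exists>!k. k \<in> hom C z (fst ?T U) \<and> (\<forall>u \<in> U - {None}. cmp C z (fst ?T U) (fst ?T {u, None})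
        (snd ?T (U, {u, None}, {u, None})) k = h u)"
    proof (rule ex1I[of _ "dmor C ?a (dob C z) k"], intro conjI ballI)
      show "dmor C ?a (dob C z) k \<in> hom C z (fst ?T U)" using kin aT by simp
      fix u assume u: "u \<in> U - {None}"
      show "cmp C z (fst ?T U) (fst ?T {u, None}) (snd ?T (U, {u, None}, {u, None}))
          (dmor C ?a (dob C z) k) = h u"
        unfolding eq[OF u kin] kk using k(2) \<sigma>U'[OF u] by blast
    next
      fix k' assume k': "k' \<in> hom C z (fst ?T U) \<and> (\<forall>u \<in> U - {None}. cmp C z (fst ?T U)
          (fst ?T {u, None}) (snd ?T (U, {u, None}, {u, None})) k' = h u)"
      then have k'in: "k' \<in> hom C z (dob C ?a)" by (simp add: aT)
      let ?k = "dmor C z (dob C ?a) k'"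
      have "?k \<in> hom C ?a (dob C z)" using dmor_in[OF z dob_in[OF a] k'in] a by (simp add: dob_dob)
      moreover have "cmp C (fst A {u, None}) ?a (dob C z) ?k (snd A ({u, None}, \<sigma> ` U, {u, None})) = ?h u"
        if u: "u \<in> \<sigma> ` U - {None}" for u
      proof -
        have "cmp C z (fst ?T U) (fst ?T {\<sigma> u, None}) (snd ?T (U, {\<sigma> u, None}, {\<sigma> u, None})) k' = h (\<sigma> u)"
          using k' \<sigma>U[OF u] by blast
        then show ?thesis using eq[of "\<sigma> u" k'] k'in \<sigma>U[OF u] by simp
      qed
      ultimately have "?k = k" using ex k by blast
      then show "k' = dmor C ?a (dob C z) k"
        using dmor_dmor[OF z dob_in[OF a] k'in] a by (simp add: dob_dob)
    qed
  qed
  show ?thesis using is_functor zero prod by (simp add: sum_diagrams_def)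
qed

lemma strict_dual_diag_cat: "strict_dual_cat (diag_cat C X \<sigma>)"
proof -
  let ?D = "diag_cat C X \<sigma>" and ?T = "diag_dual C X \<sigma>"
  note QO = involution_QOb[OF \<sigma>] and QM = involution_QMor[OF \<sigma>]
  have S: "ob ?D = sum_diagrams C X" "hom ?D = diag_hom C X"
    "dob ?D = diag_dual C X \<sigma>"
    by (simp_all add: diag_cat_def)
  have ii: "\<sigma> ` \<sigma> ` U = U" if "U \<in> QOb X" for U
    using that involution_image_image[OF \<sigma>] by (simp add: QOb_def)
  show ?thesis
  proof
    fix A assume "A \<in> ob ?D"
    then have A: "A \<in> sum_diagrams C X" by (simp add: S)
    note D = sum_diagramsD[OF A]
    show "dob ?D A \<in> ob ?D" using A by (simp add: S diag_dual_in)
    show "dob ?D (dob ?D A) = A"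
      unfolding S
    proof (rule prod_eqI; rule ext)
      fix U
      show "fst (?T (?T A)) U = fst A U"
      proof (cases "U \<in> QOb X")
        case True
        then show ?thesis using QO[OF True] D(1) by (simp add: diag_dual_simps ii dob_dob)
      qed (use D(5) in \<open>simp add: diag_dual_def extensional_def\<close>)
    next
      fix w
      show "snd (?T (?T A)) w = snd A w"
      proof (cases "w \<in> QMor X")
        case True
        then obtain U V W where w: "w = (U, V, W)" "(U, V, W) \<in> QMor X" by (cases w) auto
        then have "\<sigma> ` \<sigma> ` W = W" using involution_image_image[OF \<sigma>] by (auto simp: QMor_iff)
        then show ?thesis using w QM[OF w(2)] QO QMor_QOb[OF w(2)] D(1) D(2)
          by (simp add: diag_dual_simps ii dmor_dmor)
      qed (cases w, use D(6) in \<open>simp add: diag_dual_def extensional_def\<close>)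
    qed
    show "dmor ?D A A (idt ?D A) =
        idt ?D (dob ?D A)"
      using QO D(1) by (auto simp: diag_cat_def diag_dual_simps dmor_idt intro!: restrict_ext)
  next
    fix A B \<phi> assume "A \<in> ob ?D" "B \<in> ob ?D"
      and "\<phi> \<in> hom ?D A B"
    then have A: "A \<in> sum_diagrams C X" and B: "B \<in> sum_diagrams C X" and \<phi>: "\<phi> \<in> diag_hom C X A B"
      by (simp_all add: S)
    note DA = sum_diagramsD[OF A] and DB = sum_diagramsD[OF B] and H = diag_homD[OF \<phi>]
    have dm: "dmor ?D A B \<phi> U = dmor C (fst A (\<sigma> ` U)) (fst B (\<sigma> ` U)) (\<phi> (\<sigma> ` U))"
      if "U \<in> QOb X" for U using that by (simp add: diag_cat_def)
    show "dmor ?D A B \<phi> \<in> hom ?D (dob ?D B) (dob ?D A)"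
      unfolding S diag_hom_def
    proof (intro CollectI conjI ballI)
      show "dmor ?D A B \<phi> \<in> extensional (QOb X)" by (simp add: diag_cat_def)
      show "dmor ?D A B \<phi> U \<in> hom C (fst (?T B) U) (fst (?T A) U)"
        if "U \<in> QOb X" for U
        using that QO DA(1) DB(1) H(1) by (simp add: dm diag_dual_simps dmor_in)
      fix w assume w: "w \<in> QMor X"
      then obtain U V W where w: "w = (U, V, W)" "(U, V, W) \<in> QMor X" by (cases w) auto
      note U = QMor_QOb[OF w(2)] and q = QM[OF w(2)]
      show "case w of (U, V, W) \<Rightarrow> cmp C (fst (?T B) U) (fst (?T B) V)
          (fst (?T A) V) (dmor ?D A B \<phi> V) (snd (?T B) (U, V, W)) =
        cmp C (fst (?T B) U) (fst (?T A) U) (fst (?T A) V)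
          (snd (?T A) (U, V, W)) (dmor ?D A B \<phi> U)"
        using U QO DA(1) DB(1) DA(2)[OF q] DB(2)[OF q] H(1)[OF QO] H(2)[OF q] w(2)
        by (simp add: w(1) dm diag_dual_simps dmor_cmp[symmetric])
    qed
    show "dmor ?D (dob ?D B) (dob ?D A)
        (dmor ?D A B \<phi>) = \<phi>"
    proof
      fix U
      show "dmor ?D (dob ?D B) (dob ?D A)
        (dmor ?D A B \<phi>) U = \<phi> U"
      proof (cases "U \<in> QOb X")
        case True
        then show ?thesis using QO[OF True] DA(1) DB(1) H(1)
          by (simp add: diag_cat_def diag_dual_simps ii dmor_dmor)
      qed (use H(3) in \<open>simp add: diag_cat_def extensional_def\<close>)
    qed
  next
    fix A B D \<phi> \<psi> assume "A \<in> ob ?D" "B \<in> ob ?D" "D \<in> ob ?D"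
      and "\<phi> \<in> hom ?D A B" "\<psi> \<in> hom ?D B D"
    then have A: "A \<in> sum_diagrams C X" and B: "B \<in> sum_diagrams C X" and D: "D \<in> sum_diagrams C X"
      and \<phi>: "\<phi> \<in> diag_hom C X A B" and \<psi>: "\<psi> \<in> diag_hom C X B D"
      by (simp_all add: S)
    show "dmor ?D A D (cmp ?D A B D \<psi> \<phi>) =
        cmp ?D (dob ?D D) (dob ?D B) (dob ?D A)
          (dmor ?D A B \<phi>) (dmor ?D B D \<psi>)"
      using QO sum_diagramsD(1)[OF A] sum_diagramsD(1)[OF B] sum_diagramsD(1)[OF D]
        diag_homD(1)[OF \<phi>] diag_homD(1)[OF \<psi>]
      by (auto simp: diag_cat_def diag_dual_simps dmor_cmp intro!: restrict_ext)
  qed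
qed

end

end

section \<open>The involution of \<open>NiA\<close>\<close>

lemma pinv_QOb: "None \<in> X \<Longrightarrow> pinv f X U \<in> QOb X"
  by (auto simp: pinv_def QOb_def)

lemma pinv_QMor: "None \<in> X \<Longrightarrow> (U, V, W) \<in> QMor Y \<Longrightarrow> (pinv f X U, pinv f X V, pinv f X W) \<in> QMor X"
  by (auto simp: pinv_def QMor_iff)

text \<open>Preimages turn the commutation \<open>circ_inv_op\<close> of the reflection with circle
  operators into a statement on pointed subsets. The reflection sends only the base point to the
  base point, so removing it on both sides does no harm.\<close>

lemma pinv_circ_inv:
  assumes "\<theta> \<in> sop k m" "U \<in> QOb (circ k)"
  shows "circ_inv m ` pinv (circ_op k (rev_op k m \<theta>)) (circ m) U =
    pinv (circ_op k \<theta>) (circ m) (circ_inv k ` U)"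
proof -
  have U: "U \<subseteq> circ k" using assms(2) by (simp add: QOb_def)
  have None: "circ_inv k y = None \<longleftrightarrow> y = None" if "y \<in> circ k" for y
    using that circ_inv_inv by (metis circ_inv_None)
  have iff: "circ_op k (rev_op k m \<theta>) (circ_inv m x) \<in> U - {None} \<longleftrightarrow>
      circ_op k \<theta> x \<in> circ_inv k ` U - {None}" if "x \<in> circ m" for x
  proof -
    let ?y = "circ_op k \<theta> x"
    have y: "?y \<in> circ k" using circ_op_in assms(1) that .
    have "circ_inv k ?y \<in> U \<longleftrightarrow> ?y \<in> circ_inv k ` U"
      using y U circ_inv_inv by (metis (no_types, lifting) image_iff subsetD)
    then show ?thesis
      unfolding circ_inv_op[OF assms(1) that, symmetric] using None[OF y] by simp
  qed
  show ?thesis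
  proof (intro equalityI subsetI)
    fix z assume "z \<in> circ_inv m ` pinv (circ_op k (rev_op k m \<theta>)) (circ m) U"
    then obtain x where x: "x \<in> pinv (circ_op k (rev_op k m \<theta>)) (circ m) U" "z = circ_inv m x" by blast
    show "z \<in> pinv (circ_op k \<theta>) (circ m) (circ_inv k ` U)"
    proof (cases "x = None")
      case False
      then have "x \<in> circ m" "circ_op k (rev_op k m \<theta>) x \<in> U - {None}"
        using x(1) by (auto simp: pinv_def)
      then have "z \<in> circ m" "circ_op k \<theta> z \<in> circ_inv k ` U - {None}"
        using iff[of z] circ_inv_inv[of x m] x(2) circ_inv_in[of x m] by simp_all
      then show ?thesis by (simp add: pinv_def)
    qed (simp add: x(2) pinv_def)
  next
    fix z assume z: "z \<in> pinv (circ_op k \<theta>) (circ m) (circ_inv k ` U)"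
    show "z \<in> circ_inv m ` pinv (circ_op k (rev_op k m \<theta>)) (circ m) U"
    proof (cases "z = None")
      case True
      then show ?thesis by (intro image_eqI[of _ _ None]) (simp_all add: pinv_def)
    next
      case False
      then have "z \<in> circ m" "circ_op k \<theta> z \<in> circ_inv k ` U - {None}"
        using z by (auto simp: pinv_def)
      then have "circ_inv m z \<in> pinv (circ_op k (rev_op k m \<theta>)) (circ m) U"
        using iff[of z] circ_inv_in[of z m] by (simp add: pinv_def)
      then show ?thesis using circ_inv_inv \<open>z \<in> circ m\<close> by (metis image_eqI)
    qed
  qed
qed

lemma diag_push_dual:
  assumes "\<theta> \<in> sop k m"
  shows "diag_dual C (circ k) (circ_inv k) (diag_push (circ_op k \<theta>) (circ m) (circ k) A) =
    diag_push (circ_op k (rev_op k m \<theta>)) (circ m) (circ k) (diag_dual C (circ m) (circ_inv m) A)"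
proof -
  note P = pointed_involution_circ[of k]
  have "U \<in> QOb (circ k) \<Longrightarrow> circ_inv k ` U \<in> QOb (circ k)" for U by (rule involution_QOb[OF P])
  moreover have "(U, V, W) \<in> QMor (circ k) \<Longrightarrow>
      (circ_inv k ` V, circ_inv k ` U, circ_inv k ` W) \<in> QMor (circ k)" for U V W
    by (rule involution_QMor[OF P])
  moreover have "(U, V, W) \<in> QMor (circ k) \<Longrightarrow> W \<in> QOb (circ k)" for U V W
    by (auto simp: QMor_iff QOb_def)
  ultimately show ?thesis
    using QMor_QOb[where X = "circ k"] assms
    unfolding diag_dual_def diag_push_def
    by (auto simp: pinv_QOb pinv_QMor None_in_circ pinv_circ_inv intro!: restrict_ext)
qed

lemma diag_push_dmor:
  assumes "\<theta> \<in> sop k m"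
  shows "dmor (diag_cat C (circ k) (circ_inv k)) (diag_push (circ_op k \<theta>) (circ m) (circ k) A)
      (diag_push (circ_op k \<theta>) (circ m) (circ k) B) (diag_push_mor (circ_op k \<theta>) (circ m) (circ k) \<phi>) =
    diag_push_mor (circ_op k (rev_op k m \<theta>)) (circ m) (circ k)
      (dmor (diag_cat C (circ m) (circ_inv m)) A B \<phi>)"
  unfolding diag_cat_def diag_push_def diag_push_mor_def
  using involution_QOb[OF pointed_involution_circ[of k]] assms
  by (auto simp: pinv_QOb None_in_circ pinv_circ_inv intro!: restrict_ext)

lemma circ_op_cong:
  assumes "\<And>i. i \<le> k \<Longrightarrow> \<theta> i = \<theta>' i"
  shows "circ_op k \<theta> = circ_op k \<theta>'"
proof
  fix x :: "(nat \<Rightarrow> nat) option"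
  have "(\<lambda>i\<in>{..k}. \<xi> (\<theta> i)) = (\<lambda>i\<in>{..k}. \<xi> (\<theta>' i))" for \<xi> :: "nat \<Rightarrow> nat"
    using assms by (intro restrict_ext) simp
  then show "circ_op k \<theta> x = circ_op k \<theta>' x" by (simp add: circ_op_def split: option.split)
qed

lemma nerve_op_cong:
  assumes "\<And>i. i \<le> l \<Longrightarrow> \<psi> i = \<psi>' i"
  shows "nerve_op l \<psi> = nerve_op l \<psi>'"
  unfolding nerve_op_def using assms
  by (auto simp: fun_eq_iff le_pairs_def)

text \<open>F and G stand for the action of a circle operator on objects and morphisms, F' and G'
  for that of its reversal. With these abstracted, the nerve direction is reindexing by i \<mapsto>
  n - i.\<close>

lemma nerve_inv_op:
  assumes "\<psi> \<in> sop l n"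
    and dob: "\<And>A. dob D (F A) = F' (dob E A)"
    and dmor: "\<And>A B \<phi>. dmor D (F A) (F B) (G \<phi>) = G' (dmor E A B \<phi>)"
  shows "nerve_inv D l (nerve_map l F G (nerve_op l \<psi> x)) =
    nerve_map l F' G' (nerve_op l (rev_op l n \<psi>) (nerve_inv E n x))"
proof (rule prod_eqI; rule ext)
  fix i show "fst (nerve_inv D l (nerve_map l F G (nerve_op l \<psi> x))) i =
      fst (nerve_map l F' G' (nerve_op l (rev_op l n \<psi>) (nerve_inv E n x))) i"
    using sop_le[OF assms(1)]
    by (simp add: nerve_inv_def nerve_map_def nerve_op_def dob rev_op_def)
next
  fix p show "snd (nerve_inv D l (nerve_map l F G (nerve_op l \<psi> x))) p =
      snd (nerve_map l F' G' (nerve_op l (rev_op l n \<psi>) (nerve_inv E n x))) p"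
    using sop_le[OF assms(1)] sop_mono[OF assms(1)]
    by (cases p) (simp add: nerve_inv_def nerve_map_def nerve_op_def dmor rev_op_def le_pairs_def
        diff_le_mono2)
qed

lemma dual_bisset_NiA:
  assumes "additive_dual_cat (DP \<alpha> \<epsilon>) add"
  shows "dual_bisset (NiA \<alpha> \<epsilon>)"
proof -
  interpret additive_dual_cat "DP \<alpha> \<epsilon>" add by (rule assms)
  have SD: "strict_dual_cat (SD \<alpha> \<epsilon> m)" for m
    by (intro strict_dual_cat.strict_dual_iso_cat strict_dual_diag_cat pointed_involution_circ)
  show ?thesis
  proof
    fix x m n assume x: "x \<in> bs_set (NiA \<alpha> \<epsilon>) m n"
    show "bs_inv (NiA \<alpha> \<epsilon>) m n x \<in> bs_set (NiA \<alpha> \<epsilon>) m n"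
      using x strict_dual_cat.nerve_inv_in[OF SD] by (simp add: NiA_def)
    show "bs_inv (NiA \<alpha> \<epsilon>) m n (bs_inv (NiA \<alpha> \<epsilon>) m n x) = x"
      using x strict_dual_cat.nerve_inv_inv[OF SD] by (simp add: NiA_def)
    fix \<theta> k \<psi> l assume "\<theta> \<in> sop k m" "\<psi> \<in> sop l n"
    then show "bs_inv (NiA \<alpha> \<epsilon>) k l (bs_op (NiA \<alpha> \<epsilon>) m n k l \<theta> \<psi> x) =
        bs_op (NiA \<alpha> \<epsilon>) m n k l (rev_op k m \<theta>) (rev_op l n \<psi>) (bs_inv (NiA \<alpha> \<epsilon>) m n x)"
      unfolding NiA_def bisset.simps
      by (intro nerve_inv_op) (simp_all add: diag_push_dmor, simp add: diag_cat_def diag_push_dual)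
  next
    fix k l m n :: nat and \<theta> \<theta>' \<psi> \<psi>' :: "nat \<Rightarrow> nat" and x
    assume eq: "\<And>i. i \<le> k \<Longrightarrow> \<theta> i = \<theta>' i" "\<And>i. i \<le> l \<Longrightarrow> \<psi> i = \<psi>' i"
    show "bs_op (NiA \<alpha> \<epsilon>) m n k l \<theta> \<psi> x = bs_op (NiA \<alpha> \<epsilon>) m n k l \<theta>' \<psi>' x"
      by (simp add: NiA_def circ_op_cong[of k \<theta> \<theta>', OF eq(1)] nerve_op_cong[of l \<psi> \<psi>', OF eq(2)])
  qed
qed

section \<open>The additive category \<open>DP\<close>\<close>

lemma right_moduleD:
  assumes "right_module M"
  shows "comm_group M"
    and "x \<in> carrier M \<Longrightarrow> ract M x r \<in> carrier M"
    and "x \<in> carrier M \<Longrightarrow> y \<in> carrier M \<Longrightarrow> ract M (x \<otimes>\<^bsub>M\<^esub> y) r = ract M x r \<otimes>\<^bsub>M\<^esub> ract M y r"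
  using assms by (auto simp: right_module_def)

lemma rhomI:
  assumes "f \<in> extensional (carrier M)" "\<And>x. x \<in> carrier M \<Longrightarrow> f x \<in> carrier N"
    "\<And>x y. x \<in> carrier M \<Longrightarrow> y \<in> carrier M \<Longrightarrow> f (x \<otimes>\<^bsub>M\<^esub> y) = f x \<otimes>\<^bsub>N\<^esub> f y"
    "\<And>x r. x \<in> carrier M \<Longrightarrow> f (ract M x r) = ract N (f x) r"
  shows "f \<in> rhom M N"
  using assms by (auto simp: rhom_def PiE_def)

lemma rhomD:
  assumes "f \<in> rhom M N"
  shows "f \<in> extensional (carrier M)" "x \<in> carrier M \<Longrightarrow> f x \<in> carrier N"
    "x \<in> carrier M \<Longrightarrow> y \<in> carrier M \<Longrightarrow> f (x \<otimes>\<^bsub>M\<^esub> y) = f x \<otimes>\<^bsub>N\<^esub> f y"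
    "x \<in> carrier M \<Longrightarrow> f (ract M x r) = ract N (f x) r"
  using assms by (auto simp: rhom_def PiE_def)

lemma comm_group_mult [simp]:
  assumes "comm_group M"
  shows "x \<in> carrier M \<Longrightarrow> y \<in> carrier M \<Longrightarrow> x \<otimes>\<^bsub>M\<^esub> y \<in> carrier M" "\<one>\<^bsub>M\<^esub> \<in> carrier M"
    "x \<in> carrier M \<Longrightarrow> x \<otimes>\<^bsub>M\<^esub> \<one>\<^bsub>M\<^esub> = x" "x \<in> carrier M \<Longrightarrow> \<one>\<^bsub>M\<^esub> \<otimes>\<^bsub>M\<^esub> x = x"
proof -
  interpret comm_group M by (rule assms)
  show "x \<in> carrier M \<Longrightarrow> y \<in> carrier M \<Longrightarrow> x \<otimes>\<^bsub>M\<^esub> y \<in> carrier M" "\<one>\<^bsub>M\<^esub> \<in> carrier M"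
    "x \<in> carrier M \<Longrightarrow> x \<otimes>\<^bsub>M\<^esub> \<one>\<^bsub>M\<^esub> = x" "x \<in> carrier M \<Longrightarrow> \<one>\<^bsub>M\<^esub> \<otimes>\<^bsub>M\<^esub> x = x"
    by simp_all
qed

lemma comm_group_swap:
  assumes "comm_group M" "x \<in> carrier M" "y \<in> carrier M" "z \<in> carrier M" "w \<in> carrier M"
  shows "x \<otimes>\<^bsub>M\<^esub> y \<otimes>\<^bsub>M\<^esub> (z \<otimes>\<^bsub>M\<^esub> w) = x \<otimes>\<^bsub>M\<^esub> z \<otimes>\<^bsub>M\<^esub> (y \<otimes>\<^bsub>M\<^esub> w)"
proof -
  interpret comm_group M by (rule assms)
  show ?thesis using assms by (simp add: m_assoc m_lcomm)
qed

text \<open>Cancellation in the group. It is the common reason why homomorphisms and scalar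
  multiplications preserve the neutral element, which is the zero vector written
  multiplicatively.\<close>

lemma comm_group_idem:
  assumes "comm_group M" "x \<in> carrier M" "x \<otimes>\<^bsub>M\<^esub> x = x"
  shows "x = \<one>\<^bsub>M\<^esub>"
proof -
  interpret comm_group M by (rule assms)
  show ?thesis using assms l_cancel_one by blast
qed

lemma rhom_one:
  assumes "comm_group M" "comm_group N" "f \<in> rhom M N"
  shows "f \<one>\<^bsub>M\<^esub> = \<one>\<^bsub>N\<^esub>"
  using rhomD[OF assms(3)] assms(1,2) comm_group_mult[OF assms(1)]
  by (intro comm_group_idem) (metis, metis, metis)

lemma ract_one:
  assumes "right_module M"
  shows "ract M \<one>\<^bsub>M\<^esub> r = \<one>\<^bsub>M\<^esub>"
  using right_moduleD[OF assms] comm_group_mult[OF right_moduleD(1)[OF assms]]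
  by (intro comm_group_idem) metis+

lemma rhom_compose: "f \<in> rhom M N \<Longrightarrow> g \<in> rhom N P \<Longrightarrow> compose (carrier M) g f \<in> rhom M P"
  if "right_module M"
  using right_moduleD[OF that]
  by (intro rhomI) (auto simp: compose_eq rhomD)

lemma rhom_id: "right_module M \<Longrightarrow> (\<lambda>x\<in>carrier M. x) \<in> rhom M M"
  by (intro rhomI) (auto simp: right_moduleD)

lemma rhom_add:
  assumes "right_module M" "right_module N" "f \<in> rhom M N" "g \<in> rhom M N"
  shows "(\<lambda>x\<in>carrier M. f x \<otimes>\<^bsub>N\<^esub> g x) \<in> rhom M N"
  using assms right_moduleD[OF assms(1)] right_moduleD[OF assms(2)]
  by (intro rhomI) (auto simp: rhomD comm_group_swap)

section \<open>Dual modules, pairings and adjoint maps\<close>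

lemma regular_rmod_simps [simp]:
  "carrier regular_rmod = UNIV" "mult regular_rmod = (+)" "one regular_rmod = 0"
  "ract regular_rmod = (*)"
  by (simp_all add: regular_rmod_def)

lemma dual_rmod_simps [simp]:
  "carrier (dual_rmod \<alpha> P) = rhom P regular_rmod"
  "f \<otimes>\<^bsub>dual_rmod \<alpha> P\<^esub> g = (\<lambda>p\<in>carrier P. f p + g p)"
  "ract (dual_rmod \<alpha> P) f r = (\<lambda>p\<in>carrier P. \<alpha> r * f p)"
  by (simp_all add: dual_rmod_def)

abbreviation car :: "'r dpob \<Rightarrow> (nat \<Rightarrow> 'r) set" where
  "car a \<equiv> carrier (fst a)"

abbreviation dmod :: "'r dpob \<Rightarrow> 'r vmod" where
  "dmod a \<equiv> fst (snd a)"

abbreviation dcar :: "'r dpob \<Rightarrow> (nat \<Rightarrow> 'r) set" where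
  "dcar a \<equiv> carrier (dmod a)"

abbreviation pair :: "'r dpob \<Rightarrow> (nat \<Rightarrow> 'r) \<Rightarrow> (nat \<Rightarrow> 'r) \<Rightarrow> 'r" where
  "pair a \<equiv> snd (snd a)"

lemma DP_simps [simp]:
  "ob (DP \<alpha> \<epsilon>) = DP_ob \<alpha>" "hom (DP \<alpha> \<epsilon>) = DP_hom \<alpha>"
  "idt (DP \<alpha> \<epsilon>) a = (\<lambda>x\<in>car a. x, \<lambda>x\<in>dcar a. x)"
  "cmp (DP \<alpha> \<epsilon>) a b c g f =
    (compose (car a) (fst g) (fst f), compose (dcar c) (snd f) (snd g))"
  "dob (DP \<alpha> \<epsilon>) = DP_dual \<alpha> \<epsilon>"
  "dmor (DP \<alpha> \<epsilon>) a b f = (snd f, fst f)"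
  "osum (DP \<alpha> \<epsilon>) = DP_sum"
  by (simp_all add: DP_def case_prod_beta)

text \<open>The object \<open>(c, c', f)\<close> is regarded as the pairing \<open>f w x\<close> between \<open>w \<in> c'\<close> and \<open>x \<in> c\<close>;
  then a morphism is a pair of adjoint maps, and the duality swaps the two arguments.\<close>

lemma DP_obD:
  fixes a :: "'r::comm_ring_1 dpob"
  assumes "a \<in> DP_ob id"
  shows "right_module (fst a)" "right_module (dmod a)"
    and "w \<in> dcar a \<Longrightarrow> pair a w \<in> rhom (fst a) regular_rmod"
    and "w \<in> dcar a \<Longrightarrow> x \<in> car a \<Longrightarrow> y \<in> car a \<Longrightarrow>
      pair a w (x \<otimes>\<^bsub>fst a\<^esub> y) = pair a w x + pair a w y"
    and "w \<in> dcar a \<Longrightarrow> x \<in> car a \<Longrightarrow>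
      pair a w (ract (fst a) x r) = pair a w x * r"
    and "v \<in> dcar a \<Longrightarrow> w \<in> dcar a \<Longrightarrow> x \<in> car a \<Longrightarrow>
      pair a (v \<otimes>\<^bsub>dmod a\<^esub> w) x = pair a v x + pair a w x"
    and "w \<in> dcar a \<Longrightarrow> x \<in> car a \<Longrightarrow>
      pair a (ract (dmod a) w r) x = pair a w x * r"
    and "w \<in> dcar a \<Longrightarrow> pair a w \<in> extensional (car a)"
    and "pair a \<in> extensional (dcar a)"
    and "bij_betw (pair a) (dcar a) (rhom (fst a) regular_rmod)"
    and "fg_projective (fst a)" "fg_projective (dmod a)"
    and "pair a \<in> rhom (dmod a) (dual_rmod id (fst a))"
proof -
  obtain c c' f where a: "a = (c, c', f)" by (cases a)
  show b: "bij_betw (pair a) (dcar a) (rhom (fst a) regular_rmod)"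
    and p: "fg_projective (fst a)" "fg_projective (dmod a)"
    and F: "pair a \<in> rhom (dmod a) (dual_rmod id (fst a))"
    using assms by (auto simp: a DP_ob_def)
  show "right_module (fst a)" "right_module (dmod a)" using p by (auto simp: fg_projective_def)
  show "pair a \<in> extensional (dcar a)" using rhomD(1)[OF F] .
  show h: "pair a w \<in> rhom (fst a) regular_rmod" if "w \<in> dcar a" for w
    using rhomD(2)[OF F that] by simp
  show "pair a w \<in> extensional (car a)" if "w \<in> dcar a"
    using rhomD(1)[OF h[OF that]] .
  show "pair a w (x \<otimes>\<^bsub>fst a\<^esub> y) = pair a w x + pair a w y"
    if "w \<in> dcar a" "x \<in> car a" "y \<in> car a"
    using rhomD(3)[OF h[OF that(1)] that(2,3)] by simp
  show "pair a w (ract (fst a) x r) = pair a w x * r"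
    if "w \<in> dcar a" "x \<in> car a"
    using rhomD(4)[OF h[OF that(1)] that(2)] by simp
  show "pair a (v \<otimes>\<^bsub>dmod a\<^esub> w) x = pair a v x + pair a w x"
    if "v \<in> dcar a" "w \<in> dcar a" "x \<in> car a"
    using rhomD(3)[OF F that(1,2)] that(3) by simp
  show "pair a (ract (dmod a) w r) x = pair a w x * r"
    if "w \<in> dcar a" "x \<in> car a"
    using rhomD(4)[OF F that(1)] that(2) by (simp add: mult.commute)
qed

text \<open>The equation between f \<circ> s and T r \<circ> g, evaluated first at w and then at x,
  is the adjointness of r and s. Both evaluations lose nothing because all functions involved are
  extensional.\<close>

lemma DP_hom_iff:
  fixes a b :: "'r::comm_ring_1 dpob"
  assumes "a \<in> DP_ob id" "b \<in> DP_ob id"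
  shows "f \<in> DP_hom id a b \<longleftrightarrow> fst f \<in> rhom (fst a) (fst b) \<and>
    snd f \<in> rhom (dmod b) (dmod a) \<and>
    (\<forall>w \<in> dcar b. \<forall>x \<in> car a.
      pair a (snd f w) x = pair b w (fst f x))"
proof -
  have "compose (dcar b) (pair a) (snd f) =
      compose (dcar b) (dual_map id (fst a) (fst b) (fst f)) (pair b) \<longleftrightarrow>
    (\<forall>w \<in> dcar b. \<forall>x \<in> car a.
      pair a (snd f w) x = pair b w (fst f x))" (is "?L = ?R \<longleftrightarrow> _")
    if s: "snd f \<in> rhom (dmod b) (dmod a)"
  proof -
    have "?L = ?R \<longleftrightarrow> (\<forall>w \<in> dcar b. ?L w = ?R w)"
      by (metis compose_extensional extensionalityI)
    also have "\<dots> \<longleftrightarrow> (\<forall>w \<in> dcar b.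
        pair a (snd f w) = compose (car a) (pair b w) (fst f))"
      using DP_obD(3)[OF assms(2)] by (simp add: compose_eq dual_map_def)
    also have "\<dots> \<longleftrightarrow> (\<forall>w \<in> dcar b. \<forall>x \<in> car a.
        pair a (snd f w) x = compose (car a) (pair b w) (fst f) x)"
      using DP_obD(8)[OF assms(1)] rhomD(2)[OF s]
      by (metis compose_extensional extensionalityI)
    finally show ?thesis by (simp add: compose_eq)
  qed
  then show ?thesis by (cases a; cases b; cases f) (auto simp: DP_hom_def)
qed

text \<open>For the identity involution and the unit 1, evaluation at x followed by T f sends w to f
  w x. So the dual of a triple is literally the transposed pairing.\<close>

lemma DP_dual_eq:
  fixes a :: "'r::comm_ring_1 dpob"
  assumes "a \<in> DP_ob id"
  shows "DP_dual id 1 a =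
    (dmod a, fst a, \<lambda>x\<in>car a. \<lambda>w\<in>dcar a. pair a w x)"
proof -
  note D = DP_obD[OF assms]
  have eta: "(\<lambda>f\<in>rhom (fst a) regular_rmod. f x) \<in> rhom (dual_rmod id (fst a)) regular_rmod"
    if x: "x \<in> car a" for x
    using right_moduleD[OF D(1)] that
    by (intro rhomI) (auto simp: rhom_def algebra_simps)
  have "compose (car a) (dual_map id (dmod a) (dual_rmod id (fst a)) (pair a))
      (dual_eta id 1 (fst a)) =
    (\<lambda>x\<in>car a. \<lambda>w\<in>dcar a. pair a w x)"
    using eta D(3) by (auto simp: compose_def dual_map_def dual_eta_def fun_eq_iff)
  then show ?thesis by (cases a) (simp add: DP_dual_def)
qed

section \<open>Functionals on free modules and reflexivity\<close>

lemma free_rmod_simps [simp]: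
  "carrier (free_rmod n) = {v. \<forall>i\<ge>n. v i = 0}" "v \<otimes>\<^bsub>free_rmod n\<^esub> w = (\<lambda>i. v i + w i)"
  "ract (free_rmod n) v r = (\<lambda>i. v i * r)" "\<one>\<^bsub>free_rmod n\<^esub> = (\<lambda>i. 0)"
  by (simp_all add: free_rmod_def)

lemma free_rmod_expand:
  fixes L :: "(nat \<Rightarrow> 'r::comm_ring_1) \<Rightarrow> 'r"
  assumes L: "L \<in> rhom (free_rmod n) regular_rmod" and v: "\<forall>i\<ge>n. v i = 0"
  shows "L v = (\<Sum>k<n. L (\<lambda>i. if i = k then 1 else 0) * v k)"
proof -
  have v': "(\<lambda>i. if i < n then v i else 0) = v" using v by auto
  have "L (\<lambda>i. if i < j then v i else 0) = (\<Sum>k<j. L (\<lambda>i. if i = k then 1 else 0) * v k)"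
    if "j \<le> n" for j
    using that
  proof (induction j)
    case 0
    have "L (\<lambda>i. 0) + L (\<lambda>i. 0) = L (\<lambda>i. 0)" using rhomD(3)[OF L, of "\<lambda>i. 0" "\<lambda>i. 0"] by simp
    then show ?case by simp
  next
    case (Suc j)
    have eq: "(\<lambda>i. if i < Suc j then v i else 0) = (\<lambda>i. (if i < j then v i else 0) + (if i = j then 1 else 0) * v j)"
      by (auto simp: less_Suc_eq)
    have "L (\<lambda>i. (if i < j then v i else 0) + (if i = j then 1 else 0) * v j) =
        L (\<lambda>i. if i < j then v i else 0) + L (\<lambda>i. (if i = j then 1 else 0) * v j)"
      using rhomD(3)[OF L, of "\<lambda>i. if i < j then v i else 0" "\<lambda>i. (if i = j then 1 else 0) * v j"] Suc.prems
      by simp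
    also have "L (\<lambda>i. (if i = j then 1 else 0) * v j) = L (\<lambda>i. if i = j then 1 else 0) * v j"
      using rhomD(4)[OF L, of "\<lambda>i. if i = j then 1 else 0" "v j"] Suc.prems by simp
    finally show ?case unfolding eq using Suc by simp
  qed
  from this[of n] show ?thesis by (simp add: v')
qed

text \<open>Reflexivity of finitely generated projective modules, for a dual given as the target of a
  bijection.\<close>

lemma bij_betw_bidual:
  fixes a :: "'r::comm_ring_1 dpob"
  assumes "a \<in> DP_ob id"
  shows "bij_betw (\<lambda>x\<in>car a. \<lambda>w\<in>dcar a. pair a w x)
    (car a) (rhom (dmod a) regular_rmod)"
proof -
  obtain c c' F where a: "a = (c, c', F)" by (cases a)
  note D = DP_obD[OF assms, unfolded a fst_conv snd_conv]
  from D(11) obtain n i p where i: "i \<in> rhom c (free_rmod n)" and p: "p \<in> rhom (free_rmod n) c"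
    and pi: "\<And>x. x \<in> carrier c \<Longrightarrow> p (i x) = x" by (auto simp: fg_projective_def)
  note c = right_moduleD[OF D(1)] and c' = right_moduleD[OF D(2)]
  let ?e = "\<lambda>k i. if i = k then 1 else (0::'r)"
  let ?J = "inv_into (carrier c') F"
  have FJ: "?J g \<in> carrier c'" "F (?J g) = g" if "g \<in> rhom c regular_rmod" for g
    using that D(10) by (auto simp: bij_betw_def inv_into_into f_inv_into_f)
  have JF: "?J (F w) = w" if "w \<in> carrier c'" for w
    using that D(10) by (simp add: bij_betw_def)
  have comb: "(\<lambda>x\<in>carrier c. \<Sum>k<n. i x k * v k) \<in> rhom c regular_rmod" for v
    using c by (intro rhomI) (auto simp: rhomD[OF i] sum.distrib sum_distrib_left sum_distrib_right algebra_simps)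
  have e: "?e k \<in> carrier (free_rmod n)" if "k < n" for k using that by auto
  show ?thesis
    unfolding a fst_conv snd_conv bij_betw_def
  proof (intro conjI equalityI subsetI)
    show "inj_on (\<lambda>x\<in>carrier c. \<lambda>w\<in>carrier c'. F w x) (carrier c)"
    proof (rule inj_onI)
      fix x y assume x: "x \<in> carrier c" and y: "y \<in> carrier c"
        and eq: "(\<lambda>x\<in>carrier c. \<lambda>w\<in>carrier c'. F w x) x = (\<lambda>x\<in>carrier c. \<lambda>w\<in>carrier c'. F w x) y"
      have Fxy: "F w x = F w y" if "w \<in> carrier c'" for w
        using fun_cong[OF eq, of w] x y that by simp
      have "i x k = i y k" for k
      proof (cases "k < n")
        case True
        \<comment> \<open>The k-th coordinate functional of the embedding i. These functionals come
          from elements of c' and separate the points of c.\<close>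
        let ?g = "\<lambda>x\<in>carrier c. \<Sum>j<n. i x j * ?e k j"
        have "?g x = ?g y" using Fxy[OF FJ(1)[OF comb]] FJ(2)[OF comb] by simp
        then show ?thesis using x y True by (simp add: if_distrib cong: if_cong)
      next
        case False
        then show ?thesis using rhomD(2)[OF i x] rhomD(2)[OF i y] by simp
      qed
      then have "i x = i y" by blast
      then show "x = y" using pi x y by metis
    qed
    show "\<psi> \<in> rhom c' regular_rmod" if "\<psi> \<in> (\<lambda>x\<in>carrier c. \<lambda>w\<in>carrier c'. F w x) ` carrier c" for \<psi>
      using that D c' by (auto intro!: rhomI)
    fix \<psi> assume \<psi>: "\<psi> \<in> rhom c' regular_rmod"
    \<comment> \<open>\<psi> is transported to a functional on \<open>R\<^sup>n\<close>: a
      coefficient vector v gives the combination of the coordinate functionals of i with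
      coefficients v, which is then read as an element of c'.\<close>
    let ?L = "\<lambda>v\<in>carrier (free_rmod n). \<psi> (?J (\<lambda>x\<in>carrier c. \<Sum>k<n. i x k * v k))"
    have Jadd: "?J (\<lambda>x\<in>carrier c. g x + h x) = ?J g \<otimes>\<^bsub>c'\<^esub> ?J h"
      if "g \<in> rhom c regular_rmod" "h \<in> rhom c regular_rmod" for g h
    proof -
      have "F (?J g \<otimes>\<^bsub>c'\<^esub> ?J h) = (\<lambda>x\<in>carrier c. g x + h x)"
        using rhomD(3)[OF D(13) FJ(1) FJ(1), OF that] FJ(2) that by simp
      then show ?thesis using JF[of "?J g \<otimes>\<^bsub>c'\<^esub> ?J h"] FJ(1) that c' by simp
    qed
    have Jract: "?J (\<lambda>x\<in>carrier c. r * g x) = ract c' (?J g) r"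
      if "g \<in> rhom c regular_rmod" for g r
    proof -
      have "F (ract c' (?J g) r) = (\<lambda>x\<in>carrier c. r * g x)"
        using rhomD(4)[OF D(13) FJ(1), OF that] FJ(2) that by simp
      then show ?thesis using JF[of "ract c' (?J g) r"] FJ(1) that c' by simp
    qed
    have L: "?L \<in> rhom (free_rmod n) regular_rmod"
    proof (rule rhomI)
      fix v w :: "nat \<Rightarrow> 'r" assume vw: "v \<in> carrier (free_rmod n)" "w \<in> carrier (free_rmod n)"
      have "(\<lambda>x\<in>carrier c. \<Sum>k<n. i x k * (v k + w k)) = (\<lambda>x\<in>carrier c.
          (\<lambda>x\<in>carrier c. \<Sum>k<n. i x k * v k) x + (\<lambda>x\<in>carrier c. \<Sum>k<n. i x k * w k) x)"
        by (auto simp: sum.distrib distrib_left)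
      then show "?L (v \<otimes>\<^bsub>free_rmod n\<^esub> w) = ?L v \<otimes>\<^bsub>regular_rmod\<^esub> ?L w"
        using vw Jadd[OF comb comb] rhomD(3)[OF \<psi>] FJ(1)[OF comb] by simp
    next
      fix v :: "nat \<Rightarrow> 'r" and r :: 'r assume v: "v \<in> carrier (free_rmod n)"
      have "(\<lambda>x\<in>carrier c. \<Sum>k<n. i x k * (v k * r)) =
          (\<lambda>x\<in>carrier c. r * (\<lambda>x\<in>carrier c. \<Sum>k<n. i x k * v k) x)"
        by (auto simp: sum_distrib_left mult_ac)
      then show "?L (ract (free_rmod n) v r) = ract regular_rmod (?L v) r"
        using v Jract[OF comb] rhomD(4)[OF \<psi>] FJ(1)[OF comb] by simp
    qed simp_all
    \<comment> \<open>The coefficients of this functional on the standard basis; the preimage of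
      \<psi> is their image under the retraction p.\<close>
    let ?v = "\<lambda>k. if k < n then ?L (?e k) else 0"
    have px: "p ?v \<in> carrier c" using rhomD(2)[OF p] by simp
    have "F u (p ?v) = \<psi> u" if u: "u \<in> carrier c'" for u
    proof -
      let ?G = "\<lambda>v\<in>carrier (free_rmod n). F u (p v)"
      have G: "?G \<in> rhom (free_rmod n) regular_rmod"
        using rhomD[OF p] D u by (intro rhomI) auto
      \<comment> \<open>Coordinate functionals of i and images under p of basis vectors form a dual
        basis, so F u is the combination of the former with these coefficients.\<close>
      let ?w = "\<lambda>k. if k < n then F u (p (?e k)) else 0"
      have exp: "F u (p v) = (\<Sum>k<n. F u (p (?e k)) * v k)" if "v \<in> carrier (free_rmod n)" for v
        using free_rmod_expand[OF G] that by simp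
      have "(\<lambda>x\<in>carrier c. \<Sum>k<n. i x k * ?w k) = F u"
      proof (rule extensionalityI[of _ "carrier c"])
        show "F u \<in> extensional (carrier c)" using D(8) u .
        fix x assume x: "x \<in> carrier c"
        have "F u x = F u (p (i x))" using pi x by simp
        also have "\<dots> = (\<Sum>k<n. F u (p (?e k)) * i x k)" using rhomD(2)[OF i x] by (intro exp)
        finally show "(\<lambda>x\<in>carrier c. \<Sum>k<n. i x k * ?w k) x = F u x"
          using x by (simp add: mult.commute)
      qed simp
      then have "\<psi> u = ?L ?w" using JF[OF u] by simp
      also have "\<dots> = (\<Sum>k<n. ?L (?e k) * ?w k)" by (rule free_rmod_expand[OF L]) simp
      also have "\<dots> = (\<Sum>k<n. F u (p (?e k)) * ?v k)" by (intro sum.cong) (auto simp: mult.commute)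
      also have "\<dots> = F u (p ?v)" by (rule exp[symmetric]) simp
      finally show ?thesis ..
    qed
    then have "(\<lambda>w\<in>carrier c'. F w (p ?v)) = \<psi>"
      using rhomD(1)[OF \<psi>] by (intro extensionalityI[of _ "carrier c'"]) simp_all
    then show "\<psi> \<in> (\<lambda>x\<in>carrier c. \<lambda>w\<in>carrier c'. F w x) ` carrier c"
      using px by (intro image_eqI[of _ _ "p ?v"]) simp_all
  qed
qed

definition DP_add :: "'r::comm_ring_1 dpob \<Rightarrow> 'r dpob \<Rightarrow> 'r dpmor \<Rightarrow> 'r dpmor \<Rightarrow> 'r dpmor" where
  "DP_add a b f g = (\<lambda>x\<in>car a. fst f x \<otimes>\<^bsub>fst b\<^esub> fst g x,
     \<lambda>w\<in>dcar b. snd f w \<otimes>\<^bsub>dmod a\<^esub> snd g w)"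

lemma DP_dual_in:
  fixes a :: "'r::comm_ring_1 dpob"
  assumes "a \<in> DP_ob id"
  shows "DP_dual id 1 a \<in> DP_ob id"
proof -
  note D = DP_obD[OF assms]
  have h: "(\<lambda>w\<in>dcar a. pair a w x) \<in> rhom (dmod a) regular_rmod"
    if "x \<in> car a" for x
    using bij_betw_bidual[OF assms] that by (auto simp: bij_betw_def)
  have "(\<lambda>x\<in>car a. \<lambda>w\<in>dcar a. pair a w x) \<in>
      rhom (fst a) (dual_rmod id (dmod a))"
    using h D right_moduleD[OF D(1)]
    by (intro rhomI) (auto simp: fun_eq_iff mult.commute)
  then show ?thesis
    unfolding DP_dual_eq[OF assms] using bij_betw_bidual[OF assms] D(11,12) by (simp add: DP_ob_def)
qed

section \<open>The zero object and the additive structure\<close>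

lemma zero_rmod_simps [simp]:
  "carrier (zero_rmod :: 'r::ring_1 vmod) = {\<lambda>_. 0}" "x \<otimes>\<^bsub>zero_rmod\<^esub> y = (\<lambda>_. 0)"
  "\<one>\<^bsub>zero_rmod\<^esub> = (\<lambda>_. 0)" "ract zero_rmod x r = (\<lambda>_. 0)"
  by (simp_all add: zero_rmod_def)

lemma comm_group_zero_rmod: "comm_group (zero_rmod :: 'r::ring_1 vmod)"
  by (rule comm_groupI) (auto simp: zero_rmod_def)

lemma right_module_zero_rmod: "right_module (zero_rmod :: 'r::ring_1 vmod)"
  by (simp add: right_module_def comm_group_zero_rmod)

lemma fg_projective_zero_rmod: "fg_projective (zero_rmod :: 'r::comm_ring_1 vmod)"
proof -
  let ?f = "\<lambda>x\<in>{\<lambda>_. 0::'r}. (\<lambda>_. 0::'r) :: nat \<Rightarrow> 'r"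
  have "?f \<in> rhom zero_rmod (free_rmod 0)" "?f \<in> rhom (free_rmod 0) zero_rmod"
    by (rule rhomI; force)+
  then show ?thesis
    unfolding fg_projective_def
    by (intro conjI right_module_zero_rmod exI[of _ 0] bexI[of _ ?f]) auto
qed

lemma rhom_to_zero:
  assumes "right_module M"
  shows "r \<in> rhom M zero_rmod \<longleftrightarrow> r = (\<lambda>x\<in>carrier M. (\<lambda>_. 0 :: 'r::ring_1))"
proof
  assume "r \<in> rhom M zero_rmod"
  from rhomD(1,2)[OF this] show "r = (\<lambda>x\<in>carrier M. (\<lambda>_. 0 :: 'r::ring_1))"
    by (intro extensionalityI[of _ "carrier M"]) auto
qed (use right_moduleD[OF assms] in \<open>auto intro!: rhomI\<close>)

lemma rhom_from_zero:
  assumes "right_module M"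
  shows "r \<in> rhom (zero_rmod :: 'r::ring_1 vmod) M \<longleftrightarrow> r = (\<lambda>x\<in>{\<lambda>_. 0}. \<one>\<^bsub>M\<^esub>)"
proof
  assume r: "r \<in> rhom (zero_rmod :: 'r::ring_1 vmod) M"
  from rhomD(1)[OF r] rhom_one[OF comm_group_zero_rmod right_moduleD(1)[OF assms] r]
  show "r = (\<lambda>x\<in>{\<lambda>_. 0}. \<one>\<^bsub>M\<^esub>)"
    by (intro extensionalityI[of _ "{\<lambda>_. 0}"]) auto
next
  have "comm_group M" using right_moduleD(1)[OF assms] .
  then show "r \<in> rhom zero_rmod M" if "r = (\<lambda>x\<in>{\<lambda>_. 0}. \<one>\<^bsub>M\<^esub>)"
    using that ract_one[OF assms] by (auto intro!: rhomI)
qed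

lemma zob_DP: "zob (DP \<alpha> \<epsilon>) =
  (zero_rmod, zero_rmod, \<lambda>w\<in>{\<lambda>_. 0}. \<lambda>z\<in>{\<lambda>_. 0}. 0)"
  by (simp add: DP_def)

lemma right_module_regular: "right_module (regular_rmod :: ('r::comm_ring_1, 'r) rmod)"
proof -
  have "comm_group (regular_rmod :: ('r, 'r) rmod)"
    by (rule comm_groupI) (auto intro: exI[of _ "- x" for x] simp: add_ac)
  then show ?thesis by (simp add: right_module_def algebra_simps)
qed

lemma zob_in_DP: "zob (DP (id :: 'r::comm_ring_1 \<Rightarrow> 'r) \<epsilon>) \<in> DP_ob id"
proof -
  let ?f = "\<lambda>w\<in>{\<lambda>_::nat. 0::'r}. \<lambda>z\<in>{\<lambda>_::nat. 0::'r}. 0 :: 'r"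
  have dual: "rhom (zero_rmod :: 'r vmod) regular_rmod = {\<lambda>z\<in>{\<lambda>_. 0}. 0}"
    using rhom_from_zero[OF right_module_regular] by auto
  have "?f \<in> rhom zero_rmod (dual_rmod id zero_rmod)"
    by (rule rhomI) (auto simp: dual fun_eq_iff)
  moreover have "bij_betw ?f {\<lambda>_. 0} {\<lambda>z\<in>{\<lambda>_. 0}. 0}" by (simp add: bij_betw_def restrict_def)
  ultimately show ?thesis by (simp add: zob_DP DP_ob_def fg_projective_zero_rmod dual)
qed

lemma DP_hom_rhom:
  fixes a b :: "'r::comm_ring_1 dpob"
  assumes "a \<in> DP_ob id" "b \<in> DP_ob id" "f \<in> DP_hom id a b"
  shows "fst f \<in> rhom (fst a) (fst b)" "snd f \<in> rhom (dmod b) (dmod a)"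
    and "w \<in> dcar b \<Longrightarrow> x \<in> car a \<Longrightarrow>
      pair a (snd f w) x = pair b w (fst f x)"
  using DP_hom_iff[OF assms(1,2)] assms(3) by auto

lemma DP_hom_zero_right:
  fixes a :: "'r::comm_ring_1 dpob"
  assumes "a \<in> DP_ob id"
  shows "f \<in> DP_hom id a (zob (DP id \<epsilon>)) \<longleftrightarrow>
    f = (\<lambda>x\<in>car a. (\<lambda>_. 0), \<lambda>w\<in>{\<lambda>_. 0}. \<one>\<^bsub>dmod a\<^esub>)"
proof -
  note D = DP_obD[OF assms]
  have one: "pair a \<one>\<^bsub>dmod a\<^esub> x = 0" if "x \<in> car a" for x
    using D(6)[of "\<one>\<^bsub>dmod a\<^esub>" "\<one>\<^bsub>dmod a\<^esub>" x] that right_moduleD(1)[OF D(2)] by simp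
  show ?thesis
    unfolding DP_hom_iff[OF assms zob_in_DP] unfolding zob_DP fst_conv snd_conv
      rhom_to_zero[OF D(1)] rhom_from_zero[OF D(2)]
    by (auto simp only: prod_eq_iff fst_conv snd_conv) (simp add: one)
qed

lemma DP_hom_zero_left:
  fixes a :: "'r::comm_ring_1 dpob"
  assumes "a \<in> DP_ob id"
  shows "f \<in> DP_hom id (zob (DP id \<epsilon>)) a \<longleftrightarrow>
    f = (\<lambda>x\<in>{\<lambda>_. 0}. \<one>\<^bsub>fst a\<^esub>, \<lambda>w\<in>dcar a. (\<lambda>_. 0))"
proof -
  note D = DP_obD[OF assms]
  have one: "pair a w \<one>\<^bsub>fst a\<^esub> = 0" if "w \<in> dcar a" for w
    using D(4)[of w "\<one>\<^bsub>fst a\<^esub>" "\<one>\<^bsub>fst a\<^esub>"] that right_moduleD(1)[OF D(1)] by simp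
  show ?thesis
    unfolding DP_hom_iff[OF zob_in_DP assms] unfolding zob_DP fst_conv snd_conv
      rhom_to_zero[OF D(2)] rhom_from_zero[OF D(1)]
    by (auto simp only: prod_eq_iff fst_conv snd_conv) (simp add: one)
qed

lemma rhom_funcset: "f \<in> rhom M N \<Longrightarrow> f \<in> carrier M \<rightarrow> carrier N"
  by (auto simp: rhom_def)

text \<open>Transposing a pairing twice returns the same triple, so the duality is an involution on
  the nose. That the transposed pairing is again perfect is reflexivity, used through
  \<open>DP_dual_in\<close>. The remaining axioms split into one statement for each of the two
  adjoint components.\<close>

lemma additive_dual_cat_DP:
  "additive_dual_cat (DP (id :: 'r::comm_ring_1 \<Rightarrow> 'r) 1) DP_add"
proof
  let ?C = "DP (id :: 'r \<Rightarrow> 'r) 1"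
  fix a b c d :: "'r dpob" and f g h :: "'r dpmor"
  assume "a \<in> ob ?C"
  then have a: "a \<in> DP_ob id" by simp
  note Da = DP_obD[OF a] and ma = right_moduleD[OF Da(1)] right_moduleD[OF Da(2)]
  have iso: "(\<lambda>x\<in>car a. x) \<in> rhom (fst a) (fst a)"
    "(\<lambda>x\<in>dcar a. x) \<in> rhom (dmod a) (dmod a)"
    using Da(1,2) by (auto intro: rhom_id)
  have da: "DP_dual id 1 a \<in> DP_ob id" using DP_dual_in a .
  then show "dob ?C a \<in> ob ?C" by simp
  show "dob ?C (dob ?C a) = a"
    unfolding DP_simps DP_dual_eq[OF da] unfolding DP_dual_eq[OF a]
    using Da(8,9) by (intro prod_eqI) (auto simp: fun_eq_iff extensional_def)
  show "dmor ?C a a (idt ?C a) = idt ?C (dob ?C a)"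
    by (simp add: DP_dual_eq[OF a])
  show "idt ?C a \<in> hom ?C a a"
    unfolding DP_simps DP_hom_iff[OF a a] using iso by simp
  show "\<exists>!f. f \<in> hom ?C a (zob ?C)" "\<exists>!f. f \<in> hom ?C (zob ?C) a"
    unfolding DP_simps DP_hom_zero_right[OF a] DP_hom_zero_left[OF a] by simp_all
  assume "b \<in> ob ?C"
  then have b: "b \<in> DP_ob id" by simp
  note Db = DP_obD[OF b] and mb = right_moduleD[OF Db(1)] right_moduleD[OF Db(2)]
  have db: "DP_dual id 1 b \<in> DP_ob id" using DP_dual_in b .
  {
    assume "f \<in> hom ?C a b"
    then have f: "f \<in> DP_hom id a b" by simp
    note F = DP_hom_rhom[OF a b f]
    note ef = rhomD(1)[OF F(1)] rhomD(1)[OF F(2)] rhom_funcset[OF F(1)] rhom_funcset[OF F(2)]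
    show "dmor ?C a b f \<in> hom ?C (dob ?C b) (dob ?C a)"
      unfolding DP_simps DP_hom_iff[OF db da] using F rhomD(2)[OF F(1)] rhomD(2)[OF F(2)]
      by (simp add: DP_dual_eq[OF a] DP_dual_eq[OF b])
    show "dmor ?C (dob ?C b) (dob ?C a) (dmor ?C a b f) = f" by simp
    show "cmp ?C a a b f (idt ?C a) = f" "cmp ?C a b b (idt ?C b) f = f"
      using ef by (intro prod_eqI; simp add: compose_Id Id_compose)+
    show "DP_add a b f (cmp ?C a (zob ?C) b h g) = f"
      if "g \<in> hom ?C a (zob ?C)" "h \<in> hom ?C (zob ?C) b"
      using that ef ma mb unfolding DP_simps DP_hom_zero_right[OF a] DP_hom_zero_left[OF b]
      by (intro prod_eqI) (auto simp: DP_add_def compose_eq Pi_iff extensional_def fun_eq_iff)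
    assume "g \<in> hom ?C a b"
    then have g: "g \<in> DP_hom id a b" by simp
    note G = DP_hom_rhom[OF a b g]
    show "DP_add a b f g \<in> hom ?C a b"
      unfolding DP_simps DP_hom_iff[OF a b]
      using rhom_add[OF Da(1) Db(1) F(1) G(1)] rhom_add[OF Db(2) Da(2) F(2) G(2)]
        rhomD(2)[OF F(1)] rhomD(2)[OF F(2)] rhomD(2)[OF G(1)] rhomD(2)[OF G(2)] Da(6) Db(4) F(3) G(3)
      by (simp add: DP_add_def)
    show "DP_add a b f g = DP_add a b g f"
      using rhomD(2)[OF F(1)] rhomD(2)[OF F(2)] rhomD(2)[OF G(1)] rhomD(2)[OF G(2)]
        comm_monoid.m_comm[OF comm_group.axioms(1), OF ma(4)] comm_monoid.m_comm[OF comm_group.axioms(1), OF mb(1)]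
      by (auto simp: DP_add_def intro!: restrict_ext)
  }
  assume "c \<in> ob ?C"
  then have c: "c \<in> DP_ob id" by simp
  note Dc = DP_obD[OF c]
  {
    assume "f \<in> hom ?C a b" "g \<in> hom ?C b c"
    then have f: "f \<in> DP_hom id a b" and g: "g \<in> DP_hom id b c" by simp_all
    note F = DP_hom_rhom[OF a b f] and G = DP_hom_rhom[OF b c g]
    show "dmor ?C a c (cmp ?C a b c g f) = cmp ?C (dob ?C c) (dob ?C b) (dob ?C a) (dmor ?C a b f) (dmor ?C b c g)"
      by (simp add: DP_dual_eq[OF a] DP_dual_eq[OF c])
    show "cmp ?C a b c g f \<in> hom ?C a c"
      unfolding DP_simps DP_hom_iff[OF a c]
      using rhom_compose[OF Da(1) F(1) G(1)] rhom_compose[OF Dc(2) G(2) F(2)]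
        rhomD(2)[OF F(1)] rhomD(2)[OF F(2)] rhomD(2)[OF G(1)] rhomD(2)[OF G(2)] F(3) G(3)
      by (simp add: compose_eq)
    show "cmp ?C a b c (DP_add b c g h) f = DP_add a c (cmp ?C a b c g f) (cmp ?C a b c h f)"
      if "h \<in> hom ?C b c"
      using DP_hom_rhom[OF b c that[unfolded DP_simps]] rhomD[OF F(1)] rhomD[OF F(2)] rhomD[OF G(2)]
      by (auto simp: DP_add_def compose_def rhomD intro!: restrict_ext)
    assume "d \<in> ob ?C" "h \<in> hom ?C c d"
    then have H: "snd h \<in> rhom (dmod d) (dmod c)" using DP_hom_rhom(2)[OF c] by simp
    show "cmp ?C a b d (cmp ?C b c d h g) f = cmp ?C a c d h (cmp ?C a b c g f)"
      using rhomD(2)[OF F(1)] rhomD(2)[OF H]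
      by (auto simp: compose_def intro!: restrict_ext)
  }
  show "cmp ?C a b c h (DP_add a b f g) = DP_add a c (cmp ?C a b c h f) (cmp ?C a b c h g)"
    if "f \<in> hom ?C a b" "g \<in> hom ?C a b" "h \<in> hom ?C b c"
    using DP_hom_rhom[OF a b that(1)[unfolded DP_simps]] DP_hom_rhom[OF a b that(2)[unfolded DP_simps]]
      DP_hom_rhom[OF b c that(3)[unfolded DP_simps]]
    by (auto simp: DP_add_def compose_def rhomD intro!: restrict_ext)
next
  let ?C = "DP (id :: 'r \<Rightarrow> 'r) 1"
  show "zob ?C \<in> ob ?C" using zob_in_DP by simp
  show "dob ?C (zob ?C) = zob ?C"
    unfolding DP_simps DP_dual_eq[OF zob_in_DP] by (auto simp: zob_DP fun_eq_iff)
qed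

section \<open>Sampled diagrams are invariants of points of the realization\<close>

text \<open>Closed, so that \<open>band 0\<close> is the single point 1/2, and symmetric under y
  \<mapsto> 1 - y.\<close>

definition band :: "real \<Rightarrow> real set" where
  "band \<epsilon> = {1/2 - \<epsilon>..1/2 + \<epsilon>}"

text \<open>The Boolean selects the initial (\<open>lo\<close>) or the terminal (\<open>hi\<close>) end of the chain.\<close>

definition ix :: "bool \<Rightarrow> nat \<Rightarrow> (nat \<Rightarrow> real) \<Rightarrow> real \<Rightarrow> nat" where
  "ix b n t \<delta> = (if b then hi n t \<delta> else lo t \<delta>)"

text \<open>With position \<delta> for the initial end and 1 - \<delta> for the terminal end, this
  says that the first position is at most the second, given thresholds below 1/2.\<close>

definition prec :: "bool \<Rightarrow> real \<Rightarrow> bool \<Rightarrow> real \<Rightarrow> bool" where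
  "prec b \<delta> b' \<delta>' \<longleftrightarrow> (\<not> b \<and> b') \<or> (\<not> b \<and> \<not> b' \<and> \<delta> \<le> \<delta>') \<or> (b \<and> b' \<and> \<delta>' \<le> \<delta>)"

lemma ix_le: "t \<in> standard_simplex n \<Longrightarrow> \<delta> < 1/2 \<Longrightarrow> ix b n t \<delta> \<le> n"
  using lo_le(1)[of t n \<delta>] hi_le[of n t \<delta>] by (simp add: ix_def)

lemma ix_mono:
  assumes "t \<in> standard_simplex n" "\<delta> < 1/2" "\<delta>' < 1/2" "prec b \<delta> b' \<delta>'"
  shows "ix b n t \<delta> \<le> ix b' n t \<delta>'"
proof -
  \<comment> \<open>From the initial to the terminal end the two thresholds may differ; the
    comparison passes through the larger one, where \<open>lo_le_hi\<close> applies.\<close>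
  let ?\<mu> = "max \<delta> \<delta>'"
  have "lo t \<delta> \<le> lo t ?\<mu>" "hi n t ?\<mu> \<le> hi n t \<delta>'"
    using assms by (intro lo_mono hi_mono; simp)+
  moreover have "lo t ?\<mu> \<le> hi n t ?\<mu>" using assms by (intro lo_le_hi) simp_all
  ultimately show ?thesis
    using assms lo_mono[of t n \<delta> \<delta>'] hi_mono[of t n \<delta>' \<delta>] by (auto simp: ix_def prec_def)
qed

lemma ix_push:
  assumes "\<psi> \<in> sop l n" "t \<in> standard_simplex l" "0 \<le> \<delta>" "\<delta> < 1/2"
  shows "ix b n (simplex_push l \<psi> t) \<delta> = \<psi> (ix b l t \<delta>)"
  using lo_push[OF assms(1-3)] hi_push[OF assms(1-3)] assms(4) by (simp add: ix_def)

lemma ix_rev: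
  assumes "t \<in> standard_simplex n" "\<delta> < 1/2"
  shows "n - ix b n (simplex_rev n t) \<delta> = ix (\<not> b) n t \<delta>"
  using lo_rev[OF assms(1), of \<delta>] hi_rev[OF assms(1), of \<delta>] assms(2) lo_le(1)[OF assms(1), of \<delta>]
    hi_le[of n t \<delta>]
  by (simp add: ix_def)

type_synonym 'r sd_point = "'r sd_simplex bpt"

text \<open>The three sampling functions read off, from a representative, the total label over E at
  one end of the chain, the structure maps of the diagram there, and the transition along the chain
  between two ends.\<close>

definition samp_ob :: "'r sd_point \<Rightarrow> bool \<Rightarrow> real \<Rightarrow> real set \<Rightarrow> 'r dpob" where
  "samp_ob = (\<lambda>((m, n, x), s, t) b \<delta> E. fst (fst x (ix b n t \<delta>)) (mid m s E))"

definition samp_mor :: "'r sd_point \<Rightarrow> bool \<Rightarrow> real \<Rightarrow> real set \<Rightarrow> real set \<Rightarrow> real set \<Rightarrow> 'r dpmor" where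
  "samp_mor = (\<lambda>((m, n, x), s, t) b \<delta> E E' E''.
     snd (fst x (ix b n t \<delta>)) (mid m s E, mid m s E', mid m s E''))"

definition samp_tr :: "'r sd_point \<Rightarrow> bool \<Rightarrow> real \<Rightarrow> bool \<Rightarrow> real \<Rightarrow> real set \<Rightarrow> 'r dpmor" where
  "samp_tr = (\<lambda>((m, n, x), s, t) b \<delta> b' \<delta>' E. snd x (ix b n t \<delta>, ix b' n t \<delta>') (mid m s E))"

lemma mid_QMor: "E'' \<subseteq> E \<Longrightarrow> E'' \<subseteq> E' \<Longrightarrow> (mid m s E, mid m s E', mid m s E'') \<in> QMor (circ m)"
  using mid_in_QOb by (auto simp: QMor_iff mid_def QOb_def)

text \<open>A circle operator acts on diagrams by taking preimages of pointed subsets, and a nerve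
  operator reindexes the chain. By \<open>pinv_mid\<close> and \<open>ix_push\<close> the
  push-forward of coordinates changes the sampled subset and the sampled index in exactly the same
  way.\<close>

lemma samp_glue:
  assumes "(p, q) \<in> bs_glue (NiA \<alpha> \<epsilon>)" and \<delta>: "0 \<le> \<delta>" "\<delta> < 1/2" and E: "E \<subseteq> {0<..<1}"
  shows "samp_ob p b \<delta> E = samp_ob q b \<delta> E"
    and "E' \<subseteq> {0<..<1} \<Longrightarrow> E'' \<subseteq> E \<Longrightarrow> E'' \<subseteq> E' \<Longrightarrow> samp_mor p b \<delta> E E' E'' = samp_mor q b \<delta> E E' E''"
    and "0 \<le> \<delta>' \<Longrightarrow> \<delta>' < 1/2 \<Longrightarrow> prec b \<delta> b' \<delta>' \<Longrightarrow>
      samp_tr p b \<delta> b' \<delta>' E = samp_tr q b \<delta> b' \<delta>' E"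
proof -
  from assms(1) obtain m n k l \<theta> \<psi> x s t
    where p: "p = ((k, l, bs_op (NiA \<alpha> \<epsilon>) m n k l \<theta> \<psi> x), s, t)"
      and q: "q = ((m, n, x), simplex_push k \<theta> s, simplex_push l \<psi> t)"
      and op: "\<theta> \<in> sop k m" "\<psi> \<in> sop l n"
      and st: "s \<in> standard_simplex k" "t \<in> standard_simplex l"
    by (rule bs_glueE)
  note simps = p q NiA_def nerve_map_def nerve_op_def ix_push[OF op(2) st(2) \<delta>]
  note P = pinv_mid[OF op(1) st(1)] and le = ix_le[OF st(2) \<delta>(2), of b]
  show "samp_ob p b \<delta> E = samp_ob q b \<delta> E"
    using le by (simp add: simps samp_ob_def diag_push_def mid_in_QOb P[OF E])
  show "samp_mor p b \<delta> E E' E'' = samp_mor q b \<delta> E E' E''"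
    if "E' \<subseteq> {0<..<1}" and sub: "E'' \<subseteq> E" "E'' \<subseteq> E'"
    using le mid_QMor[OF sub, of k s]
    by (simp add: simps samp_mor_def diag_push_def P[OF E] P[OF that(1)] P[OF subset_trans[OF sub(1) E]])
  show "samp_tr p b \<delta> b' \<delta>' E = samp_tr q b \<delta> b' \<delta>' E"
    if \<delta>': "0 \<le> \<delta>'" "\<delta>' < 1/2" and "prec b \<delta> b' \<delta>'"
  proof -
    have "(ix b l t \<delta>, ix b' l t \<delta>') \<in> le_pairs l"
      using ix_mono[OF st(2) \<delta>(2) \<delta>'(2) that(3)] ix_le[OF st(2) \<delta>'(2)] by (simp add: le_pairs_def)
    then show ?thesis
      by (simp add: simps samp_tr_def diag_push_mor_def mid_in_QOb P[OF E] ix_push[OF op(2) st(2) \<delta>'])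
  qed
qed

lemma samp_eqv:
  assumes "(p, q) \<in> bs_eqv (NiA \<alpha> \<epsilon>)" "0 \<le> \<delta>" "\<delta> < 1/2" "E \<subseteq> {0<..<1}"
  shows "samp_ob p b \<delta> E = samp_ob q b \<delta> E"
    and "E' \<subseteq> {0<..<1} \<Longrightarrow> E'' \<subseteq> E \<Longrightarrow> E'' \<subseteq> E' \<Longrightarrow> samp_mor p b \<delta> E E' E'' = samp_mor q b \<delta> E E' E''"
    and "0 \<le> \<delta>' \<Longrightarrow> \<delta>' < 1/2 \<Longrightarrow> prec b \<delta> b' \<delta>' \<Longrightarrow>
      samp_tr p b \<delta> b' \<delta>' E = samp_tr q b \<delta> b' \<delta>' E"
proof -
  show "samp_ob p b \<delta> E = samp_ob q b \<delta> E"
    by (rule bs_eqv_invariant[OF assms(1) samp_glue(1)[OF _ assms(2-4)]])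
  show "samp_mor p b \<delta> E E' E'' = samp_mor q b \<delta> E E' E''"
    if "E' \<subseteq> {0<..<1}" "E'' \<subseteq> E" "E'' \<subseteq> E'"
    by (rule bs_eqv_invariant[OF assms(1) samp_glue(2)[OF _ assms(2-4) that]])
  show "samp_tr p b \<delta> b' \<delta>' E = samp_tr q b \<delta> b' \<delta>' E"
    if "0 \<le> \<delta>'" "\<delta>' < 1/2" "prec b \<delta> b' \<delta>'"
    by (rule bs_eqv_invariant[OF assms(1) samp_glue(3)[OF _ assms(2-4) that]])
qed

lemma diag_cat_dmor:
  "U \<in> QOb X \<Longrightarrow> dmor (diag_cat C X \<sigma>) A B \<phi> U = dmor C (fst A (\<sigma> ` U)) (fst B (\<sigma> ` U)) (\<phi> (\<sigma> ` U))"
  by (simp add: diag_cat_def)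

text \<open>The involution exchanges the ends of the chain, reflects the circle, and swaps the two
  components of each morphism. Combined with \<open>samp_eqv\<close> at a fixed point, this becomes
  self-duality of the samples.\<close>

lemma samp_rev:
  fixes p :: "'r::ring_1 sd_point"
  assumes "p \<in> topspace (bs_total (NiA \<alpha> \<epsilon>))" "\<delta> < 1/2"
  shows "samp_ob (pt_rev (NiA \<alpha> \<epsilon>) p) b \<delta> E = DP_dual \<alpha> \<epsilon> (samp_ob p (\<not> b) \<delta> ((-) 1 ` E))"
    and "E'' \<subseteq> E \<Longrightarrow> E'' \<subseteq> E' \<Longrightarrow> samp_mor (pt_rev (NiA \<alpha> \<epsilon>) p) b \<delta> E E' E'' =
      prod.swap (samp_mor p (\<not> b) \<delta> ((-) 1 ` E') ((-) 1 ` E) ((-) 1 ` E''))"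
    and "\<delta>' < 1/2 \<Longrightarrow> prec b \<delta> b' \<delta>' \<Longrightarrow> samp_tr (pt_rev (NiA \<alpha> \<epsilon>) p) b \<delta> b' \<delta>' E =
      prod.swap (samp_tr p (\<not> b') \<delta>' (\<not> b) \<delta> ((-) 1 ` E))"
proof -
  obtain m n x s t where p: "p = ((m, n, x), s, t)" by (metis surj_pair)
  have st: "s \<in> standard_simplex m" "t \<in> standard_simplex n"
    using assms(1) by (simp_all add: p topspace_bs_total)
  have r: "simplex_rev n t \<in> standard_simplex n" by (rule simplex_rev_in[OF st(2)])
  have D: "dob (diag_cat C (circ m) (circ_inv m)) = diag_dual C (circ m) (circ_inv m)" for C :: "('r dpob, 'r dpmor) dcat"
    by (simp add: diag_cat_def)
  show "samp_ob (pt_rev (NiA \<alpha> \<epsilon>) p) b \<delta> E = DP_dual \<alpha> \<epsilon> (samp_ob p (\<not> b) \<delta> ((-) 1 ` E))"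
    using ix_le[OF r assms(2), of b]
    by (simp add: p pt_rev_def samp_ob_def NiA_def nerve_inv_def D diag_dual_simps mid_in_QOb
        circ_inv_image_mid[OF st(1)] ix_rev[OF st(2) assms(2)])
  show "samp_mor (pt_rev (NiA \<alpha> \<epsilon>) p) b \<delta> E E' E'' =
      prod.swap (samp_mor p (\<not> b) \<delta> ((-) 1 ` E') ((-) 1 ` E) ((-) 1 ` E''))"
    if "E'' \<subseteq> E" "E'' \<subseteq> E'"
    using ix_le[OF r assms(2), of b] mid_QMor[OF that]
    by (simp add: p pt_rev_def samp_mor_def NiA_def nerve_inv_def D diag_dual_simps
        circ_inv_image_mid[OF st(1)] ix_rev[OF st(2) assms(2)] prod.swap_def)
  show "samp_tr (pt_rev (NiA \<alpha> \<epsilon>) p) b \<delta> b' \<delta>' E = prod.swap (samp_tr p (\<not> b') \<delta>' (\<not> b) \<delta> ((-) 1 ` E))"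
    if d: "\<delta>' < 1/2" and pr: "prec b \<delta> b' \<delta>'"
  proof -
    have "(ix b n (simplex_rev n t) \<delta>, ix b' n (simplex_rev n t) \<delta>') \<in> le_pairs n"
      using ix_mono[OF r assms(2) d pr] ix_le[OF r d] by (simp add: le_pairs_def)
    then show ?thesis
      by (simp add: p pt_rev_def samp_tr_def NiA_def nerve_inv_def diag_cat_dmor mid_in_QOb
          circ_inv_image_mid[OF st(1)] ix_rev[OF st(2) assms(2)] ix_rev[OF st(2) d] prod.swap_def)
  qed
qed

section \<open>The parity of the middle form\<close>

abbreviation NiZ :: "int sd_simplex bisset" where
  "NiZ \<equiv> NiA id 1"

text \<open>For \<phi> from a to its dual, the first component of \<phi> maps the underlying module
  of a to its dual module, so the number tested is the value at z of the associated quadratic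
  form.\<close>

definition odd_form :: "int dpob \<Rightarrow> int dpmor \<Rightarrow> bool" where
  "odd_form a \<phi> \<longleftrightarrow> (\<exists>z \<in> car a. odd (pair a (fst \<phi> z) z))"

text \<open>The transition from the initial to the terminal end serves as the form: at a fixed point
  the terminal sample over a symmetric band is the dual of the initial one.\<close>

definition odd_at :: "int sd_point \<Rightarrow> real \<Rightarrow> real \<Rightarrow> bool" where
  "odd_at p \<epsilon> \<delta> \<longleftrightarrow> odd_form (samp_ob p False \<delta> (band \<epsilon>)) (samp_tr p False \<delta> True \<delta> (band \<epsilon>))"

text \<open>By adjointness \<phi>' is the pullback of the form \<phi> along \<alpha>, and
  surjectivity of \<alpha> gives both forms the same values.\<close>

lemma odd_form_transport:
  fixes a b :: "int dpob"
  assumes ob: "a \<in> DP_ob id" "b \<in> DP_ob id"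
    and \<alpha>: "\<alpha> \<in> DP_hom id a b" and \<phi>: "\<phi> \<in> DP_hom id b (DP_dual id 1 b)"
    and eq: "\<And>z. z \<in> car a \<Longrightarrow> fst \<phi>' z = snd \<alpha> (fst \<phi> (fst \<alpha> z))"
    and surj: "\<And>y. y \<in> car b \<Longrightarrow> \<exists>z \<in> car a. fst \<alpha> z = y"
  shows "odd_form a \<phi>' \<longleftrightarrow> odd_form b \<phi>"
proof -
  note A = DP_hom_rhom[OF ob \<alpha>] and P = DP_hom_rhom[OF ob(2) DP_dual_in[OF ob(2)] \<phi>]
  have "pair a (fst \<phi>' z) z = pair b (fst \<phi> (fst \<alpha> z)) (fst \<alpha> z)"
    if z: "z \<in> car a" for z
  proof -
    have "fst \<phi> (fst \<alpha> z) \<in> dcar b"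
      using rhomD(2)[OF P(1) rhomD(2)[OF A(1) z]] by (simp add: DP_dual_eq[OF ob(2)])
    then show ?thesis using A(3) z eq[OF z] by simp
  qed
  then show ?thesis
    unfolding odd_form_def using rhomD(2)[OF A(1)] surj by (metis (no_types, lifting))
qed

text \<open>The summands over the two halves of the band are dual to each other, so that they
  contribute a hyperbolic, hence even, form.\<close>

lemma form_parity_split:
  fixes a :: "int dpob"
  assumes a: "a \<in> DP_ob id" and \<phi>: "\<phi> \<in> DP_hom id a (DP_dual id 1 a)" "snd \<phi> = fst \<phi>"
    and e: "e0 \<in> DP_hom id a a" "eL \<in> DP_hom id a a" "eR \<in> DP_hom id a a"
    and nat: "\<And>z. z \<in> car a \<Longrightarrow> fst \<phi> (fst e0 z) = snd e0 (fst \<phi> z)"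
      "\<And>z. z \<in> car a \<Longrightarrow> fst \<phi> (fst eL z) = snd eR (fst \<phi> z)"
      "\<And>z. z \<in> car a \<Longrightarrow> fst \<phi> (fst eR z) = snd eL (fst \<phi> z)"
    and dec: "\<And>z. z \<in> car a \<Longrightarrow> fst e0 z \<otimes>\<^bsub>fst a\<^esub> (fst eL z \<otimes>\<^bsub>fst a\<^esub> fst eR z) = z"
    and disj: "\<And>z. z \<in> car a \<Longrightarrow> fst e0 (fst eL z) = \<one>\<^bsub>fst a\<^esub>"
      "\<And>z. z \<in> car a \<Longrightarrow> fst e0 (fst eR z) = \<one>\<^bsub>fst a\<^esub>"
      "\<And>z. z \<in> car a \<Longrightarrow> fst eR (fst eL z) = \<one>\<^bsub>fst a\<^esub>"
      "\<And>z. z \<in> car a \<Longrightarrow> fst eL (fst eR z) = \<one>\<^bsub>fst a\<^esub>"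
    and z: "z \<in> car a"
  shows "odd (pair a (fst \<phi> z) z) \<longleftrightarrow> odd (pair a (fst \<phi> (fst e0 z)) (fst e0 z))"
proof -
  note D = DP_obD[OF a] and m = right_moduleD[OF DP_obD(1)[OF a]]
  note P = DP_hom_rhom[OF a DP_dual_in[OF a] \<phi>(1)]
  note E0 = DP_hom_rhom[OF a a e(1)] and EL = DP_hom_rhom[OF a a e(2)] and ER = DP_hom_rhom[OF a a e(3)]
  let ?h = "\<lambda>y z. pair a (fst \<phi> y) z"
  have \<phi>in: "fst \<phi> y \<in> dcar a" if "y \<in> car a" for y
    using rhomD(2)[OF P(1) that] by (simp add: DP_dual_eq[OF a])
  have \<phi>add: "fst \<phi> (y \<otimes>\<^bsub>fst a\<^esub> y') = fst \<phi> y \<otimes>\<^bsub>dmod a\<^esub> fst \<phi> y'"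
    if "y \<in> car a" "y' \<in> car a" for y y'
    using rhomD(3)[OF P(1) that] by (simp add: DP_dual_eq[OF a])
  have sym: "?h y y' = ?h y' y" if "y \<in> car a" "y' \<in> car a" for y y'
    using P(3)[of y y'] that \<phi>in by (simp add: DP_dual_eq[OF a] \<phi>(2))
  have addr: "?h y (u \<otimes>\<^bsub>fst a\<^esub> v) = ?h y u + ?h y v"
    if "y \<in> car a" "u \<in> car a" "v \<in> car a" for y u v
    using D(4) \<phi>in that by simp
  have addl: "?h (u \<otimes>\<^bsub>fst a\<^esub> v) y = ?h u y + ?h v y"
    if "y \<in> car a" "u \<in> car a" "v \<in> car a" for y u v
    using D(6) \<phi>in \<phi>add that by simp
  have zero: "?h y \<one>\<^bsub>fst a\<^esub> = 0" if "y \<in> car a" for y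
    using addr[of y "\<one>\<^bsub>fst a\<^esub>" "\<one>\<^bsub>fst a\<^esub>"] that m(1) by simp
  let ?x = "fst e0 z" and ?l = "fst eL z" and ?r = "fst eR z"
  have in_c: "?x \<in> car a" "?l \<in> car a" "?r \<in> car a"
    by (rule rhomD(2)[OF E0(1) z] rhomD(2)[OF EL(1) z] rhomD(2)[OF ER(1) z])+
  \<comment> \<open>The projector onto the middle is self-adjoint, while those onto the left and
    right halves are adjoint to each other. Hence each half is isotropic: pairing l with itself
    moves the right projector onto l, where it vanishes.\<close>
  have adj: "?h (fst e0 z) y = ?h z (fst e0 y)" "?h (fst eL z) y = ?h z (fst eR y)"
    "?h (fst eR z) y = ?h z (fst eL y)" if "y \<in> car a" for y
    using that nat[OF z] E0(3) EL(3) ER(3) \<phi>in[OF z] by simp_all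
  have "?h ?x ?l = 0" "?h ?x ?r = 0" "?h ?l ?l = 0" "?h ?r ?r = 0"
    using adj in_c disj[OF z] zero[OF z] by simp_all
  moreover have "?h ?l ?x = ?h ?x ?l" "?h ?r ?x = ?h ?x ?r" "?h ?r ?l = ?h ?l ?r"
    by (rule sym; rule in_c)+
  ultimately have v: "?h ?x ?l = 0" "?h ?x ?r = 0" "?h ?l ?l = 0" "?h ?r ?r = 0"
    "?h ?l ?x = 0" "?h ?r ?x = 0" "?h ?r ?l = ?h ?l ?r" by metis+
  have "?h z z = ?h (?x \<otimes>\<^bsub>fst a\<^esub> (?l \<otimes>\<^bsub>fst a\<^esub> ?r)) (?x \<otimes>\<^bsub>fst a\<^esub> (?l \<otimes>\<^bsub>fst a\<^esub> ?r))"
    using dec[OF z] by simp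
  \<comment> \<open>By symmetry the two surviving cross terms coincide, which is where evenness
    comes from.\<close>
  also have "\<dots> = ?h ?x ?x + 2 * ?h ?l ?r"
    using in_c m(1) by (simp add: addl addr v)
  finally show ?thesis by simp
qed

lemma band_subset: "\<epsilon> < 1/2 \<Longrightarrow> band \<epsilon> \<subseteq> {0<..<1}"
  by (auto simp: band_def)

lemma flip_band: "(-) 1 ` band \<epsilon> = band \<epsilon>"
  by (simp add: band_def)

lemma flip_iff: "y \<in> (-) 1 ` A \<longleftrightarrow> 1 - y \<in> A" for y :: real
proof
  show "y \<in> (-) 1 ` A" if "1 - y \<in> A" using that by (intro image_eqI[of _ _ "1 - y"]) simp_all
qed auto

text \<open>From the inverses in the isomorphism category the third statement extracts an objectwise
  right inverse, the form in which surjectivity of transitions is used.\<close>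

lemma nerve_SD_D:
  assumes "x \<in> nerve (SD \<alpha> \<epsilon> m) n"
  shows "i \<le> n \<Longrightarrow> fst x i \<in> sum_diagrams (DP \<alpha> \<epsilon>) (circ m)"
    and "i \<le> j \<Longrightarrow> j \<le> n \<Longrightarrow> snd x (i, j) \<in> diag_hom (DP \<alpha> \<epsilon>) (circ m) (fst x i) (fst x j)"
    and "i \<le> j \<Longrightarrow> j \<le> n \<Longrightarrow> \<exists>\<psi> \<in> diag_hom (DP \<alpha> \<epsilon>) (circ m) (fst x j) (fst x i).
      \<forall>U \<in> QOb (circ m). cmp (DP \<alpha> \<epsilon>) (fst (fst x j) U) (fst (fst x i) U) (fst (fst x j) U)
        (snd x (i, j) U) (\<psi> U) = idt (DP \<alpha> \<epsilon>) (fst (fst x j) U)"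
    and "i \<le> j \<Longrightarrow> j \<le> k \<Longrightarrow> k \<le> n \<Longrightarrow> U \<in> QOb (circ m) \<Longrightarrow>
      cmp (DP \<alpha> \<epsilon>) (fst (fst x i) U) (fst (fst x j) U) (fst (fst x k) U)
        (snd x (j, k) U) (snd x (i, j) U) = snd x (i, k) U"
proof -
  note N = nerveD[OF assms]
  have S: "ob (diag_cat C X \<sigma>) = sum_diagrams C X" "hom (diag_cat C X \<sigma>) = diag_hom C X"
    "idt (diag_cat C X \<sigma>) A = (\<lambda>U\<in>QOb X. idt C (fst A U))"
    "cmp (diag_cat C X \<sigma>) A B D \<psi> \<phi> = (\<lambda>U\<in>QOb X. cmp C (fst A U) (fst B U) (fst D U) (\<psi> U) (\<phi> U))"
    for C :: "('o, 'm) dcat" and X :: "'x option set" and \<sigma> A B D \<psi> \<phi>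
    by (simp_all add: diag_cat_def)
  show "fst x i \<in> sum_diagrams (DP \<alpha> \<epsilon>) (circ m)" if "i \<le> n"
    using N(1)[OF that] by (simp add: S)
  show "snd x (i, j) \<in> diag_hom (DP \<alpha> \<epsilon>) (circ m) (fst x i) (fst x j)" if "i \<le> j" "j \<le> n"
    using N(2)[OF that] by (simp add: iso_cat_hom S)
  show "cmp (DP \<alpha> \<epsilon>) (fst (fst x i) U) (fst (fst x j) U) (fst (fst x k) U)
      (snd x (j, k) U) (snd x (i, j) U) = snd x (i, k) U"
    if "i \<le> j" "j \<le> k" "k \<le> n" "U \<in> QOb (circ m)"
    using fun_cong[OF N(4)[OF that(1-3)], of U] that(4) by (simp add: S del: DP_simps)
  show "\<exists>\<psi> \<in> diag_hom (DP \<alpha> \<epsilon>) (circ m) (fst x j) (fst x i).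
      \<forall>U \<in> QOb (circ m). cmp (DP \<alpha> \<epsilon>) (fst (fst x j) U) (fst (fst x i) U) (fst (fst x j) U)
        (snd x (i, j) U) (\<psi> U) = idt (DP \<alpha> \<epsilon>) (fst (fst x j) U)"
    if "i \<le> j" "j \<le> n"
  proof -
    from N(2)[OF that] obtain \<psi> where "\<psi> \<in> diag_hom (DP \<alpha> \<epsilon>) (circ m) (fst x j) (fst x i)"
      and eq: "cmp (SD \<alpha> \<epsilon> m) (fst x j) (fst x i) (fst x j) (snd x (i, j)) \<psi> = idt (SD \<alpha> \<epsilon> m) (fst x j)"
      by (auto simp: iso_cat_hom S simp del: DP_simps)
    moreover have "cmp (DP \<alpha> \<epsilon>) (fst (fst x j) U) (fst (fst x i) U) (fst (fst x j) U)
        (snd x (i, j) U) (\<psi> U) = idt (DP \<alpha> \<epsilon>) (fst (fst x j) U)" if "U \<in> QOb (circ m)" for U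
      using fun_cong[OF eq, of U] that by (simp add: S del: DP_simps)
    ultimately show ?thesis by blast
  qed
qed

section \<open>Self-duality of the samples and the parity at a fixed point\<close>

context
  fixes m n :: nat and x :: "int sd_simplex" and s t :: "nat \<Rightarrow> real" and p :: "int sd_point"
  assumes p: "p = ((m, n, x), s, t)"
    and p_in: "p \<in> topspace (bs_total NiZ)"
    and p_fix: "(p, pt_rev NiZ p) \<in> bs_eqv NiZ"
begin

private lemma x_in: "x \<in> nerve (SD id 1 m) n" and s_in: "s \<in> standard_simplex m"
  and t_in: "t \<in> standard_simplex n"
  using p_in by (simp_all add: p topspace_bs_total, simp add: NiA_def)

private lemmas xD = nerve_SD_D[OF x_in]

private lemma fixed_ob:
  "0 \<le> \<delta> \<Longrightarrow> \<delta> < 1/2 \<Longrightarrow> E \<subseteq> {0<..<1} \<Longrightarrow>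
    samp_ob p b \<delta> E = DP_dual id 1 (samp_ob p (\<not> b) \<delta> ((-) 1 ` E))"
  using samp_eqv(1)[OF p_fix] samp_rev(1)[OF p_in] by simp

private lemma fixed_mor:
  "0 \<le> \<delta> \<Longrightarrow> \<delta> < 1/2 \<Longrightarrow> E \<subseteq> {0<..<1} \<Longrightarrow> E' \<subseteq> {0<..<1} \<Longrightarrow> E'' \<subseteq> E \<Longrightarrow> E'' \<subseteq> E' \<Longrightarrow>
    samp_mor p b \<delta> E E' E'' = prod.swap (samp_mor p (\<not> b) \<delta> ((-) 1 ` E') ((-) 1 ` E) ((-) 1 ` E''))"
  using samp_eqv(2)[OF p_fix] samp_rev(2)[OF p_in] by simp

private lemma fixed_tr:
  "0 \<le> \<delta> \<Longrightarrow> \<delta> < 1/2 \<Longrightarrow> 0 \<le> \<delta>' \<Longrightarrow> \<delta>' < 1/2 \<Longrightarrow> E \<subseteq> {0<..<1} \<Longrightarrow> prec b \<delta> b' \<delta>' \<Longrightarrow>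
    samp_tr p b \<delta> b' \<delta>' E = prod.swap (samp_tr p (\<not> b') \<delta>' (\<not> b) \<delta> ((-) 1 ` E))"
  using samp_eqv(3)[OF p_fix] samp_rev(3)[OF p_in] by simp

lemma samp_ob_in: "\<delta> < 1/2 \<Longrightarrow> samp_ob p b \<delta> E \<in> DP_ob id"
  using sum_diagramsD(1)[OF xD(1) mid_in_QOb] ix_le[OF t_in] by (simp add: p samp_ob_def)

private lemma samp_mor_in:
  "\<delta> < 1/2 \<Longrightarrow> E'' \<subseteq> E \<Longrightarrow> E'' \<subseteq> E' \<Longrightarrow>
    samp_mor p b \<delta> E E' E'' \<in> DP_hom id (samp_ob p b \<delta> E) (samp_ob p b \<delta> E')"
  using sum_diagramsD(2)[OF xD(1) mid_QMor] ix_le[OF t_in] by (simp add: p samp_ob_def samp_mor_def)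

private lemma samp_tr_in:
  "\<delta> < 1/2 \<Longrightarrow> \<delta>' < 1/2 \<Longrightarrow> prec b \<delta> b' \<delta>' \<Longrightarrow>
    samp_tr p b \<delta> b' \<delta>' E \<in> DP_hom id (samp_ob p b \<delta> E) (samp_ob p b' \<delta>' E)"
  using diag_homD(1)[OF xD(2) mid_in_QOb] ix_le[OF t_in] ix_mono[OF t_in]
  by (simp add: p samp_ob_def samp_tr_def)

private lemma samp_tr_surj:
  assumes "\<delta> < 1/2" "\<delta>' < 1/2" "prec b \<delta> b' \<delta>'" "y \<in> carrier (fst (samp_ob p b' \<delta>' E))"
  shows "\<exists>z \<in> carrier (fst (samp_ob p b \<delta> E)). fst (samp_tr p b \<delta> b' \<delta>' E) z = y"
proof -
  let ?i = "ix b n t \<delta>" and ?j = "ix b' n t \<delta>'" and ?U = "mid m s E"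
  obtain \<psi> where \<psi>: "\<psi> \<in> diag_hom (DP id 1) (circ m) (fst x ?j) (fst x ?i)"
    "cmp (DP id 1) (fst (fst x ?j) ?U) (fst (fst x ?i) ?U) (fst (fst x ?j) ?U)
        (snd x (?i, ?j) ?U) (\<psi> ?U) = idt (DP id 1) (fst (fst x ?j) ?U)"
    using xD(3)[OF ix_mono[OF t_in assms(1-3)] ix_le[OF t_in assms(2)]] mid_in_QOb by blast
  have "\<psi> ?U \<in> DP_hom id (samp_ob p b' \<delta>' E) (samp_ob p b \<delta> E)"
    using diag_homD(1)[OF \<psi>(1) mid_in_QOb] by (simp add: p samp_ob_def)
  then have "fst (\<psi> ?U) y \<in> carrier (fst (samp_ob p b \<delta> E))"
    using rhomD(2)[OF DP_hom_rhom(1)[OF samp_ob_in[OF assms(2)] samp_ob_in[OF assms(1)]] assms(4)] by simp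
  moreover have "fst (samp_tr p b \<delta> b' \<delta>' E) (fst (\<psi> ?U) y) = y"
    using fun_cong[OF arg_cong[OF \<psi>(2), of fst], where x = y] assms(4)
    by (simp add: p samp_ob_def samp_tr_def compose_eq)
  ultimately show ?thesis by blast
qed

private lemma samp_tr_cmp:
  assumes "\<delta> < 1/2" "\<delta>' < 1/2" "\<delta>'' < 1/2" "prec b \<delta> b' \<delta>'" "prec b' \<delta>' b'' \<delta>''"
    and "z \<in> carrier (fst (samp_ob p b \<delta> E))"
  shows "fst (samp_tr p b \<delta> b'' \<delta>'' E) z =
    fst (samp_tr p b' \<delta>' b'' \<delta>'' E) (fst (samp_tr p b \<delta> b' \<delta>' E) z)"
  using fun_cong[OF arg_cong[OF xD(4)[OF ix_mono[OF t_in assms(1,2,4)] ix_mono[OF t_in assms(2,3,5)]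
      ix_le[OF t_in assms(3)] mid_in_QOb[of m s E]], of fst], where x = z] assms(6)
  by (simp add: p samp_ob_def samp_tr_def compose_eq)

private lemma samp_natural:
  assumes "\<delta> < 1/2" "E'' \<subseteq> E" "E'' \<subseteq> E'" "z \<in> carrier (fst (samp_ob p False \<delta> E))"
  shows "fst (samp_tr p False \<delta> True \<delta> E') (fst (samp_mor p False \<delta> E E' E'') z) =
    fst (samp_mor p True \<delta> E E' E'') (fst (samp_tr p False \<delta> True \<delta> E) z)"
proof -
  have pr: "prec False \<delta> True \<delta>" by (simp add: prec_def)
  show ?thesis
    using fun_cong[OF arg_cong[OF diag_homD(2)[OF xD(2)[OF ix_mono[OF t_in assms(1,1) pr]
        ix_le[OF t_in assms(1)]] mid_QMor[OF assms(2,3), of m s]], of fst], where x = z] assms(4)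
    by (simp add: p samp_ob_def samp_tr_def samp_mor_def compose_eq)
qed

private lemma samp_mor_cmp:
  assumes "\<delta> < 1/2" "F \<subseteq> E" "F \<subseteq> E'" "F' \<subseteq> E'" "F' \<subseteq> E''" "z \<in> carrier (fst (samp_ob p b \<delta> E))"
  shows "fst (samp_mor p b \<delta> E' E'' F') (fst (samp_mor p b \<delta> E E' F) z) =
    fst (samp_mor p b \<delta> E E'' (F \<inter> F')) z"
  using fun_cong[OF arg_cong[OF sum_diagramsD(4)[OF xD(1)[OF ix_le[OF t_in assms(1), of b]]
      mid_QMor[OF assms(2,3), of m s] mid_QMor[OF assms(4,5), of m s]], of fst], where x = z] assms(6)
  by (simp add: p samp_ob_def samp_mor_def mid_Int compose_eq)

private lemma samp_mor_id:
  assumes "\<delta> < 1/2" "z \<in> carrier (fst (samp_ob p b \<delta> E))"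
  shows "fst (samp_mor p b \<delta> E E E) z = z"
  using sum_diagramsD(3)[OF xD(1)[OF ix_le[OF t_in assms(1)]] mid_in_QOb] assms(2)
  by (simp add: p samp_ob_def samp_mor_def)

private lemma samp_mor_zero:
  assumes "\<delta> < 1/2" "z \<in> carrier (fst (samp_ob p b \<delta> E))"
  shows "fst (samp_mor p b \<delta> E E {}) z = \<one>\<^bsub>fst (samp_ob p b \<delta> E)\<^esub>"
proof -
  interpret additive_dual_cat "DP id 1 :: (int dpob, int dpmor) dcat" DP_add
    by (rule additive_dual_cat_DP)
  let ?A = "fst x (ix b n t \<delta>)" and ?U = "mid m s E"
  have a: "fst ?A ?U \<in> DP_ob id" using samp_ob_in[OF assms(1), of b E] by (simp add: p samp_ob_def)
  note Z = diag_zero[where A = ?A and U = ?U and V = ?U,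
      OF xD(1)[OF ix_le[OF t_in assms(1)]] mid_in_QOb mid_in_QOb]
  note Z2 = Z(2)[unfolded DP_simps DP_hom_zero_right[OF a]] Z(3)[unfolded DP_simps DP_hom_zero_left[OF a]]
  show ?thesis
    using assms(2) Z(1) Z2
    by (simp add: p samp_ob_def samp_mor_def mid_empty compose_eq)
qed

private lemma samp_mor_split:
  assumes "\<delta> < 1/2" "F \<subseteq> E" "F' \<subseteq> E" "F \<inter> F' = {}" "z \<in> carrier (fst (samp_ob p b \<delta> E))"
  shows "fst (samp_mor p b \<delta> E E (F \<union> F')) z =
    fst (samp_mor p b \<delta> E E F) z \<otimes>\<^bsub>fst (samp_ob p b \<delta> E)\<^esub> fst (samp_mor p b \<delta> E E F') z"
proof -
  interpret additive_dual_cat "DP id 1 :: (int dpob, int dpmor) dcat" DP_add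
    by (rule additive_dual_cat_DP)
  have "mid m s F \<inter> mid m s F' = {None}"
    unfolding mid_Int[symmetric] assms(4) mid_empty ..
  from diag_split[OF xD(1)[OF ix_le[OF t_in assms(1), of b]] mid_in_QOb mid_mono[OF assms(2)]
      mid_mono[OF assms(3)] this] assms(5)
  show ?thesis by (simp add: p samp_ob_def samp_mor_def mid_Un DP_add_def)
qed

text \<open>A symmetric band makes the terminal sample equal to the dual of the initial one, and the
  transition equal to its own swap. Equality of the two components of the transition is symmetry of
  the form.\<close>

lemma fixed_form:
  assumes "\<epsilon> < 1/2" "0 \<le> \<delta>" "\<delta> < 1/2"
  shows "samp_tr p False \<delta> True \<delta> (band \<epsilon>) \<in>
      DP_hom id (samp_ob p False \<delta> (band \<epsilon>)) (DP_dual id 1 (samp_ob p False \<delta> (band \<epsilon>)))"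
    and "snd (samp_tr p False \<delta> True \<delta> (band \<epsilon>)) = fst (samp_tr p False \<delta> True \<delta> (band \<epsilon>))"
proof -
  have pr: "prec False \<delta> True \<delta>" by (simp add: prec_def)
  show "samp_tr p False \<delta> True \<delta> (band \<epsilon>) \<in>
      DP_hom id (samp_ob p False \<delta> (band \<epsilon>)) (DP_dual id 1 (samp_ob p False \<delta> (band \<epsilon>)))"
    using samp_tr_in[OF assms(3,3) pr, of "band \<epsilon>"] fixed_ob[OF assms(2,3) band_subset[OF assms(1)], of True]
    by (simp add: flip_band)
  show "snd (samp_tr p False \<delta> True \<delta> (band \<epsilon>)) = fst (samp_tr p False \<delta> True \<delta> (band \<epsilon>))"
    using arg_cong[OF fixed_tr[OF assms(2,3,2,3) band_subset[OF assms(1)] pr], of snd]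
    by (simp add: flip_band)
qed

text \<open>The transition from end to end at threshold 0 passes through the two samples at
  \<delta>. By self-duality its last part is the dual of its first part \<alpha>, so the form at 0
  is the pullback of the form at \<delta> along the surjection \<alpha>.\<close>

private lemma odd_at_delta:
  assumes "\<epsilon> < 1/2" "0 \<le> \<delta>" "\<delta> < 1/2"
  shows "odd_at p \<epsilon> 0 \<longleftrightarrow> odd_at p \<epsilon> \<delta>"
proof -
  let ?E = "band \<epsilon>"
  let ?a = "samp_ob p False 0 ?E" and ?b = "samp_ob p False \<delta> ?E"
  let ?\<alpha> = "samp_tr p False 0 False \<delta> ?E" and ?\<phi> = "samp_tr p False \<delta> True \<delta> ?E"
  have half: "(0::real) < 1/2" by simp
  have pr: "prec False 0 False \<delta>" "prec False \<delta> True \<delta>" "prec True \<delta> True 0" "prec False \<delta> True 0"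
    using assms by (auto simp: prec_def)
  have ob: "?a \<in> DP_ob id" "?b \<in> DP_ob id" using samp_ob_in assms by simp_all
  have \<alpha>: "?\<alpha> \<in> DP_hom id ?a ?b" using samp_tr_in[OF half assms(3) pr(1)] .
  have "fst (samp_tr p False 0 True 0 ?E) z = snd ?\<alpha> (fst ?\<phi> (fst ?\<alpha> z))"
    if z: "z \<in> car ?a" for z
  proof -
    have \<alpha>z: "fst ?\<alpha> z \<in> car ?b" using rhomD(2)[OF DP_hom_rhom(1)[OF ob \<alpha>] z] .
    \<comment> \<open>Reflection turns the motion from \<delta> to 0 at the terminal end into the
      motion from 0 to \<delta> at the initial end.\<close>
    have "samp_tr p True \<delta> True 0 ?E = prod.swap ?\<alpha>"
      using fixed_tr[OF assms(2,3) order_refl half band_subset[OF assms(1)] pr(3)] by (simp add: flip_band)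
    then show ?thesis
      using samp_tr_cmp[OF half assms(3) half pr(1,4) z] samp_tr_cmp[OF assms(3,3) half pr(2,3) \<alpha>z]
      by simp
  qed
  then show ?thesis
    unfolding odd_at_def
    by (rule odd_form_transport[OF ob \<alpha> fixed_form(1)[OF assms] _ samp_tr_surj[OF half assms(3) pr(1)]])
qed

text \<open>The band is the point 1/2 together with two halves exchanged by the reflection.
  Self-duality makes the projectors onto these halves adjoint to each other, so
  \<open>form_parity_split\<close> reduces the parity to the summand over 1/2.\<close>

private lemma odd_at_epsilon:
  assumes "0 \<le> \<epsilon>" "\<epsilon> < 1/2" "0 \<le> \<delta>" "\<delta> < 1/2"
  shows "odd_at p \<epsilon> \<delta> \<longleftrightarrow> odd_at p 0 \<delta>"
proof -
  let ?E = "band \<epsilon>" and ?M = "band 0" and ?L = "{1/2 - \<epsilon>..<1/2}" and ?R = "{1/2<..1/2 + \<epsilon>}"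
  have E: "?E = ?M \<union> (?L \<union> ?R)" using assms(1) by (auto simp: band_def)
  have sub: "?M \<subseteq> ?E" "?L \<subseteq> ?E" "?R \<subseteq> ?E" "?L \<union> ?R \<subseteq> ?E" by (auto simp: E)
  have I: "?E \<subseteq> {0<..<1}" "?M \<subseteq> {0<..<1}" using assms(2) by (auto simp: band_def)
  have flip: "(-) 1 ` ?L = ?R" "(-) 1 ` ?R = ?L"
    unfolding set_eq_iff flip_iff by auto
  let ?a = "samp_ob p False \<delta> ?E" and ?am = "samp_ob p False \<delta> ?M"
  let ?\<phi> = "samp_tr p False \<delta> True \<delta> ?E" and ?\<phi>m = "samp_tr p False \<delta> True \<delta> ?M"
  let ?e = "samp_mor p False \<delta> ?E ?E"
  have a: "?a \<in> DP_ob id" "?am \<in> DP_ob id" using samp_ob_in assms(4) by simp_all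
  note \<phi> = fixed_form[OF assms(2-4)]
  have e: "?e Y \<in> DP_hom id ?a ?a" if "Y \<subseteq> ?E" for Y
    using samp_mor_in[OF assms(4) that that] .
  have e_in: "fst (?e Y) z \<in> car ?a" if "Y \<subseteq> ?E" "z \<in> car ?a" for Y z
    using rhomD(2)[OF DP_hom_rhom(1)[OF a(1) a(1) e[OF that(1)]] that(2)] .
  \<comment> \<open>Naturality replaces the projector at the initial end by the one at the terminal
    end, and the latter is the dual of the initial projector over the reflected set.\<close>
  have nat: "fst ?\<phi> (fst (?e Y) z) = snd (?e ((-) 1 ` Y)) (fst ?\<phi> z)"
    if "Y \<subseteq> ?E" "z \<in> car ?a" for Y z
    using samp_natural[OF assms(4) that(1,1,2)] fixed_mor[OF assms(3,4) I(1,1) that(1,1), of True]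
    by (simp add: flip_band)
  have dec: "fst (?e ?M) z \<otimes>\<^bsub>fst ?a\<^esub> (fst (?e ?L) z \<otimes>\<^bsub>fst ?a\<^esub> fst (?e ?R) z) = z"
    if z: "z \<in> car ?a" for z
  proof -
    have "?M \<inter> (?L \<union> ?R) = {}" "?L \<inter> ?R = {}" by (auto simp: band_def)
    then have "fst (?e (?M \<union> (?L \<union> ?R))) z =
        fst (?e ?M) z \<otimes>\<^bsub>fst ?a\<^esub> (fst (?e ?L) z \<otimes>\<^bsub>fst ?a\<^esub> fst (?e ?R) z)"
      using samp_mor_split[OF assms(4) sub(1) sub(4) _ z] samp_mor_split[OF assms(4) sub(2,3) _ z] by simp
    then show ?thesis unfolding E[symmetric] using samp_mor_id[OF assms(4) z] by simp
  qed
  have disj: "fst (?e Y) (fst (?e Y') z) = \<one>\<^bsub>fst ?a\<^esub>"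
    if "Y \<subseteq> ?E" "Y' \<subseteq> ?E" "Y \<inter> Y' = {}" "z \<in> car ?a" for Y Y' z
    using samp_mor_cmp[OF assms(4) that(2,2,1,1,4)] samp_mor_zero[OF assms(4) that(4)] that(3)
    by (simp add: Int_commute)
  have dis: "?M \<inter> ?L = {}" "?M \<inter> ?R = {}" "?R \<inter> ?L = {}" "?L \<inter> ?R = {}" by (auto simp: band_def)
  have split: "odd (pair ?a (fst ?\<phi> z) z) \<longleftrightarrow>
      odd (pair ?a (fst ?\<phi> (fst (?e ?M) z)) (fst (?e ?M) z))"
    if z: "z \<in> car ?a" for z
  proof (rule form_parity_split[OF a(1) \<phi> e[OF sub(1)] e[OF sub(2)] e[OF sub(3)] _ _ _ dec
        disj[OF sub(1,2) dis(1)] disj[OF sub(1,3) dis(2)] disj[OF sub(3,2) dis(3)] disj[OF sub(2,3) dis(4)] z])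
    show "fst ?\<phi> (fst (?e ?M) z) = snd (?e ?M) (fst ?\<phi> z)" if "z \<in> car ?a" for z
      using nat[OF sub(1) that] by (simp add: flip_band)
    show "fst ?\<phi> (fst (?e ?L) z) = snd (?e ?R) (fst ?\<phi> z)" if "z \<in> car ?a" for z
      using nat[OF sub(2) that] by (simp only: flip)
    show "fst ?\<phi> (fst (?e ?R) z) = snd (?e ?L) (fst ?\<phi> z)" if "z \<in> car ?a" for z
      using nat[OF sub(3) that] by (simp only: flip)
  qed
  \<comment> \<open>Inclusion and projection of the middle summand: ?q after ?i is the identity, and
    ?i after ?q is the projector onto the middle. Self-duality, used below, makes the form on the
    middle the restriction along ?i of the form on the whole band.\<close>
  let ?i = "samp_mor p False \<delta> ?M ?E ?M" and ?q = "samp_mor p False \<delta> ?E ?M ?M"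
  have i: "?i \<in> DP_hom id ?am ?a" by (rule samp_mor_in[OF assms(4) order_refl sub(1)])
  have q: "?q \<in> DP_hom id ?a ?am" by (rule samp_mor_in[OF assms(4) sub(1) order_refl])
  have i_in: "fst ?i y \<in> car ?a" if "y \<in> car ?am" for y
    using rhomD(2)[OF DP_hom_rhom(1)[OF a(2,1) i] that] .
  have q_in: "fst ?q z \<in> car ?am" if "z \<in> car ?a" for z
    using rhomD(2)[OF DP_hom_rhom(1)[OF a q] that] .
  have restrict: "pair ?a (fst ?\<phi> (fst ?i y)) (fst ?i y) = pair ?am (fst ?\<phi>m y) y"
    if y: "y \<in> car ?am" for y
  proof -
    have "fst ?\<phi> (fst ?i y) = snd ?q (fst ?\<phi>m y)"
      using samp_natural[OF assms(4) order_refl sub(1) y] fixed_mor[OF assms(3,4) I(2,1) order_refl sub(1), of True]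
      by (simp add: flip_band)
    moreover have "fst ?\<phi>m y \<in> dcar ?am"
      using rhomD(2)[OF DP_hom_rhom(1)[OF a(2) DP_dual_in[OF a(2)] fixed_form(1)[OF _ assms(3,4), of 0]] y]
      by (simp add: DP_dual_eq[OF a(2)])
    moreover have "fst ?q (fst ?i y) = y"
      using samp_mor_cmp[OF assms(4) order_refl sub(1) sub(1) order_refl y] samp_mor_id[OF assms(4) y] by simp
    ultimately show ?thesis using DP_hom_rhom(3)[OF a q] i_in[OF y] by simp
  qed
  have eM: "fst (?e ?M) z = fst ?i (fst ?q z)" if "z \<in> car ?a" for z
    using samp_mor_cmp[OF assms(4) sub(1) order_refl order_refl sub(1) that] by simp
  show ?thesis
    unfolding odd_at_def odd_form_def
  proof
    assume "\<exists>z \<in> car ?a. odd (pair ?a (fst ?\<phi> z) z)"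
    then obtain z where z: "z \<in> car ?a" "odd (pair ?a (fst ?\<phi> z) z)" by blast
    then have "odd (pair ?am (fst ?\<phi>m (fst ?q z)) (fst ?q z))"
      using split[OF z(1)] restrict[OF q_in[OF z(1)]] eM[OF z(1)] by simp
    then show "\<exists>y \<in> car ?am. odd (pair ?am (fst ?\<phi>m y) y)"
      using q_in[OF z(1)] by blast
  next
    assume "\<exists>y \<in> car ?am. odd (pair ?am (fst ?\<phi>m y) y)"
    then obtain y where y: "y \<in> car ?am" "odd (pair ?am (fst ?\<phi>m y) y)" by blast
    then have "odd (pair ?a (fst ?\<phi> (fst ?i y)) (fst ?i y))" using restrict[OF y(1)] by simp
    then show "\<exists>z \<in> car ?a. odd (pair ?a (fst ?\<phi> z) z)"
      using i_in[OF y(1)] by blast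
  qed
qed

lemma odd_at_indep:
  assumes "0 \<le> \<epsilon>" "\<epsilon> < 1/2" "0 \<le> \<delta>" "\<delta> < 1/2"
  shows "odd_at p \<epsilon> \<delta> \<longleftrightarrow> odd_at p 0 0"
  using odd_at_epsilon[OF assms] odd_at_delta[of 0 \<delta>] assms by simp

end

section \<open>Generic thresholds and openness of the parity conditions\<close>

lemma openin_threshold:
  fixes F :: "('z \<Rightarrow> real) set"
  assumes "finite F" "\<And>f. f \<in> F \<Longrightarrow> continuous_map Z euclideanreal f" "z \<in> topspace Z" "c < d"
  obtains c' T where "c < c'" "c' < d" "openin Z T" "z \<in> T"
    "\<And>y f. y \<in> T \<Longrightarrow> f \<in> F \<Longrightarrow> c' < f y \<longleftrightarrow> c < f z"
proof -
  \<comment> \<open>Choosing c' strictly between c and the least element of this finite set keeps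
    every comparison at z unchanged and makes each strict in one direction or the other, hence
    stable near z. Values equal to c fall below c', which is why the threshold is raised and not
    lowered.\<close>
  let ?S = "insert d ((\<lambda>f. f z) ` {f \<in> F. c < f z})"
  have S: "finite ?S" "?S \<noteq> {}" using assms(1) by auto
  have "c < Min ?S" using S assms(4) by (subst Min_gr_iff) auto
  then obtain c' where c': "c < c'" "c' < Min ?S" using dense by blast
  have above: "c' < f z" if "f \<in> F" "c < f z" for f
    using c'(2) Min_le[OF S(1), of "f z"] that by fastforce
  have d: "c' < d" using c'(2) Min_le[OF S(1), of d] by simp
  let ?T = "(\<Inter>f\<in>F. {y \<in> topspace Z. f y \<in> (if c < f z then {c'<..} else {..<c'})}) \<inter> topspace Z"
  have "openin Z ?T"
  proof (rule openin_INT[OF assms(1)])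
    fix f assume "f \<in> F"
    then show "openin Z {y \<in> topspace Z. f y \<in> (if c < f z then {c'<..} else {..<c'})}"
      by (intro openin_continuous_map_preimage[OF assms(2)]) auto
  qed
  moreover have "z \<in> ?T" using above c'(1) assms(3) by auto
  moreover have "c' < f y \<longleftrightarrow> c < f z" if "y \<in> ?T" "f \<in> F" for y f
  proof -
    have "f y \<in> (if c < f z then {c'<..} else {..<c'})" using that by blast
    then show ?thesis by (auto split: if_splits)
  qed
  ultimately show thesis using that[OF c'(1) d] by blast
qed

lemma continuous_map_coordinate:
  "continuous_map (simplex_top m) euclideanreal (\<lambda>s. s i)"
  unfolding simplex_top_def
  by (intro continuous_map_from_subtopology continuous_map_product_projection) simp

lemma topspace_simplex_top [simp]: "topspace (simplex_top m) = standard_simplex m"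
  by (simp add: simplex_top_def)

text \<open>Membership in the band fails exactly if \<epsilon> is less than the distance of the
  location from 1/2, and \<open>lo\<close> tests whether \<delta> is less than a partial sum. Both
  samples thus depend on strict comparisons of a threshold with finitely many continuous functions,
  to which \<open>openin_threshold\<close> applies.\<close>

lemma openin_sampling_constant:
  assumes "s \<in> standard_simplex m" "t \<in> standard_simplex n"
    and "0 \<le> \<epsilon>" "\<epsilon> < 1/2" "0 \<le> \<delta>" "\<delta> < 1/2"
  obtains \<epsilon>' \<delta>' T where "0 \<le> \<epsilon>'" "\<epsilon>' < 1/2" "0 \<le> \<delta>'" "\<delta>' < 1/2"
    "openin (prod_topology (simplex_top m) (simplex_top n)) T" "(s, t) \<in> T"
    "\<And>s' t'. (s', t') \<in> T \<Longrightarrow> mid m s' (band \<epsilon>') = mid m s (band \<epsilon>)"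
    "\<And>s' t' b. (s', t') \<in> T \<Longrightarrow> ix b n t' \<delta>' = ix b n t \<delta>"
proof -
  let ?Z = "prod_topology (simplex_top m) (simplex_top n)"
  have fst: "continuous_map ?Z euclideanreal (\<lambda>z. fst z i)" for i
    using continuous_map_compose[OF continuous_map_fst continuous_map_coordinate] by (simp add: comp_def)
  have snd: "continuous_map ?Z euclideanreal (\<lambda>z. snd z i)" for i
    using continuous_map_compose[OF continuous_map_snd continuous_map_coordinate] by (simp add: comp_def)
  have z: "(s, t) \<in> topspace ?Z" using assms by simp
  let ?F = "(\<lambda>\<xi> z. \<bar>loc m (fst z) \<xi> - 1/2\<bar>) ` {\<xi>. Some \<xi> \<in> circ m}"
  have "finite (Some -` circ m)" by (intro finite_vimageI finite_circ) simp
  then have F: "finite ?F" by (simp add: vimage_def)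
  have Fc: "continuous_map ?Z euclideanreal f" if "f \<in> ?F" for f
    using that unfolding loc_def
    by (auto intro!: continuous_map_real_abs continuous_map_diff continuous_map_sum fst)
  obtain \<epsilon>' T1 where e: "\<epsilon> < \<epsilon>'" "\<epsilon>' < 1/2" "openin ?Z T1" "(s, t) \<in> T1"
    and T1: "\<And>y f. y \<in> T1 \<Longrightarrow> f \<in> ?F \<Longrightarrow> \<epsilon>' < f y \<longleftrightarrow> \<epsilon> < f (s, t)"
    using openin_threshold[OF F Fc z assms(4)] by blast
  \<comment> \<open>The reversed partial sums account for the terminal end, whose index is
    \<open>lo\<close> of the reversed coordinates.\<close>
  let ?G = "(\<lambda>j z. sum (snd z) {..j}) ` {..n} \<union> (\<lambda>j z. sum (simplex_rev n (snd z)) {..j}) ` {..n}"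
  have Gc: "continuous_map ?Z euclideanreal f" if "f \<in> ?G" for f
    using that by (auto simp: simplex_rev_def intro!: continuous_map_sum snd)
  have G: "finite ?G" by simp
  obtain \<delta>' T2 where d: "\<delta> < \<delta>'" "\<delta>' < 1/2" "openin ?Z T2" "(s, t) \<in> T2"
    and T2: "\<And>y f. y \<in> T2 \<Longrightarrow> f \<in> ?G \<Longrightarrow> \<delta>' < f y \<longleftrightarrow> \<delta> < f (s, t)"
    using openin_threshold[OF G Gc z assms(6)] by blast
  have in_Z: "s' \<in> standard_simplex m" "t' \<in> standard_simplex n" if "(s', t') \<in> T2" for s' t'
    using openin_subset[OF d(3)] that by auto
  have mid: "mid m s' (band \<epsilon>') = mid m s (band \<epsilon>)" if "(s', t') \<in> T1" for s' t'
  proof -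
    have "loc m s' \<xi> \<in> band \<epsilon>' \<longleftrightarrow> loc m s \<xi> \<in> band \<epsilon>" if \<xi>: "Some \<xi> \<in> circ m" for \<xi>
    proof -
      have "\<epsilon>' < \<bar>loc m s' \<xi> - 1/2\<bar> \<longleftrightarrow> \<epsilon> < \<bar>loc m s \<xi> - 1/2\<bar>"
        using T1[OF \<open>(s', t') \<in> T1\<close>, of "\<lambda>z. \<bar>loc m (fst z) \<xi> - 1/2\<bar>"] \<xi> by auto
      then show ?thesis by (auto simp: band_def abs_if split: if_splits)
    qed
    then show ?thesis by (auto simp: mid_def)
  qed
  have lo_eq: "lo u' \<delta>' = lo u \<delta>"
    if "u \<in> standard_simplex n" "u' \<in> standard_simplex n"
      "\<And>j. j \<le> n \<Longrightarrow> \<delta>' < sum u' {..j} \<longleftrightarrow> \<delta> < sum u {..j}" for u u'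
  proof -
    have "\<delta>' < sum u' {..j} \<longleftrightarrow> \<delta> < sum u {..j}" for j
    proof (cases "j \<le> n")
      \<comment> \<open>\<open>lo\<close> is a least element among all natural numbers, so indices
        beyond n have to be compared as well; the sums there equal 1 and exceed both
        thresholds.\<close>
      case False
      have "sum v {..j} = 1" if "v \<in> standard_simplex n" for v
      proof -
        have "sum v {..j} = sum v {..n}"
          using False standard_simplex_outside[OF that] by (intro sum.mono_neutral_right) auto
        then show ?thesis using standard_simplex_sum[OF that] by simp
      qed
      then show ?thesis using that(1,2) d(2) assms(6) by simp
    qed (use that(3) in simp)
    then show ?thesis by (simp add: lo_def)
  qed
  have ix: "ix b n t' \<delta>' = ix b n t \<delta>" if "(s', t') \<in> T2" for s' t' b
  proof -
    have "\<delta>' < sum t' {..j} \<longleftrightarrow> \<delta> < sum t {..j}" if "j \<le> n" for j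
      using T2[OF \<open>(s', t') \<in> T2\<close>, of "\<lambda>z. sum (snd z) {..j}"] that by auto
    moreover have "\<delta>' < sum (simplex_rev n t') {..j} \<longleftrightarrow> \<delta> < sum (simplex_rev n t) {..j}" if "j \<le> n" for j
      using T2[OF \<open>(s', t') \<in> T2\<close>, of "\<lambda>z. sum (simplex_rev n (snd z)) {..j}"] that by auto
    ultimately show ?thesis
      using lo_eq[OF assms(2) in_Z(2)[OF that]]
        lo_eq[OF simplex_rev_in[OF assms(2)] simplex_rev_in[OF in_Z(2)[OF that]]]
      by (simp add: ix_def hi_def)
  qed
  show thesis
    by (rule that[of \<epsilon>' \<delta>' "T1 \<inter> T2"]) (use e d assms mid ix in auto)
qed

text \<open>These two sets need not be disjoint: away from fixed points the parity may depend on the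
  thresholds. The existential quantifier lets neighbouring points use the slightly raised
  thresholds.\<close>

definition parity_points :: "bool \<Rightarrow> int sd_point set" where
  "parity_points par = {p \<in> topspace (bs_total NiZ).
     \<exists>\<epsilon> \<delta>. 0 \<le> \<epsilon> \<and> \<epsilon> < 1/2 \<and> 0 \<le> \<delta> \<and> \<delta> < 1/2 \<and> odd_at p \<epsilon> \<delta> = par}"

lemma openin_parity_points: "openin (bs_total NiZ) (parity_points par)"
proof -
  have "openin (prod_topology (simplex_top m) (simplex_top n)) {z. ((m, n, x), z) \<in> parity_points par}"
    if x: "x \<in> bs_set NiZ m n" for m n x
  proof (subst openin_subopen, intro ballI)
    fix z assume "z \<in> {z. ((m, n, x), z) \<in> parity_points par}"
    then obtain s t \<epsilon> \<delta> where z: "z = (s, t)" "s \<in> standard_simplex m" "t \<in> standard_simplex n"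
      and par: "0 \<le> \<epsilon>" "\<epsilon> < 1/2" "0 \<le> \<delta>" "\<delta> < 1/2" "odd_at ((m, n, x), s, t) \<epsilon> \<delta> = par"
      by (auto simp: parity_points_def topspace_bs_total)
    obtain \<epsilon>' \<delta>' T where T: "0 \<le> \<epsilon>'" "\<epsilon>' < 1/2" "0 \<le> \<delta>'" "\<delta>' < 1/2"
      "openin (prod_topology (simplex_top m) (simplex_top n)) T" "(s, t) \<in> T"
      "\<And>s' t'. (s', t') \<in> T \<Longrightarrow> mid m s' (band \<epsilon>') = mid m s (band \<epsilon>)"
      "\<And>s' t' b. (s', t') \<in> T \<Longrightarrow> ix b n t' \<delta>' = ix b n t \<delta>"
      using openin_sampling_constant[OF z(2,3) par(1-4)] by blast
    have "((m, n, x), s', t') \<in> parity_points par" if T': "(s', t') \<in> T" for s' t'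
    proof -
      have "(s', t') \<in> topspace (prod_topology (simplex_top m) (simplex_top n))"
        using openin_subset[OF T(5)] T' by blast
      then have "((m, n, x), s', t') \<in> topspace (bs_total NiZ)" using x by (simp add: topspace_bs_total)
      moreover have "odd_at ((m, n, x), s', t') \<epsilon>' \<delta>' = par"
        using par(5) T(7,8)[OF T'] by (simp add: odd_at_def samp_ob_def samp_tr_def)
      ultimately show ?thesis using T(1-4) unfolding parity_points_def by blast
    qed
    then show "\<exists>T. openin (prod_topology (simplex_top m) (simplex_top n)) T \<and> z \<in> T \<and>
        T \<subseteq> {z. ((m, n, x), z) \<in> parity_points par}"
      using T(5,6) z(1) by (intro exI[of _ T]) auto
  qed
  moreover have "parity_points par \<subseteq> topspace (bs_total NiZ)" by (auto simp: parity_points_def)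
  ultimately show ?thesis
    unfolding bs_total_def openin_sum_topology topspace_sum_topology by auto
qed

section \<open>Parity as a condition on points of the realization\<close>

definition parity_set :: "bool \<Rightarrow> int sd_point set set" where
  "parity_set par = (\<lambda>p. bs_eqv NiZ `` {p}) ` parity_points par"

lemma parity_points_saturated:
  assumes "p \<in> parity_points par" "(p, q) \<in> bs_eqv NiZ" "q \<in> topspace (bs_total NiZ)"
  shows "q \<in> parity_points par"
proof -
  obtain \<epsilon> \<delta> where e: "0 \<le> \<epsilon>" "\<epsilon> < 1/2" "0 \<le> \<delta>" "\<delta> < 1/2" "odd_at p \<epsilon> \<delta> = par"
    using assms(1) by (auto simp: parity_points_def)
  have "prec False \<delta> True \<delta>" by (simp add: prec_def)
  then have "odd_at q \<epsilon> \<delta> = par"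
    using samp_eqv(1,3)[OF assms(2) e(3,4) band_subset[OF e(2)]] e by (simp add: odd_at_def)
  then show ?thesis using assms(3) e(1-4) unfolding parity_points_def by blast
qed

lemma parity_set_iff:
  assumes "p \<in> topspace (bs_total NiZ)"
  shows "bs_eqv NiZ `` {p} \<in> parity_set par \<longleftrightarrow> p \<in> parity_points par"
proof
  assume "bs_eqv NiZ `` {p} \<in> parity_set par"
  then obtain q where "q \<in> parity_points par" "bs_eqv NiZ `` {q} = bs_eqv NiZ `` {p}"
    by (auto simp: parity_set_def)
  then show "p \<in> parity_points par"
    using parity_points_saturated[OF _ _ assms] by (simp add: bs_eqv_class_eq)
qed (simp add: parity_set_def)

lemma openin_parity_set: "openin (bs_real NiZ) (parity_set par)"
proof -
  have sub: "parity_points par \<subseteq> topspace (bs_total NiZ)" by (auto simp: parity_points_def)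
  have "{p \<in> topspace (bs_total NiZ). bs_eqv NiZ `` {p} \<in> parity_set par} =
      {p \<in> topspace (bs_total NiZ). p \<in> parity_points par}"
    by (simp add: parity_set_iff cong: conj_cong)
  also have "\<dots> = parity_points par" using sub by blast
  finally have "{p \<in> topspace (bs_total NiZ). bs_eqv NiZ `` {p} \<in> parity_set par} =
      parity_points par" .
  moreover have "parity_set par \<subseteq> topspace (bs_total NiZ) // bs_eqv NiZ"
    unfolding parity_set_def by (intro image_subsetI quotientI subsetD[OF sub])
  ultimately show ?thesis
    unfolding openin_bs_real using openin_parity_points[of par] by simp
qed

lemma dual_bisset_int: "dual_bisset NiZ"
  by (rule dual_bisset_NiA[OF additive_dual_cat_DP])

lemma parity_points_fixed:
  assumes "p \<in> topspace (bs_total NiZ)" "(p, pt_rev NiZ p) \<in> bs_eqv NiZ"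
  shows "p \<in> parity_points par \<longleftrightarrow> odd_at p 0 0 = par"
proof -
  obtain m n x s t where p: "p = ((m, n, x), s, t)" by (metis surj_pair)
  have indep: "odd_at p \<epsilon> \<delta> = odd_at p 0 0" if "0 \<le> \<epsilon>" "\<epsilon> < 1/2" "0 \<le> \<delta>" "\<delta> < 1/2" for \<epsilon> \<delta>
    using odd_at_indep[OF p assms that] .
  show ?thesis
  proof
    assume "p \<in> parity_points par"
    then obtain \<epsilon> \<delta> where e: "0 \<le> \<epsilon>" "\<epsilon> < 1/2" "0 \<le> \<delta>" "\<delta> < 1/2" and "odd_at p \<epsilon> \<delta> = par"
      by (auto simp: parity_points_def)
    then show "odd_at p 0 0 = par" using indep[OF e] by simp
  next
    assume "odd_at p 0 0 = par"
    moreover have "(0::real) < 1/2" by simp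
    ultimately show "p \<in> parity_points par"
      using assms(1) unfolding parity_points_def by blast
  qed
qed

lemma fixed_class:
  assumes "y \<in> topspace (bs_real NiZ)" "bs_real_inv NiZ y = y" "p \<in> y"
    and "p \<in> topspace (bs_total NiZ)"
  shows "(p, pt_rev NiZ p) \<in> bs_eqv NiZ"
proof -
  have y: "bs_eqv NiZ `` {p} = y" using bs_real_class_of[OF assms(1,3)] by (rule sym)
  have "y = bs_eqv NiZ `` {pt_rev NiZ p}"
    using dual_bisset.bs_real_inv_class[OF dual_bisset_int assms(4)] unfolding y assms(2) .
  then show ?thesis unfolding y[symmetric] by (rule iffD1[OF bs_eqv_class_eq])
qed

lemma parity_set_fixed:
  assumes "y \<in> topspace (bs_real NiZ)" "bs_real_inv NiZ y = y"
    and "p \<in> y" "p \<in> topspace (bs_total NiZ)"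
  shows "y \<in> parity_set par \<longleftrightarrow> odd_at p 0 0 = par"
proof -
  have y: "y = bs_eqv NiZ `` {p}" by (rule bs_real_class_of[OF assms(1,3)])
  show ?thesis
    unfolding y parity_set_iff[OF assms(4)] by (rule parity_points_fixed[OF assms(4) fixed_class[OF assms]])
qed

text \<open>At a fixed point \<open>odd_at p 0 0\<close> decides between the two open sets, so
  \<open>midpoint_separation\<close> applies with the opposite parity as second set.\<close>

lemma parity_path_component:
  assumes "path_component_of (K11 (id :: int \<Rightarrow> int) 1) \<gamma> \<gamma>'" "\<gamma> (1/2) \<in> parity_set par"
  shows "\<gamma>' (1/2) \<in> parity_set par"
proof (rule midpoint_separation[OF openin_parity_set[of par] openin_parity_set[of "\<not> par"] _
      assms(1)[unfolded K11_def] assms(2)])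
  fix y assume y: "y \<in> topspace (bs_real NiZ)" "bs_real_inv NiZ y = y"
  obtain p where p: "p \<in> topspace (bs_total NiZ)" "y = bs_eqv NiZ `` {p}"
    using bs_real_point[OF y(1)] .
  then have "p \<in> y" by (simp add: bs_eqv_refl)
  then show "y \<in> parity_set par \<longleftrightarrow> y \<notin> parity_set (\<not> par)"
    using parity_set_fixed[OF y _ p(1)] by auto
qed

section \<open>Diagrams with one object\<close>

context additive_dual_cat
begin

text \<open>The zero map. The record names a zero object but no maps to or from it, so they are
  picked out by their uniqueness.\<close>

definition zmap :: "'o \<Rightarrow> 'o \<Rightarrow> 'm" where
  "zmap a b = cmp C a (zob C) b (THE h. h \<in> hom C (zob C) b) (THE g. g \<in> hom C a (zob C))"

lemma zmap_eq:
  assumes "a \<in> ob C" "b \<in> ob C" "g \<in> hom C a (zob C)" "h \<in> hom C (zob C) b"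
  shows "zmap a b = cmp C a (zob C) b h g"
proof -
  have "(THE h. h \<in> hom C (zob C) b) = h" "(THE g. g \<in> hom C a (zob C)) = g"
    using the1_equality[OF zob_initial[OF assms(2)]] the1_equality[OF zob_terminal[OF assms(1)]] assms(3,4)
    by simp_all
  then show ?thesis by (simp add: zmap_def)
qed

lemma zero_maps:
  assumes "a \<in> ob C"
  obtains g h where "g \<in> hom C a (zob C)" "h \<in> hom C (zob C) a"
  using zob_initial[OF assms] zob_terminal[OF assms] by blast

lemma zmap_in:
  assumes "a \<in> ob C" "b \<in> ob C"
  shows "zmap a b \<in> hom C a b"
proof -
  obtain g where g: "g \<in> hom C a (zob C)" using zero_maps[OF assms(1)] by blast
  obtain h where h: "h \<in> hom C (zob C) b" using zero_maps[OF assms(2)] by blast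
  show ?thesis unfolding zmap_eq[OF assms g h] by (rule cmp_in[OF assms(1) zob_in assms(2) g h])
qed

lemma cmp_zmap_right:
  assumes "a \<in> ob C" "b \<in> ob C" "c \<in> ob C" "f \<in> hom C b c"
  shows "cmp C a b c f (zmap a b) = zmap a c"
proof -
  obtain g where g: "g \<in> hom C a (zob C)" using zero_maps[OF assms(1)] by blast
  obtain h where h: "h \<in> hom C (zob C) b" using zero_maps[OF assms(2)] by blast
  have "cmp C a b c f (zmap a b) = cmp C a (zob C) c (cmp C (zob C) b c f h) g"
    unfolding zmap_eq[OF assms(1,2) g h]
    by (rule cmp_assoc[symmetric, OF assms(1) zob_in assms(2,3) g h assms(4)])
  also have "\<dots> = zmap a c"
    using zmap_eq[OF assms(1,3) g cmp_in[OF zob_in assms(2,3) h assms(4)]] by simp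
  finally show ?thesis .
qed

lemma cmp_zmap_left:
  assumes "a \<in> ob C" "b \<in> ob C" "c \<in> ob C" "f \<in> hom C a b"
  shows "cmp C a b c (zmap b c) f = zmap a c"
proof -
  obtain g where g: "g \<in> hom C b (zob C)" using zero_maps[OF assms(2)] by blast
  obtain h where h: "h \<in> hom C (zob C) c" using zero_maps[OF assms(3)] by blast
  have "cmp C a b c (zmap b c) f = cmp C a (zob C) c h (cmp C a b (zob C) g f)"
    unfolding zmap_eq[OF assms(2,3) g h]
    by (rule cmp_assoc[OF assms(1,2) zob_in assms(3,4) g h])
  also have "\<dots> = zmap a c"
    using zmap_eq[OF assms(1,3) cmp_in[OF assms(1,2) zob_in assms(4) g] h] by simp
  finally show ?thesis .
qed

lemma zmap_zob: "zmap (zob C) (zob C) = idt C (zob C)"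
  using zob_terminal[OF zob_in] zmap_in[OF zob_in zob_in] idt_in[OF zob_in] by blast

lemma dmor_zmap:
  assumes "a \<in> ob C" "b \<in> ob C"
  shows "dmor C a b (zmap a b) = zmap (dob C b) (dob C a)"
proof -
  obtain g where g: "g \<in> hom C a (zob C)" using zero_maps[OF assms(1)] by blast
  obtain h where h: "h \<in> hom C (zob C) b" using zero_maps[OF assms(2)] by blast
  have "dmor C a b (zmap a b) =
      cmp C (dob C b) (zob C) (dob C a) (dmor C a (zob C) g) (dmor C (zob C) b h)"
    unfolding zmap_eq[OF assms g h] using dmor_cmp[OF assms(1) zob_in assms(2) g h] by (simp add: dob_zob)
  moreover have "dmor C a (zob C) g \<in> hom C (zob C) (dob C a)" "dmor C (zob C) b h \<in> hom C (dob C b) (zob C)"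
    using dmor_in[OF assms(1) zob_in g] dmor_in[OF zob_in assms(2) h] by (simp_all add: dob_zob)
  ultimately show ?thesis using zmap_eq[OF dob_in[OF assms(2)] dob_in[OF assms(1)]] by simp
qed

text \<open>Intended for a pointed set with at most one further point, the label of which is b.
  There W differs from {None} only if U, V and W are the whole set, so the identity of b has the
  right type. The one-point set is included and gives the zero diagram.\<close>

definition point_diag :: "'x option set \<Rightarrow> 'o \<Rightarrow> ('x, 'o, 'm) diag" where
  "point_diag X b = (\<lambda>U\<in>QOb X. if U = {None} then zob C else b,
     \<lambda>(U, V, W)\<in>QMor X. if W = {None} then zmap (if U = {None} then zob C else b)
       (if V = {None} then zob C else b) else idt C b)"

context
  fixes X :: "'x option set" and u
  assumes X: "None \<in> X" "X \<subseteq> {None, u}"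
begin

lemma point_QOb: "U \<in> QOb X \<Longrightarrow> U \<noteq> {None} \<Longrightarrow> U = X \<and> u \<noteq> None"
  using X by (auto simp: QOb_def)

lemma point_QMor: "(U, V, W) \<in> QMor X \<Longrightarrow> W \<noteq> {None} \<Longrightarrow> U = X \<and> V = X \<and> W = X \<and> X \<noteq> {None}"
proof -
  assume "(U, V, W) \<in> QMor X" "W \<noteq> {None}"
  then have q: "U \<subseteq> X" "V \<subseteq> X" "W \<subseteq> U" "W \<subseteq> V" "None \<in> W" and "W \<noteq> {None}"
    by (simp_all add: QMor_iff)
  then obtain w where "w \<in> W" "w \<noteq> None" by blast
  then have "w = u" using q X by blast
  then have "X \<subseteq> W" using X q \<open>w \<in> W\<close> by blast
  then show ?thesis using q \<open>W \<noteq> {None}\<close> by blast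
qed

lemma point_diag_in:
  assumes b: "b \<in> ob C"
  shows "point_diag X b \<in> sum_diagrams C X"
proof -
  let ?A = "point_diag X b"
  have N: "{None} \<in> QOb X" using X by (simp add: QOb_def)
  have o: "fst ?A U = (if U = {None} then zob C else b)" if "U \<in> QOb X" for U
    using that by (simp add: point_diag_def)
  have ob: "fst ?A U \<in> ob C" if "U \<in> QOb X" for U
    using o[OF that] b zob_in by simp
  have z: "snd ?A (U, V, W) = zmap (fst ?A U) (fst ?A V)" if "(U, V, W) \<in> QMor X" "W = {None}" for U V W
    using that QMor_QOb[OF that(1)] o by (simp add: point_diag_def)
  have i: "snd ?A (U, V, W) = idt C b" "fst ?A U = b" "fst ?A V = b"
    if "(U, V, W) \<in> QMor X" "W \<noteq> {None}" for U V W
    using that QMor_QOb[OF that(1)] point_QMor[OF that] by (simp_all add: point_diag_def)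
  have mor: "snd ?A (U, V, W) \<in> hom C (fst ?A U) (fst ?A V)" if q: "(U, V, W) \<in> QMor X" for U V W
  proof (cases "W = {None}")
    case True
    then show ?thesis using z[OF q] ob QMor_QOb[OF q] by (simp add: zmap_in)
  qed (use i[OF q] b in \<open>simp add: idt_in\<close>)
  have idt: "snd ?A (U, U, U) = idt C (fst ?A U)" if U: "U \<in> QOb X" for U
  proof -
    have q: "(U, U, U) \<in> QMor X" using U by (auto simp: QMor_iff QOb_def)
    show ?thesis
    proof (cases "U = {None}")
      case True
      then show ?thesis using z[OF q] o[OF U] by (simp add: zmap_zob)
    qed (use i[OF q] in simp)
  qed
  have cmp: "snd ?A (U, V', W \<inter> W') =
      cmp C (fst ?A U) (fst ?A V) (fst ?A V') (snd ?A (V, V', W')) (snd ?A (U, V, W))"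
    if q: "(U, V, W) \<in> QMor X" "(V, V', W') \<in> QMor X" for U V V' W W'
  proof -
    have q': "(U, V', W \<inter> W') \<in> QMor X" using q by (auto simp: QMor_iff)
    have O: "fst ?A U \<in> ob C" "fst ?A V \<in> ob C" "fst ?A V' \<in> ob C"
      using ob QMor_QOb[OF q(1)] QMor_QOb[OF q(2)] by auto
    have N: "None \<in> W" "None \<in> W'" using q by (auto simp: QMor_iff)
    consider "W = {None}" | "W' = {None}" | "W \<noteq> {None}" "W' \<noteq> {None}" by blast
    then show ?thesis
    proof cases
      case 1
      then have "W \<inter> W' = {None}" using N by auto
      then show ?thesis using z[OF q(1) 1] z[OF q'] cmp_zmap_right[OF O mor[OF q(2)]] by simp
    next
      case 2
      then have "W \<inter> W' = {None}" using N by auto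
      then show ?thesis using z[OF q(2) 2] z[OF q'] cmp_zmap_left[OF O mor[OF q(1)]] by simp
    next
      case 3
      then have "W \<inter> W' = X" "X \<noteq> {None}" using point_QMor q by auto
      then show ?thesis using i[OF q(1) 3(1)] i[OF q(2) 3(2)] i[OF q'] b
        by (simp add: cmp_idt_left idt_in)
    qed
  qed
  have prod: "is_product C (fst ?A U) (U - {None}) (\<lambda>u. fst ?A {u, None})
      (\<lambda>u. snd ?A (U, {u, None}, {u, None}))" if U: "U \<in> QOb X" for U
  proof (cases "U = {None}")
    case True
    then show ?thesis using o[OF U] zob_in zob_terminal by (simp add: is_product_def)
  next
    case False
    from point_QOb[OF U False] have UX: "U = X" "u \<noteq> None" by auto
    then have Uu: "U = {u, None}" "U - {None} = {u}" using X False by auto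
    have q: "(U, {u, None}, {u, None}) \<in> QMor X" using Uu UX by (simp add: QMor_iff)
    have "{u, None} \<noteq> {None}" using UX by auto
    note I = i[OF q this]
    have "\<exists>!k. k \<in> hom C z b \<and> cmp C z b b (idt C b) k = h" if "z \<in> ob C" "h \<in> hom C z b" for z h
      using that b cmp_idt_left by metis
    then show ?thesis unfolding is_product_def Uu(2) using I b by (simp add: idt_in)
  qed
  have "Qfunctor C X ?A"
    unfolding Qfunctor_def using ob mor idt cmp by (auto simp: PiE_def point_diag_def)
  then show ?thesis using prod o[OF N] by (simp add: sum_diagrams_def)
qed

lemma point_diag_dual:
  assumes b: "b \<in> ob C" "dob C b = b" and \<sigma>: "\<sigma> None = None" "\<And>v. v \<in> X \<Longrightarrow> \<sigma> v = v"
  shows "diag_dual C X \<sigma> (point_diag X b) = point_diag X b"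
proof -
  have \<sigma>U: "\<sigma> ` U = U" if "U \<subseteq> X" for U using \<sigma>(2) that by force
  have m: "(V, U, W) \<in> QMor X \<longleftrightarrow> (U, V, W) \<in> QMor X" for U V W by (auto simp: QMor_iff)
  show ?thesis
  proof (rule prod_eqI; rule ext)
    fix U show "fst (diag_dual C X \<sigma> (point_diag X b)) U = fst (point_diag X b) U"
    proof (cases "U \<in> QOb X")
      case True
      then have "\<sigma> ` U = U" using \<sigma>U by (simp add: QOb_def)
      then show ?thesis using True b by (simp add: diag_dual_simps point_diag_def dob_zob)
    qed (simp add: diag_dual_def point_diag_def)
  next
    fix w show "snd (diag_dual C X \<sigma> (point_diag X b)) w = snd (point_diag X b) w"
    proof (cases "w \<in> QMor X")
      case True
      then obtain U V W where w: "w = (U, V, W)" "(U, V, W) \<in> QMor X" by (cases w) auto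
      then have S: "\<sigma> ` U = U" "\<sigma> ` V = V" "\<sigma> ` W = W" using \<sigma>U by (auto simp: QMor_iff)
      have "dmor C (if V = {None} then zob C else b) (if U = {None} then zob C else b)
          (zmap (if V = {None} then zob C else b) (if U = {None} then zob C else b)) =
        zmap (if U = {None} then zob C else b) (if V = {None} then zob C else b)"
        using b zob_in by (simp add: dmor_zmap dob_zob)
      then show ?thesis
        using w m QMor_QOb[OF w(2)] b point_QMor[OF w(2)] dmor_idt[OF b(1)]
        by (auto simp: diag_dual_simps S point_diag_def)
    next
      case False
      then show ?thesis by (cases w) (simp add: diag_dual_def point_diag_def)
    qed
  qed
qed

end

end

definition const_simplex :: "('o, 'm) dcat \<Rightarrow> 'o \<Rightarrow> ('o, 'm) chain_simplex" where
  "const_simplex D a = (\<lambda>i\<in>{..0}. a, \<lambda>_\<in>le_pairs 0. idt D a)"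

lemma le_pairs_0: "le_pairs 0 = {(0, 0)}"
  by (auto simp: le_pairs_def)

lemma const_simplex_in:
  assumes "a \<in> ob D" "idt D a \<in> hom D a a" "cmp D a a a (idt D a) (idt D a) = idt D a"
  shows "const_simplex D a \<in> nerve D 0"
  using assms by (simp add: nerve_def const_simplex_def le_pairs_0)

lemma nerve_inv_const_simplex:
  assumes "dob D a = a" "dmor D a a (idt D a) = idt D a"
  shows "nerve_inv D 0 (const_simplex D a) = const_simplex D a"
  using assms by (auto simp: nerve_inv_def const_simplex_def le_pairs_0 fun_eq_iff)

lemma const_simplex_SD:
  assumes "additive_dual_cat (DP \<alpha> \<epsilon>) add" "A \<in> sum_diagrams (DP \<alpha> \<epsilon>) (circ m)"
  shows "const_simplex (SD \<alpha> \<epsilon> m) A \<in> nerve (SD \<alpha> \<epsilon> m) 0"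
    and "diag_dual (DP \<alpha> \<epsilon>) (circ m) (circ_inv m) A = A \<Longrightarrow>
      nerve_inv (SD \<alpha> \<epsilon> m) 0 (const_simplex (SD \<alpha> \<epsilon> m) A) = const_simplex (SD \<alpha> \<epsilon> m) A"
proof -
  interpret additive_dual_cat "DP \<alpha> \<epsilon>" add by (rule assms(1))
  note D = sum_diagramsD[OF assms(2)]
  let ?D = "diag_cat (DP \<alpha> \<epsilon>) (circ m) (circ_inv m)"
  have idt: "idt ?D A \<in> hom ?D A A" "cmp ?D A A A (idt ?D A) (idt ?D A) = idt ?D A"
  proof -
    have "(\<lambda>U\<in>QOb (circ m). idt (DP \<alpha> \<epsilon>) (fst A U)) \<in> diag_hom (DP \<alpha> \<epsilon>) (circ m) A A"
      unfolding diag_hom_def using D(1,2) QMor_QOb[where X = "circ m"]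
      by (auto simp del: DP_simps simp: idt_in cmp_idt_left cmp_idt_right)
    then show "idt ?D A \<in> hom ?D A A" by (simp add: diag_cat_def)
    show "cmp ?D A A A (idt ?D A) (idt ?D A) = idt ?D A"
      using D(1) by (auto simp del: DP_simps simp: diag_cat_def cmp_idt_left idt_in intro!: restrict_ext)
  qed
  have ob: "A \<in> ob ?D" using assms(2) by (simp add: diag_cat_def)
  show "const_simplex (SD \<alpha> \<epsilon> m) A \<in> nerve (SD \<alpha> \<epsilon> m) 0"
    using ob idt by (intro const_simplex_in) (auto simp: iso_cat_hom)
  show "nerve_inv (SD \<alpha> \<epsilon> m) 0 (const_simplex (SD \<alpha> \<epsilon> m) A) = const_simplex (SD \<alpha> \<epsilon> m) A"
    if "diag_dual (DP \<alpha> \<epsilon>) (circ m) (circ_inv m) A = A"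
  proof (rule nerve_inv_const_simplex)
    have d: "dob ?D A = A" using that by (simp add: diag_cat_def)
    then show "dob (SD \<alpha> \<epsilon> m) A = A" by simp
    show "dmor (SD \<alpha> \<epsilon> m) A A (idt (SD \<alpha> \<epsilon> m) A) = idt (SD \<alpha> \<epsilon> m) A"
      using strict_dual_cat.dmor_idt[OF strict_dual_diag_cat[OF pointed_involution_circ] ob] d by simp
  qed
qed

section \<open>The base loop and the loop of the unit form\<close>

lemma circ_0: "circ 0 = {None}"
proof -
  have "Some \<xi> \<notin> circ 0" for \<xi> by (auto simp: Some_in_circ_iff)
  then show ?thesis using None_in_circ[of 0] by (auto simp: set_eq_iff) (metis not_Some_eq)
qed

definition gen1 :: "nat \<Rightarrow> nat" where
  "gen1 = (\<lambda>i\<in>{..1}. i)"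

lemma circ_1: "circ 1 = {None, Some gen1}"
proof -
  have "Some \<xi> \<in> circ 1 \<longleftrightarrow> \<xi> = gen1" for \<xi>
  proof
    assume "Some \<xi> \<in> circ 1"
    then have \<xi>: "\<xi> 0 \<le> \<xi> 1" "\<xi> 1 \<le> 1" "\<xi> \<in> extensional {..1}" "\<not> (\<exists>c. \<forall>i\<le>1. \<xi> i = c)"
      by (auto simp: Some_in_circ_iff Delta1_iff)
    have "\<xi> 0 \<noteq> \<xi> 1"
    proof
      assume "\<xi> 0 = \<xi> 1"
      then have "\<forall>i\<le>1. \<xi> i = \<xi> 0" by (auto simp: le_Suc_eq)
      then show False using \<xi>(4) by blast
    qed
    then have "\<xi> 0 = 0" "\<xi> 1 = 1" using \<xi>(1,2) by linarith+
    then show "\<xi> = gen1"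
      using \<xi>(3) by (intro extensionalityI[of _ "{..1}"]) (auto simp: gen1_def le_Suc_eq)
  next
    assume "\<xi> = gen1"
    moreover have "\<not> (\<exists>c. \<forall>i\<le>1. gen1 i = c)"
    proof
      assume "\<exists>c. \<forall>i\<le>1. gen1 i = c"
      then obtain c where "\<And>i. i \<le> 1 \<Longrightarrow> gen1 i = c" by blast
      from this[of 0] this[of 1] show False by (simp add: gen1_def)
    qed
    ultimately show "Some \<xi> \<in> circ 1" by (auto simp: Some_in_circ_iff Delta1_iff gen1_def)
  qed
  then show ?thesis using None_in_circ[of 1] by (auto simp: set_eq_iff) (metis not_Some_eq)+
qed

text \<open>An involution of a two-point set that fixes the base point fixes the other point
  too.\<close>

lemma circ_inv_circ_1: "v \<in> circ 1 \<Longrightarrow> circ_inv 1 v = v"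
  using circ_inv_in[of v 1] circ_inv_inv[of v 1] unfolding circ_1 by auto

section \<open>The form \<langle>1\<rangle> as a self-dual object, and its one-point
  diagrams\<close>

lemma right_module_free: "right_module (free_rmod n :: (nat \<Rightarrow> 'r::comm_ring_1, 'r) rmod)"
proof -
  have "comm_group (free_rmod n :: (nat \<Rightarrow> 'r, 'r) rmod)"
  proof (rule comm_groupI)
    fix x assume "x \<in> carrier (free_rmod n :: (nat \<Rightarrow> 'r, 'r) rmod)"
    then show "\<exists>y \<in> carrier (free_rmod n). y \<otimes>\<^bsub>free_rmod n\<^esub> x = \<one>\<^bsub>free_rmod n\<^esub>"
      by (intro bexI[of _ "\<lambda>i. - x i"]) auto
  qed (auto simp: add_ac)
  then show ?thesis by (simp add: right_module_def algebra_simps)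
qed

lemma fg_projective_free: "fg_projective (free_rmod n :: (nat \<Rightarrow> 'r::comm_ring_1, 'r) rmod)"
proof -
  let ?F = "free_rmod n :: (nat \<Rightarrow> 'r, 'r) rmod"
  let ?i = "\<lambda>x\<in>carrier ?F. x"
  have "?i \<in> rhom ?F ?F" by (rule rhom_id[OF right_module_free])
  moreover have "\<forall>x\<in>carrier ?F. ?i (?i x) = x" by simp
  ultimately show ?thesis unfolding fg_projective_def using right_module_free by blast
qed

definition unit_form :: "int dpob" where
  "unit_form = (free_rmod 1, free_rmod 1,
     \<lambda>w\<in>carrier (free_rmod 1). \<lambda>x\<in>carrier (free_rmod 1). w 0 * x 0)"

lemma unit_form_in: "unit_form \<in> DP_ob id"
proof -
  let ?F = "free_rmod 1 :: (nat \<Rightarrow> int, int) rmod"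
  let ?f = "\<lambda>w\<in>carrier ?F. \<lambda>x\<in>carrier ?F. w 0 * x 0"
  have h: "(\<lambda>x\<in>carrier ?F. w 0 * x 0) \<in> rhom ?F regular_rmod" for w :: "nat \<Rightarrow> int"
    by (rule rhomI) (auto simp: algebra_simps)
  have f: "?f \<in> rhom ?F (dual_rmod id ?F)"
    using h by (intro rhomI) (auto simp: fun_eq_iff algebra_simps)
  have "bij_betw ?f (carrier ?F) (rhom ?F regular_rmod)"
    unfolding bij_betw_def
  proof (intro conjI equalityI subsetI)
    show "inj_on ?f (carrier ?F)"
    proof (rule inj_onI)
      fix v w assume v: "v \<in> carrier ?F" and w: "w \<in> carrier ?F" and eq: "?f v = ?f w"
      have "?f v (\<lambda>i. if i = 0 then 1 else 0) = ?f w (\<lambda>i. if i = 0 then 1 else 0)"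
        using eq by simp
      then have "v 0 = w 0" using v w by simp
      moreover have "v i = w i" if "i \<noteq> 0" for i using v w that by simp
      ultimately show "v = w" by (metis ext)
    qed
    show "g \<in> rhom ?F regular_rmod" if "g \<in> ?f ` carrier ?F" for g
      using that h by auto
    fix L assume L: "L \<in> rhom ?F regular_rmod"
    \<comment> \<open>A functional on the free module of rank one is multiplication by its value on
      the basis vector.\<close>
    let ?w = "\<lambda>i::nat. if i = 0 then L (\<lambda>i. if i = 0 then 1 else 0) else 0"
    have "?f ?w = L"
    proof (rule extensionalityI[of _ "carrier ?F"])
      show "?f ?w v = L v" if "v \<in> carrier ?F" for v
        using free_rmod_expand[OF L, of v] that by simp
    qed (use rhomD(1)[OF L] in simp_all)
    then show "L \<in> ?f ` carrier ?F" by (intro image_eqI[of _ _ ?w]) simp_all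
  qed
  then show ?thesis using f fg_projective_free[of 1, where 'r = int]
    by (simp add: unit_form_def DP_ob_def)
qed

lemma unit_form_self_dual: "DP_dual id 1 unit_form = unit_form"
  unfolding DP_dual_eq[OF unit_form_in] by (auto simp: unit_form_def fun_eq_iff)

interpretation DPZ: additive_dual_cat "DP (id :: int \<Rightarrow> int) 1" DP_add
  by (rule additive_dual_cat_DP)

definition unit_diag :: "nat \<Rightarrow> (nat \<Rightarrow> nat, int dpob, int dpmor) diag" where
  "unit_diag m = DPZ.point_diag (circ m) unit_form"

definition unit_simplex :: "nat \<Rightarrow> int sd_simplex" where
  "unit_simplex m = const_simplex (SD id 1 m) (unit_diag m)"

lemma circ_subset: "m \<le> 1 \<Longrightarrow> circ m \<subseteq> {None, Some gen1}"
  using circ_0 circ_1 by (cases m) auto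

lemma unit_diag_in: "m \<le> 1 \<Longrightarrow> unit_diag m \<in> sum_diagrams (DP id 1) (circ m)"
  unfolding unit_diag_def using unit_form_in
  by (intro DPZ.point_diag_in[OF None_in_circ circ_subset]) simp_all

lemma unit_diag_dual:
  assumes "m \<le> 1"
  shows "diag_dual (DP id 1) (circ m) (circ_inv m) (unit_diag m) = unit_diag m"
proof -
  have "circ_inv m v = v" if "v \<in> circ m" for v
    using that assms circ_0 circ_inv_circ_1 by (cases m) auto
  then show ?thesis
    unfolding unit_diag_def using unit_form_in unit_form_self_dual
    by (intro DPZ.point_diag_dual[OF None_in_circ circ_subset[OF assms]]) simp_all
qed

lemma unit_simplex_in: "m \<le> 1 \<Longrightarrow> unit_simplex m \<in> bs_set NiZ m 0"
  using const_simplex_SD(1)[OF additive_dual_cat_DP unit_diag_in] by (simp add: NiA_def unit_simplex_def)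

lemma unit_simplex_self_dual: "m \<le> 1 \<Longrightarrow> bs_inv NiZ m 0 (unit_simplex m) = unit_simplex m"
  using const_simplex_SD(2)[OF additive_dual_cat_DP unit_diag_in unit_diag_dual]
  by (simp add: NiA_def unit_simplex_def)

lemma QOb_point: "QOb {None} = {{None}}"
  by (auto simp: QOb_def)

lemma QMor_point: "QMor {None} = {({None}, {None}, {None})}"
  by (auto simp: QMor_def QOb_point)

lemma unit_diag_0: "unit_diag 0 = zob (diag_cat (DP id 1) (circ 0) (circ_inv 0))"
  unfolding unit_diag_def diag_cat_def DPZ.point_diag_def circ_0 QOb_point QMor_point
  by (auto simp: DPZ.zmap_zob simp del: DP_simps)

lemma base_eq: "bs_base NiZ = unit_simplex 0"
  by (simp add: NiA_def unit_simplex_def const_simplex_def unit_diag_0)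

lemma diag_push_point:
  assumes "A \<in> sum_diagrams C X" "None \<in> X"
  shows "diag_push f X {None} A = (\<lambda>U\<in>QOb {None}. zob C, \<lambda>_\<in>QMor {None}. idt C (zob C))"
proof -
  have "pinv f X {None} = {None}" by (simp add: pinv_def)
  moreover have "{None} \<in> QOb X" using assms(2) by (simp add: QOb_def)
  ultimately show ?thesis
    using sum_diagramsD(3,7)[OF assms(1)]
    unfolding diag_push_def QOb_point QMor_point by (auto simp: fun_eq_iff)
qed

text \<open>Both faces at once, for arbitrary \<theta>: a sum-diagram pushed to the one-point set
  retains just its value at {None}, which is zero.\<close>

lemma unit_simplex_face:
  "bs_op NiZ 1 0 0 0 \<theta> (\<lambda>i. i) (unit_simplex 1) = bs_base NiZ"
proof -
  have push: "diag_push (circ_op 0 \<theta>) (circ 1) (circ 0) (unit_diag 1) = unit_diag 0"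
    unfolding unit_diag_0 using diag_push_point[OF unit_diag_in[OF order_refl] None_in_circ]
    by (simp add: diag_cat_def circ_0)
  have "pinv (circ_op 0 \<theta>) (circ 1) {None} = {None}" by (simp add: pinv_def)
  moreover have "{None} \<in> QOb (circ 1)" by (simp add: QOb_def None_in_circ)
  moreover have "fst (unit_diag 0) {None} = fst (unit_diag 1) {None}"
    using sum_diagramsD(7)[OF unit_diag_in] by simp
  ultimately have "diag_push_mor (circ_op 0 \<theta>) (circ 1) (circ 0) (idt (SD id 1 1) (unit_diag 1)) =
      idt (SD id 1 0) (unit_diag 0)"
    by (auto simp: diag_push_mor_def diag_cat_def circ_0 QOb_point fun_eq_iff simp del: DP_simps)
  then show ?thesis
    unfolding base_eq by (auto simp: NiA_def nerve_map_def nerve_op_def unit_simplex_def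
        const_simplex_def le_pairs_0 push fun_eq_iff
        simp del: iso_cat_simps One_nat_def)
qed

section \<open>The two loops and the parities of their midpoints\<close>

definition vertex :: "nat \<Rightarrow> real" where
  "vertex = (\<lambda>i. if i = 0 then 1 else 0)"

definition edge :: "real \<Rightarrow> nat \<Rightarrow> real" where
  "edge u = (\<lambda>i. if i = 0 then 1 - u else if i = 1 then u else 0)"

lemma vertex_in: "vertex \<in> standard_simplex 0"
  by (simp add: vertex_def standard_simplex_0)

lemma edge_in: "u \<in> {0..1} \<Longrightarrow> edge u \<in> standard_simplex 1"
  by (rule standard_simplexI) (auto simp: edge_def)

lemma vertex_rev: "simplex_rev 0 vertex = vertex"
  by (auto simp: simplex_rev_def vertex_def)

lemma edge_rev: "simplex_rev 1 (edge u) = edge (1 - u)"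
  by (auto simp: simplex_rev_def edge_def fun_eq_iff le_Suc_eq)

text \<open>The edge labelled with the unit form is traversed in the circle direction, while the
  nerve direction stays in degree 0.\<close>

definition unit_point :: "real \<Rightarrow> int sd_point" where
  "unit_point u = ((1, 0, unit_simplex 1), edge u, vertex)"

definition base_point :: "int sd_point" where
  "base_point = ((0, 0, unit_simplex 0), vertex, vertex)"

lemma bs_real_base_eq: "bs_real_base NiZ = bs_eqv NiZ `` {base_point}"
  by (simp add: bs_real_base_def base_point_def base_eq vertex_def)

lemma unit_point_in: "u \<in> {0..1} \<Longrightarrow> unit_point u \<in> topspace (bs_total NiZ)"
  using unit_simplex_in[of 1] edge_in vertex_in by (simp add: unit_point_def topspace_bs_total)

lemma base_point_in: "base_point \<in> topspace (bs_total NiZ)"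
  using unit_simplex_in[of 0] vertex_in by (simp add: base_point_def topspace_bs_total)

text \<open>The constant operator with value c, from [0] to [1], sends the vertex to the end c of
  the edge and takes the simplex to the base simplex, so one gluing identifies the two points. A
  natural number c treats both ends together.\<close>

lemma unit_point_end:
  assumes "c \<le> 1"
  shows "(base_point, unit_point (real c)) \<in> bs_eqv NiZ"
proof -
  have ops: "(\<lambda>i. c) \<in> sop 0 1" "(\<lambda>i. i) \<in> sop 0 0" using assms by (auto simp: sop_def mono_on_def)
  have S: "{i. i \<le> 0 \<and> P i} = (if P 0 then {0} else {})" for P :: "nat \<Rightarrow> bool" by auto
  have "simplex_push 0 (\<lambda>i. c) vertex = edge (real c)"
    using assms by (auto simp: simplex_push_def S edge_def vertex_def fun_eq_iff le_Suc_eq)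
  moreover have "simplex_push 0 (\<lambda>i. i) vertex = vertex"
    by (auto simp: simplex_push_def S vertex_def fun_eq_iff)
  ultimately show ?thesis
    using bs_glue_eqv[OF bs_glueI[OF unit_simplex_in[OF order_refl] ops vertex_in vertex_in]]
    by (simp add: unit_simplex_face base_eq base_point_def unit_point_def del: One_nat_def)
qed

definition unit_loop :: "real \<Rightarrow> int sd_point set" where
  "unit_loop = (\<lambda>u\<in>{0..1}. bs_eqv NiZ `` {unit_point u})"

definition base_loop :: "real \<Rightarrow> int sd_point set" where
  "base_loop = (\<lambda>u\<in>{0..1}. bs_real_base NiZ)"

lemma continuous_map_edge:
  "continuous_map (top_of_set {0..1}) (prod_topology (simplex_top 1) (simplex_top 0)) (\<lambda>u. (edge u, vertex))"
proof -
  have "continuous_map (top_of_set {0..1}) euclideanreal (\<lambda>u. edge u i)" for i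
  proof -
    consider "i = 0" | "i = 1" | "1 < i" by linarith
    then show ?thesis by cases (auto simp: edge_def intro!: continuous_intros)
  qed
  then have "continuous_map (top_of_set {0..1}) (powertop_real UNIV) edge"
    by (simp add: continuous_map_componentwise_UNIV)
  then have "continuous_map (top_of_set {0..1}) (simplex_top 1) edge"
    unfolding simplex_top_def using edge_in by (auto simp: continuous_map_in_subtopology)
  moreover have "continuous_map (top_of_set {0..1}) (simplex_top 0) (\<lambda>u. vertex)"
    using vertex_in by simp
  ultimately show ?thesis by (rule continuous_map_pairedI)
qed

text \<open>Reversing the coordinate of the edge replaces u by 1 - u and thereby undoes the reversal
  of the loop parameter; the label stays the same because its simplex is self-dual.\<close>

lemma unit_loop_in: "unit_loop \<in> topspace (K11 id 1)"
proof -
  have "continuous_map (top_of_set {0..1}) (bs_real NiZ) (\<lambda>u. bs_eqv NiZ `` {unit_point u})"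
    unfolding unit_point_def by (rule continuous_map_bs_cell[OF unit_simplex_in[OF order_refl] continuous_map_edge])
  then have "continuous_map (top_of_set {0..1}) (bs_real NiZ) unit_loop"
    by (rule continuous_map_eq) (simp add: unit_loop_def)
  moreover have "unit_loop 0 = bs_real_base NiZ" "unit_loop 1 = bs_real_base NiZ"
    using unit_point_end[of 0] unit_point_end[of 1]
    by (simp_all add: unit_loop_def bs_real_base_eq bs_eqv_class_eq bs_eqv_sym)
  moreover have "loop_conj NiZ unit_loop = unit_loop"
  proof
    fix u
    show "loop_conj NiZ unit_loop u = unit_loop u"
    proof (cases "u \<in> {0..1}")
      case True
      then have "1 - u \<in> {0..1}" by simp
      from dual_bisset.bs_real_inv_class[OF dual_bisset_int unit_point_in[OF this]] True
      show ?thesis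
        by (simp add: loop_conj_def unit_loop_def unit_point_def pt_rev_def
            unit_simplex_self_dual[OF order_refl, unfolded One_nat_def]
            edge_rev[unfolded One_nat_def] vertex_rev)
    qed (auto simp: loop_conj_def unit_loop_def)
  qed
  ultimately show ?thesis
    by (simp add: K11_def topspace_loop_fix_top loops_def, simp add: unit_loop_def)
qed

lemma base_loop_in: "base_loop \<in> topspace (K11 id 1)"
proof -
  have inv: "bs_real_inv NiZ (bs_real_base NiZ) = bs_real_base NiZ"
    unfolding bs_real_base_eq dual_bisset.bs_real_inv_class[OF dual_bisset_int base_point_in]
    by (simp add: base_point_def pt_rev_def unit_simplex_self_dual vertex_rev)
  have "bs_real_base NiZ \<in> topspace (bs_real NiZ)"
    unfolding bs_real_base_eq topspace_bs_real by (rule quotientI[OF base_point_in])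
  then have "continuous_map (top_of_set {0..1}) (bs_real NiZ) (\<lambda>u. bs_real_base NiZ)" by simp
  then have "continuous_map (top_of_set {0..1}) (bs_real NiZ) base_loop"
    by (rule continuous_map_eq) (simp add: base_loop_def)
  moreover have "loop_conj NiZ base_loop = base_loop"
    by (auto simp: loop_conj_def base_loop_def inv fun_eq_iff)
  ultimately show ?thesis
    by (simp add: K11_def topspace_loop_fix_top loops_def, simp add: base_loop_def)
qed

lemma ix_0: "ix b 0 t \<delta> = 0" if "t \<in> standard_simplex 0" "\<delta> < 1/2"
  using ix_le[OF that, of b] by simp

text \<open>The generator of the circle sits at location u along the loop, so at the midpoint
  \<open>band 0\<close> captures the whole diagram. The form found there takes the value 1 on the
  basis vector.\<close>

lemma unit_loop_odd: "unit_loop (1/2) \<in> parity_set True"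
proof -
  let ?p = "unit_point (1/2)"
  have y: "unit_loop (1/2) = bs_eqv NiZ `` {?p}" by (simp add: unit_loop_def)
  have "{i. i \<le> 1 \<and> gen1 i = 1} = {1}" by (auto simp: gen1_def)
  then have "loc 1 (edge (1/2)) gen1 = 1/2" unfolding loc_def by (simp add: edge_def)
  then have mid: "mid 1 (edge (1/2)) (band 0) = circ 1" by (auto simp: mid_def circ_1 band_def simp del: One_nat_def)
  have ob: "fst (unit_diag 1) (circ 1) = unit_form"
    using None_in_circ[of 1] circ_1 by (auto simp: unit_diag_def DPZ.point_diag_def QOb_def)
  have "circ 1 \<in> QOb (circ 1)" using None_in_circ by (simp add: QOb_def)
  then have "idt (SD id 1 1) (unit_diag 1) (circ 1) = idt (DP id 1) unit_form"
    using ob by (simp add: diag_cat_def)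
  then have "samp_ob ?p False 0 (band 0) = unit_form"
    "samp_tr ?p False 0 True 0 (band 0) = idt (DP id 1) unit_form"
    using ob mid ix_0[OF vertex_in]
    by (simp_all add: unit_point_def samp_ob_def samp_tr_def unit_simplex_def const_simplex_def le_pairs_0
        del: iso_cat_simps DP_simps)
  moreover have "odd_form unit_form (idt (DP id 1) unit_form)"
    unfolding odd_form_def
    by (rule bexI[of _ "\<lambda>i. if i = 0 then 1 else 0"]) (simp_all add: unit_form_def)
  ultimately have "odd_at ?p 0 0" by (simp add: odd_at_def)
  then show ?thesis
    using parity_set_fixed[of "unit_loop (1/2)" ?p True] midpoint_fixed[OF unit_loop_in[unfolded K11_def]]
      unit_point_in[of "1/2"] bs_eqv_refl[of ?p NiZ] by (simp add: y)
qed

text \<open>The sample is the zero module, where the form has no value but 0.\<close>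

lemma base_loop_even: "base_loop (1/2) \<notin> parity_set True"
proof -
  have y: "base_loop (1/2) = bs_eqv NiZ `` {base_point}" by (simp add: base_loop_def bs_real_base_eq)
  have mid: "mid 0 vertex (band 0) = {None}" by (auto simp: mid_def circ_0)
  have ob: "fst (unit_diag 0) {None} = zob (DP id 1)" using sum_diagramsD(7)[OF unit_diag_in] by simp
  have "{None} \<in> QOb (circ 0)" by (simp add: circ_0 QOb_point)
  then have "idt (SD id 1 0) (unit_diag 0) {None} = idt (DP id 1) (zob (DP id 1))"
    using ob by (simp add: diag_cat_def)
  then have "samp_ob base_point False 0 (band 0) = zob (DP id 1)"
    "samp_tr base_point False 0 True 0 (band 0) = idt (DP id 1) (zob (DP id 1))"
    using ob mid ix_0[OF vertex_in]
    by (simp_all add: base_point_def samp_ob_def samp_tr_def unit_simplex_def const_simplex_def le_pairs_0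
        del: iso_cat_simps DP_simps)
  moreover have "\<not> odd_form (zob (DP id 1)) (idt (DP id 1) (zob (DP id 1)))"
    by (simp add: odd_form_def zob_DP)
  ultimately have "\<not> odd_at base_point 0 0" by (simp add: odd_at_def)
  then show ?thesis
    using parity_set_fixed[of "base_loop (1/2)" base_point True] midpoint_fixed[OF base_loop_in[unfolded K11_def]]
      base_point_in bs_eqv_refl[of base_point NiZ] by (simp add: y)
qed

section \<open>Parity and direct sums\<close>

lemma ffst_fpair [simp]: "ffst (fpair v w) = v"
  by (simp add: ffst_def fpair_def)

lemma fsnd_fpair [simp]: "fsnd (fpair v w) = w"
  by (simp add: fsnd_def fpair_def)

lemma DP_sum_simps:
  "fst (DP_sum a b) = sum_rmod (fst a) (fst b)"
  "snd (snd (DP_sum a b)) = (\<lambda>w\<in>carrier (sum_rmod (dmod a) (dmod b)).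
    \<lambda>z\<in>carrier (sum_rmod (fst a) (fst b)).
      pair a (ffst w) (ffst z) + pair b (fsnd w) (fsnd z))"
  by (cases a; cases b; simp add: DP_sum_def)+

lemma DP_msum_fst:
  "fst (msum (DP \<alpha> \<epsilon>) a b c d f g) = sum_rhom (fst a) (fst c) (fst f) (fst g)"
  by (simp add: DP_def case_prod_beta)

lemma carrier_sum_rmod: "z \<in> carrier (sum_rmod P Q) \<longleftrightarrow> ffst z \<in> carrier P \<and> fsnd z \<in> carrier Q"
  by (simp add: sum_rmod_def)

lemma odd_form_sum:
  assumes a: "a \<in> DP_ob id" "\<phi> \<in> DP_hom id a (DP_dual id 1 a)"
    and b: "b \<in> DP_ob id" "\<psi> \<in> DP_hom id b (DP_dual id 1 b)"
    and odd: "odd_form a \<phi>" and \<omega>: "fst \<omega> = sum_rhom (fst a) (fst b) (fst \<phi>) (fst \<psi>)"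
  shows "odd_form (DP_sum a b) \<omega>"
proof -
  obtain z where z: "z \<in> car a" "odd (pair a (fst \<phi> z) z)"
    using odd by (auto simp: odd_form_def)
  \<comment> \<open>The zero vector of b in multiplicative notation. Pairing it with an odd vector z
    of a gives a vector of the sum on which the form takes the same value as on z.\<close>
  let ?one = "\<one>\<^bsub>fst b\<^esub>"
  have one: "?one \<in> car b" using right_moduleD(1)[OF DP_obD(1)[OF b(1)]] by simp
  have \<phi>z: "fst \<phi> z \<in> dcar a"
    using rhomD(2)[OF DP_hom_rhom(1)[OF a(1) DP_dual_in[OF a(1)] a(2)] z(1)] by (simp add: DP_dual_eq[OF a(1)])
  have \<psi>1: "fst \<psi> ?one \<in> dcar b"
    using rhomD(2)[OF DP_hom_rhom(1)[OF b(1) DP_dual_in[OF b(1)] b(2)] one] by (simp add: DP_dual_eq[OF b(1)])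
  have "pair b (fst \<psi> ?one) ?one = 0"
    using DP_obD(4)[OF b(1) \<psi>1 one one] right_moduleD(1)[OF DP_obD(1)[OF b(1)]] one by simp
  then show ?thesis
    unfolding odd_form_def using z one \<phi>z \<psi>1
    by (intro bexI[of _ "fpair z ?one"]) (simp_all add: DP_sum_simps \<omega> sum_rhom_def carrier_sum_rmod)
qed

text \<open>The sampled subset and indices depend on s and t alone, which both points share. As sums
  are formed objectwise, the sample of the sum is the sum of the samples on the nose.\<close>

lemma odd_at_sum:
  assumes p: "p = ((m, n, x), s, t)" "p \<in> topspace (bs_total NiZ)" "(p, pt_rev NiZ p) \<in> bs_eqv NiZ"
    and q: "q = ((m, n, y), s, t)" "q \<in> topspace (bs_total NiZ)" "(q, pt_rev NiZ q) \<in> bs_eqv NiZ"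
    and odd: "odd_at p 0 0"
  shows "odd_at ((m, n, NiA_sum id 1 m n (x, y)), s, t) 0 0"
proof -
  let ?r = "((m, n, NiA_sum id 1 m n (x, y)), s, t)"
  have t: "t \<in> standard_simplex n" using p by (simp add: topspace_bs_total)
  have half: "(0::real) < 1/2" by simp
  have ix: "ix c n t 0 \<le> n" for c using ix_le[OF t half] .
  have le: "(ix False n t 0, ix True n t 0) \<in> le_pairs n"
    using ix_mono[OF t half half, of False True] ix by (simp add: prec_def le_pairs_def)
  have "samp_ob ?r False 0 (band 0) = DP_sum (samp_ob p False 0 (band 0)) (samp_ob q False 0 (band 0))"
    using ix by (simp add: samp_ob_def NiA_sum_def nerve_sum_def p(1) q(1) diag_cat_def diag_sum_def mid_in_QOb)
  moreover have "fst (samp_tr ?r False 0 True 0 (band 0)) =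
      sum_rhom (fst (samp_ob p False 0 (band 0))) (fst (samp_ob q False 0 (band 0)))
        (fst (samp_tr p False 0 True 0 (band 0))) (fst (samp_tr q False 0 True 0 (band 0)))"
    using le by (simp add: samp_ob_def samp_tr_def NiA_sum_def nerve_sum_def p(1) q(1) diag_cat_def
        mid_in_QOb DP_msum_fst)
  ultimately show ?thesis
    using odd_form_sum[OF samp_ob_in[OF p half] fixed_form(1)[OF p half order_refl half]
        samp_ob_in[OF q half] fixed_form(1)[OF q half order_refl half] odd[unfolded odd_at_def]]
    unfolding odd_at_def by simp
qed

text \<open>The loop in the realization of the product supplies, at its midpoint, representatives of
  both projections in the same bidegree with the same coordinates. This is the situation of
  \<open>odd_at_sum\<close>.\<close>

lemma loop_sum_odd:
  assumes \<zeta>: "\<zeta> \<in> topspace (loop_fix_top (bs_prod NiZ NiZ))"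
    and L: "(\<lambda>t\<in>{0..1}. bs_real_map NiZ (\<lambda>_ _. fst) (\<zeta> t)) \<in> topspace (K11 id 1)"
      "(\<lambda>t\<in>{0..1}. bs_real_map NiZ (\<lambda>_ _. fst) (\<zeta> t)) (1/2) \<in> parity_set True"
    and R: "(\<lambda>t\<in>{0..1}. bs_real_map NiZ (\<lambda>_ _. snd) (\<zeta> t)) \<in> topspace (K11 id 1)"
    and S: "(\<lambda>t\<in>{0..1}. bs_real_map NiZ (NiA_sum id 1) (\<zeta> t)) \<in> topspace (K11 id 1)"
  shows "(\<lambda>t\<in>{0..1}. bs_real_map NiZ (NiA_sum id 1) (\<zeta> t)) (1/2) \<in> parity_set True"
proof -
  let ?y = "\<zeta> (1/2)"
  obtain p where p: "p \<in> topspace (bs_total (bs_prod NiZ NiZ))" "?y = bs_eqv (bs_prod NiZ NiZ) `` {p}"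
    using bs_real_point[OF midpoint_fixed(1)[OF \<zeta>]] .
  obtain m n x y s t where p_eq: "p = ((m, n, (x, y)), s, t)" by (metis surj_pair)
  have x: "x \<in> bs_set NiZ m n" "y \<in> bs_set NiZ m n" "s \<in> standard_simplex m" "t \<in> standard_simplex n"
    using p(1) by (simp_all add: p_eq topspace_bs_total bs_prod_def)
  have py: "((m, n, (x, y)), s, t) \<in> ?y" using p(2) by (simp add: p_eq bs_eqv_refl)
  have map: "((m, n, F m n (x, y)), s, t) \<in> bs_real_map NiZ F ?y" for F
    unfolding bs_real_map_def
    by (rule ImageI[OF bs_eqv_refl], rule image_eqI[OF _ py]) simp
  let ?p = "((m, n, x), s, t)" and ?q = "((m, n, y), s, t)" and ?r = "((m, n, NiA_sum id 1 m n (x, y)), s, t)"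
  have pq: "?p \<in> topspace (bs_total NiZ)" "?q \<in> topspace (bs_total NiZ)"
    using x by (simp_all add: topspace_bs_total)
  note FL = midpoint_fixed[OF L(1)[unfolded K11_def]] and FR = midpoint_fixed[OF R[unfolded K11_def]]
    and FS = midpoint_fixed[OF S[unfolded K11_def]]
  have half: "(1/2::real) \<in> {0..1}" by simp
  have pL: "?p \<in> (\<lambda>t\<in>{0..1}. bs_real_map NiZ (\<lambda>_ _. fst) (\<zeta> t)) (1/2)"
    using map[of "\<lambda>_ _. fst"] half by simp
  have pR: "?q \<in> (\<lambda>t\<in>{0..1}. bs_real_map NiZ (\<lambda>_ _. snd) (\<zeta> t)) (1/2)"
    using map[of "\<lambda>_ _. snd"] half by simp
  have pS: "?r \<in> (\<lambda>t\<in>{0..1}. bs_real_map NiZ (NiA_sum id 1) (\<zeta> t)) (1/2)"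
    using map[of "NiA_sum id 1"] half by simp
  have "odd_at ?p 0 0" using parity_set_fixed[OF FL pL pq(1), of True] L(2) by simp
  then have r: "odd_at ?r 0 0"
    using odd_at_sum[OF refl pq(1) fixed_class[OF FL pL pq(1)] refl pq(2) fixed_class[OF FR pR pq(2)]] by simp
  \<comment> \<open>The sum simplex in ?r has not been shown to lie in the nerve, whereas
    \<open>parity_set_fixed\<close> asks for a representative in the total space. Such a q exists
    because the sum loop has its values in the realization, and sampling invariance carries the
    parity from ?r to q.\<close>
  obtain q where q: "q \<in> topspace (bs_total NiZ)"
    "(\<lambda>t\<in>{0..1}. bs_real_map NiZ (NiA_sum id 1) (\<zeta> t)) (1/2) = bs_eqv NiZ `` {q}"
    using bs_real_point[OF FS(1)] .
  have qr: "(q, ?r) \<in> bs_eqv NiZ" using pS unfolding q(2) by simp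
  have z: "(0::real) < 1/2" by simp
  have "prec False 0 True 0" by (simp add: prec_def)
  then have "odd_at q 0 0"
    using samp_eqv(1,3)[OF qr order_refl z band_subset[OF z]] r by (simp add: odd_at_def)
  moreover have "q \<in> (\<lambda>t\<in>{0..1}. bs_real_map NiZ (NiA_sum id 1) (\<zeta> t)) (1/2)"
    unfolding q(2) by (simp add: bs_eqv_refl)
  ultimately show ?thesis using parity_set_fixed[OF FS _ q(1), of True] by simp
qed

text \<open>The second claim locates the failure in the inverses, not in the monoid laws, and it
  implies the first. The class without inverse is that of the loop of the unit form; an inverse
  would in particular be a right inverse, which matches \<open>odd_at_sum\<close> with its odd left
  summand.\<close>

theorem proposition5p15:
  shows "\<not> group (K11_zero (id :: int \<Rightarrow> int) 1) \<and>
    \<not> carrier (K11_zero (id :: int \<Rightarrow> int) 1) \<subseteq> Units (K11_zero (id :: int \<Rightarrow> int) 1)"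
proof -
  let ?G = "K11_zero (id :: int \<Rightarrow> int) 1"
  have "\<not> carrier ?G \<subseteq> Units ?G"
  proof
    assume "carrier ?G \<subseteq> Units ?G"
    moreover have "path_component_of_set (K11 id 1) unit_loop \<in> carrier ?G"
      using unit_loop_in by (simp add: K11_zero_def path_component_in_path_components_of)
    ultimately obtain b where b: "b \<in> carrier ?G"
      "path_component_of_set (K11 id 1) unit_loop \<otimes>\<^bsub>?G\<^esub> b = \<one>\<^bsub>?G\<^esub>"
      unfolding Units_def by blast
    have "base_loop \<in> \<one>\<^bsub>?G\<^esub>"
      using base_loop_in by (simp add: K11_zero_def base_loop_def[symmetric] path_component_of_refl)
    then have "base_loop \<in> path_component_of_set (K11 id 1) unit_loop \<otimes>\<^bsub>?G\<^esub> b"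
      by (simp only: b(2))
    \<comment> \<open>Products are unions of components, so membership of the base loop yields a
      loop in the product whose first projection is connected to the unit loop and whose sum is
      connected to the base loop. Parity is carried from the unit loop to that projection, then to
      the sum, then to the base loop.\<close>
    then obtain \<zeta> where \<zeta>: "\<zeta> \<in> topspace (loop_fix_top (bs_prod NiZ NiZ))"
      and l: "path_component_of (K11 id 1) unit_loop (\<lambda>t\<in>{0..1}. bs_real_map NiZ (\<lambda>_ _. fst) (\<zeta> t))"
        (is "path_component_of _ _ ?l")
      and r: "(\<lambda>t\<in>{0..1}. bs_real_map NiZ (\<lambda>_ _. snd) (\<zeta> t)) \<in> b" (is "?r \<in> _")
      and s: "path_component_of (K11 id 1)
        (\<lambda>t\<in>{0..1}. bs_real_map NiZ (NiA_sum id 1) (\<zeta> t)) base_loop" (is "path_component_of _ ?s _")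
      by (auto simp: K11_zero_def)
    have "?l \<in> topspace (K11 id 1)" "?s \<in> topspace (K11 id 1)"
      by (rule conjunct2[OF path_component_in_topspace[OF l]] conjunct1[OF path_component_in_topspace[OF s]])+
    moreover have "?r \<in> topspace (K11 id 1)"
      using subsetD[OF path_components_of_subset r] b(1) by (simp add: K11_zero_def)
    ultimately have "?s (1/2) \<in> parity_set True"
      using parity_path_component[OF l unit_loop_odd] by (intro loop_sum_odd[OF \<zeta>])
    from parity_path_component[OF s this] base_loop_even show False by contradiction
  qed
  then show ?thesis by (simp add: group_def group_axioms_def)
qed

end
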